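(* Let $G$ be a compact group and let $1<p<\infty$. Then the Banach space $\ell_{sch}^{p}(\widehat{G})$ is uniformly convex and uniformly smooth. Moreover, $\ell_{sch}^{p}(\widehat{G})$ is reflexive.
   Context: $G$ is a compact topological group. $\widehat{G}$ is its unitary dual, the set of equivalence classes $[\xi]$ of strongly continuous irreducible unitary representations $\xi:G\to\mathcal{U}(\mathcal{H}_\xi)$; one representative is fixed per class. Each $\mathcal{H}_\xi$ is a finite-dimensional complex Hilbert space and $\dim(\xi):=\dim(\mathcal{H}_\xi)$. $\mathcal{M}(\widehat{G})$ is the complex vector space (pointwise operations) of all maps $H$ assigning to each $[\xi]\in\widehat{G}$ a linear operator $H(\xi)\in\mathcal{L}(\mathcal{H}_\xi)$. For $1\le p<\infty$, $\|A\|_{\mathcal{S}^p(\mathcal{H}_\xi)}=(\mathrm{Tr}(|A|^p))^{1/p}$ is the Schatten norm, and $\ell_{sch}^{p}(\widehat{G})$ is the Banach space of all $H\in\mathcal{M}(\widehat{G})$ with $$\|H\|_{\ell_{sch}^{p}(\widehat{G})}:=\Big(\sum_{[\xi]\in\widehat{G}}\dim(\xi)\,\|H(\xi)\|_{\mathcal{S}^{p}(\mathcal{H}_{\xi})}^{p}\Big)^{1/p}<\infty.$$ For a Banach space $X$, the modulus of convexity is $\delta_X(\varepsilon)=\inf\{1-\|\frac{x+y}{2}\|: \|x\|=\|y\|=1,\ \|x-y\|=\varepsilon\}$ for $0<\varepsilon\le 2$, and the modulus of smoothness is $\rho_X(t)=\sup\{\frac{\|x+ty\|+\|x-ty\|}{2}-1: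 \|x\|=\|y\|=1\}$ for $t>0$. $X$ is uniformly convex if $\delta_X(\varepsilon)>0$ for every $0<\varepsilon\le 2$, and uniformly smooth if $\lim_{t\to0}\rho_X(t)/t=0$. *)

theory Defs
  imports
    "HOL-Algebra.Module"
    "HOL-Algebra.Coset"
    "HOL-Analysis.Product_Topology"
    "HOL-Analysis.Infinite_Sum"
    "Jordan_Normal_Form.Schur_Decomposition"
    "Jordan_Normal_Form.VS_Connect"
begin

hide_const (open) Polynomial.smult

section \<open>Compact groups and their unitary duals\<close>

locale topological_group = group G for G (structure) +
  fixes T :: "'a topology"
  assumes topspace_eq: "topspace T = carrier G"
    and continuous_mult: "continuous_map (prod_topology T T) T (\<lambda>(x, y). x \<otimes> y)"
    and continuous_inv: "continuous_map T T (\<lambda>x. inv x)"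

locale compact_topological_group = topological_group +
  assumes compact: "compact_space T"

definition unitary_group :: "nat \<Rightarrow> complex mat monoid" where
  "unitary_group n =
     \<lparr>carrier = {U \<in> carrier_mat n n. mat_adjoint U * U = 1\<^sub>m n \<and> U * mat_adjoint U = 1\<^sub>m n},
      mult = (*), one = 1\<^sub>m n\<rparr>"

text \<open>
  Representation spaces are \<open>\<complex>\<^sup>n\<close> with the standard inner product: every finite-dimensional
  unitary representation is unitarily equivalent to such a one by a choice of orthonormal basis.
  A representation is the pair of \<open>n\<close> and a homomorphism into \<open>\<U>(\<complex>\<^sup>n)\<close>. Since \<open>n\<close> is finite,
  strong continuity (\<open>g \<mapsto> \<pi>(g) v\<close> is continuous for every \<open>v\<close>) can be read off the coordinates
  of \<open>\<pi>(g) v\<close>. Values outside the group are fixed by extensionality.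
\<close>

type_synonym 'g rep = "nat \<times> ('g \<Rightarrow> complex mat)"

definition unitary_rep ::
  "('g, 'm) monoid_scheme \<Rightarrow> 'g topology \<Rightarrow> nat \<Rightarrow> ('g \<Rightarrow> complex mat) \<Rightarrow> bool" where
  "unitary_rep G T n \<pi> \<longleftrightarrow>
     \<pi> \<in> hom G (unitary_group n) \<and> \<pi> \<in> extensional (carrier G) \<and>
     (\<forall>v \<in> carrier_vec n. \<forall>i < n. continuous_map T euclidean (\<lambda>g. vec_index (\<pi> g *\<^sub>v v) i))"

definition irreducible_rep ::
  "('g, 'm) monoid_scheme \<Rightarrow> nat \<Rightarrow> ('g \<Rightarrow> complex mat) \<Rightarrow> bool" where
  "irreducible_rep G n \<pi> \<longleftrightarrow>
     n \<noteq> 0 \<and>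
     (\<forall>W. VectorSpace.subspace class_ring W (module_vec TYPE(complex) n) \<and>
          (\<forall>g \<in> carrier G. \<forall>w \<in> W. \<pi> g *\<^sub>v w \<in> W) \<longrightarrow>
          W = {0\<^sub>v n} \<or> W = carrier_vec n)"

definition irreps :: "('g, 'm) monoid_scheme \<Rightarrow> 'g topology \<Rightarrow> 'g rep set" where
  "irreps G T = {(n, \<pi>). unitary_rep G T n \<pi> \<and> irreducible_rep G n \<pi>}"

definition unitary_equivalence ::
  "('g, 'm) monoid_scheme \<Rightarrow> 'g topology \<Rightarrow> ('g rep \<times> 'g rep) set" where
  "unitary_equivalence G T =
     {((n, \<pi>), (m, \<sigma>)). (n, \<pi>) \<in> irreps G T \<and> (m, \<sigma>) \<in> irreps G T \<and> n = m \<and>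
        (\<exists>U \<in> carrier (unitary_group n). \<forall>g \<in> carrier G. U * \<pi> g = \<sigma> g * U)}"

definition unitary_dual :: "('g, 'm) monoid_scheme \<Rightarrow> 'g topology \<Rightarrow> 'g rep set set" where
  "unitary_dual G T = irreps G T // unitary_equivalence G T"

definition choice_of_reps ::
  "('g, 'm) monoid_scheme \<Rightarrow> 'g topology \<Rightarrow> ('g rep set \<Rightarrow> 'g rep) \<Rightarrow> bool" where
  "choice_of_reps G T \<xi> \<longleftrightarrow> (\<forall>c \<in> unitary_dual G T. \<xi> c \<in> c)"

abbreviation rep_dim :: "'g rep \<Rightarrow> nat" where
  "rep_dim \<equiv> fst"


section \<open>Schatten norms\<close>

text \<open>
  Functional calculus of a Hermitian matrix: \<open>f(U diag(d) U\<^sup>*) = U diag(f \<circ> d) U\<^sup>*\<close>. The result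
  does not depend on the unitary diagonalisation, and one exists for every Hermitian matrix.
\<close>

definition hermitian_calculus :: "(real \<Rightarrow> real) \<Rightarrow> complex mat \<Rightarrow> complex mat" where
  "hermitian_calculus f A =
     (let n = dim_row A in
      THE B. \<exists>U \<in> carrier (unitary_group n). \<exists>d :: nat \<Rightarrow> real.
        A = U * mat_diag n (\<lambda>i. complex_of_real (d i)) * mat_adjoint U \<and>
        B = U * mat_diag n (\<lambda>i. complex_of_real (f (d i))) * mat_adjoint U)"

definition mat_abs :: "complex mat \<Rightarrow> complex mat" where
  "mat_abs A = hermitian_calculus sqrt (mat_adjoint A * A)"

definition mat_trace :: "complex mat \<Rightarrow> complex" where
  "mat_trace A = (\<Sum>i < dim_row A. A $$ (i, i))"

definition schatten_norm :: "real \<Rightarrow> complex mat \<Rightarrow> real" where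
  "schatten_norm p A =
     Re (mat_trace (hermitian_calculus (\<lambda>s. s powr p) (mat_abs A))) powr (1 / p)"


section \<open>Complex Banach spaces\<close>

record ('k, 'x) normed_module = "('k, 'x) module" +
  mnorm :: "'x \<Rightarrow> real" ("\<parallel>_\<parallel>\<index>")

locale complex_normed_space = vectorspace class_ring X
  for X :: "(complex, 'x, 'm) normed_module_scheme" (structure) +
  assumes norm_eq_zero: "x \<in> carrier X \<Longrightarrow> \<parallel>x\<parallel> = 0 \<longleftrightarrow> x = \<zero>"
    and norm_triangle: "\<lbrakk>x \<in> carrier X; y \<in> carrier X\<rbrakk> \<Longrightarrow> \<parallel>x \<oplus> y\<parallel> \<le> \<parallel>x\<parallel> + \<parallel>y\<parallel>"
    and norm_smult: "x \<in> carrier X \<Longrightarrow> \<parallel>a \<odot> x\<parallel> = cmod a * \<parallel>x\<parallel>"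

locale complex_banach_space = complex_normed_space +
  assumes complete:
    "\<lbrakk>\<And>n :: nat. s n \<in> carrier X;
      \<And>e. e > 0 \<Longrightarrow> \<exists>N. \<forall>m \<ge> N. \<forall>n \<ge> N. \<parallel>s m \<ominus> s n\<parallel> < e\<rbrakk>
     \<Longrightarrow> \<exists>x \<in> carrier X. (\<lambda>n. \<parallel>s n \<ominus> x\<parallel>) \<longlonglongrightarrow> 0"

text \<open>
  In the two moduli, infimum and supremum range over bounded sets of reals, which for \<open>X \<noteq> {0}\<close>
  are nonempty because the scalars are complex.
\<close>

definition modulus_of_convexity ::
  "(complex, 'x, 'm) normed_module_scheme \<Rightarrow> real \<Rightarrow> real" where
  "modulus_of_convexity X \<epsilon> =
     Inf {1 - \<parallel>complex_of_real (1 / 2) \<odot>\<^bsub>X\<^esub> (x \<oplus>\<^bsub>X\<^esub> y)\<parallel>\<^bsub>X\<^esub> | x y.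
            x \<in> carrier X \<and> y \<in> carrier X \<and> \<parallel>x\<parallel>\<^bsub>X\<^esub> = 1 \<and> \<parallel>y\<parallel>\<^bsub>X\<^esub> = 1 \<and>
            \<parallel>x \<ominus>\<^bsub>X\<^esub> y\<parallel>\<^bsub>X\<^esub> = \<epsilon>}"

definition modulus_of_smoothness ::
  "(complex, 'x, 'm) normed_module_scheme \<Rightarrow> real \<Rightarrow> real" where
  "modulus_of_smoothness X t =
     Sup {(\<parallel>x \<oplus>\<^bsub>X\<^esub> complex_of_real t \<odot>\<^bsub>X\<^esub> y\<parallel>\<^bsub>X\<^esub>
           + \<parallel>x \<ominus>\<^bsub>X\<^esub> complex_of_real t \<odot>\<^bsub>X\<^esub> y\<parallel>\<^bsub>X\<^esub>) / 2 - 1 | x y.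
            x \<in> carrier X \<and> y \<in> carrier X \<and> \<parallel>x\<parallel>\<^bsub>X\<^esub> = 1 \<and> \<parallel>y\<parallel>\<^bsub>X\<^esub> = 1}"

definition uniformly_convex :: "(complex, 'x, 'm) normed_module_scheme \<Rightarrow> bool" where
  "uniformly_convex X \<longleftrightarrow> (\<forall>\<epsilon>. 0 < \<epsilon> \<and> \<epsilon> \<le> 2 \<longrightarrow> modulus_of_convexity X \<epsilon> > 0)"

definition uniformly_smooth :: "(complex, 'x, 'm) normed_module_scheme \<Rightarrow> bool" where
  "uniformly_smooth X \<longleftrightarrow> ((\<lambda>t. modulus_of_smoothness X t / t) \<longlongrightarrow> 0) (at_right 0)"

text \<open>
  The ring fields \<open>mult\<close> and \<open>one\<close> of a module record carry no meaning.
\<close>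

definition dual_space ::
  "(complex, 'x, 'm) normed_module_scheme \<Rightarrow> (complex, 'x \<Rightarrow> complex) normed_module" where
  "dual_space X =
     \<lparr>carrier = {f \<in> extensional (carrier X).
        (\<forall>x \<in> carrier X. \<forall>y \<in> carrier X. f (x \<oplus>\<^bsub>X\<^esub> y) = f x + f y) \<and>
        (\<forall>a. \<forall>x \<in> carrier X. f (a \<odot>\<^bsub>X\<^esub> x) = a * f x) \<and>
        (\<exists>C. \<forall>x \<in> carrier X. cmod (f x) \<le> C * \<parallel>x\<parallel>\<^bsub>X\<^esub>)},
      mult = undefined,
      one = undefined,
      zero = (\<lambda>x \<in> carrier X. 0),
      add = (\<lambda>f g. \<lambda>x \<in> carrier X. f x + g x),
      smult = (\<lambda>a f. \<lambda>x \<in> carrier X. a * f x),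
      mnorm = (\<lambda>f. SUP x \<in> {x \<in> carrier X. \<parallel>x\<parallel>\<^bsub>X\<^esub> \<le> 1}. cmod (f x))\<rparr>"

definition canonical_embedding ::
  "(complex, 'x, 'm) normed_module_scheme \<Rightarrow> 'x \<Rightarrow> ('x \<Rightarrow> complex) \<Rightarrow> complex" where
  "canonical_embedding X x = (\<lambda>f \<in> carrier (dual_space X). f x)"

definition reflexive_space :: "(complex, 'x, 'm) normed_module_scheme \<Rightarrow> bool" where
  "reflexive_space X \<longleftrightarrow>
     canonical_embedding X ` carrier X = carrier (dual_space (dual_space X))"


section \<open>Schatten \<open>\<ell>\<^sup>p\<close> spaces on the unitary dual\<close>

definition operator_fields ::
  "('g, 'm) monoid_scheme \<Rightarrow> 'g topology \<Rightarrow> ('g rep set \<Rightarrow> 'g rep) \<Rightarrow>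
   (complex, 'g rep set \<Rightarrow> complex mat) module" where
  "operator_fields G T \<xi> =
     \<lparr>carrier = (\<Pi>\<^sub>E c \<in> unitary_dual G T. carrier_mat (rep_dim (\<xi> c)) (rep_dim (\<xi> c))),
      mult = undefined,
      one = undefined,
      zero = (\<lambda>c \<in> unitary_dual G T. 0\<^sub>m (rep_dim (\<xi> c)) (rep_dim (\<xi> c))),
      add = (\<lambda>H K. \<lambda>c \<in> unitary_dual G T. H c + K c),
      smult = (\<lambda>a H. \<lambda>c \<in> unitary_dual G T. a \<cdot>\<^sub>m H c)\<rparr>"

definition ell_sch ::
  "('g, 'm) monoid_scheme \<Rightarrow> 'g topology \<Rightarrow> ('g rep set \<Rightarrow> 'g rep) \<Rightarrow> real \<Rightarrow>
   (complex, 'g rep set \<Rightarrow> complex mat) normed_module" where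
  "ell_sch G T \<xi> p =
     \<lparr>carrier = {H \<in> carrier (operator_fields G T \<xi>).
        (\<lambda>c. real (rep_dim (\<xi> c)) * schatten_norm p (H c) powr p) summable_on unitary_dual G T},
      mult = undefined,
      one = undefined,
      zero = zero (operator_fields G T \<xi>),
      add = add (operator_fields G T \<xi>),
      smult = smult (operator_fields G T \<xi>),
      mnorm = (\<lambda>H. (\<Sum>\<^sub>\<infinity>c \<in> unitary_dual G T.
        real (rep_dim (\<xi> c)) * schatten_norm p (H c) powr p) powr (1 / p))\<rparr>"

end

theory Submission
  imports Defs "Jordan_Normal_Form.Spectral_Radius" "HOL-Analysis.Convex" "HOL-Analysis.L2_Norm"
begin

hide_const (open) Polynomial.smult

text \<open>
  The space is a weighted \<open>\<ell>\<^sup>p\<close>-sum of Schatten classes of \<open>n \<times> n\<close> matrices, one for each point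
  of the unitary dual, and everything is derived from two facts about a single matrix algebra. The
  bookkeeping quantity is the \<open>p\<close>-th power of the Schatten norm, \<open>schatten_energy p A\<close>, since it
  adds up over the points of the dual.

  The first fact is duality. \<open>schatten_Young\<close> bounds the Hilbert-Schmidt product of \<open>A\<close> and \<open>B\<close> by
  the energies of \<open>A\<close> at \<open>p\<close> and of \<open>B\<close> at the conjugate exponent \<open>q\<close>, and \<open>schatten_norming\<close> gives
  equality for \<open>B = A |A|\<^sup>p\<^sup>-\<^sup>2\<close>. Scaling and summing produce Hoelder's inequality for fields of
  operators together with its converse \<open>lp_by_duality\<close>: a field whose finite pairings are bounded by
  \<open>C\<close> times the \<open>q\<close>-norm lies in \<open>\<ell>\<^sup>p\<close> with norm at most \<open>C\<close>. The triangle inequality, completeness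
  and the representation of functionals (\<open>lp_dual_representation\<close>) are all instances of this
  converse. Reflexivity follows because the dual of the \<open>p\<close>-space is the \<open>q\<close>-space, whose dual is
  the \<open>p\<close>-space again, through the same pairing.

  The second fact is the inequality \<open>schatten_energy_Clarkson\<close> of Clarkson and McCarthy for
  \<open>0 < p \<le> 2\<close>. It sums over the dual and says that the \<open>p\<close>-space is uniformly smooth for
  \<open>1 < p \<le> 2\<close>. For larger \<open>p\<close> the gram map \<open>x \<mapsto> x\<^sup>* x\<close> carries the \<open>2s\<close>-space into the \<open>s\<close>-space and
  squares the norm; along a line it equals an affine function of the parameter up to a quadratic
  error, so that uniform smoothness passes from \<open>s\<close> to \<open>2s\<close> (\<open>lp_smooth_double\<close>), and by induction
  it holds for all \<open>p > 1\<close>.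

  Uniform convexity at \<open>p\<close> is uniform smoothness at \<open>q\<close> (\<open>lp_midpoint_bound\<close>): when \<open>f\<close> norms
  \<open>x + y\<close> and \<open>g\<close> norms \<open>x - y\<close>, the number \<open>\<parallel>x + y\<parallel> + t \<parallel>x - y\<parallel>\<close> is the value of the pairing of
  \<open>x\<close> with \<open>f + t g\<close> plus that of \<open>y\<close> with \<open>f - t g\<close>, hence at most \<open>\<parallel>f + t g\<parallel> + \<parallel>f - t g\<parallel>\<close>.

  The group enters through its dual: every representation space is nonzero, and the dual is
  nonempty, because it contains the class of the trivial representation. This provides the unit
  vectors without which the two moduli would be empty expressions.
\<close>

section \<open>Adjoints and unitary matrices\<close>

lemma mat_adjoint_carrier [simp]:
  "A \<in> carrier_mat nr nc \<Longrightarrow> mat_adjoint A \<in> carrier_mat nc nr"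
  unfolding mat_adjoint_def by (auto simp: mat_of_rows_def)

lemma mat_adjoint_dim [simp]:
  "dim_row (mat_adjoint A) = dim_col A" "dim_col (mat_adjoint A) = dim_row A"
  unfolding mat_adjoint_def by (auto simp: mat_of_rows_def)

lemma mat_adjoint_index [simp]:
  "i < dim_col A \<Longrightarrow> j < dim_row A \<Longrightarrow> mat_adjoint A $$ (i, j) = conjugate (A $$ (j, i))"
  unfolding mat_adjoint_def by (auto simp: mat_of_rows_def)

lemma mat_mult_index:
  "A \<in> carrier_mat n k \<Longrightarrow> B \<in> carrier_mat k m \<Longrightarrow> i < n \<Longrightarrow> j < m \<Longrightarrow>
   (A * B) $$ (i, j) = (\<Sum>l<k. A $$ (i, l) * B $$ (l, j))"
  by (auto simp: scalar_prod_def lessThan_atLeast0 intro!: sum.cong)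

lemma mat_adjoint_mult:
  fixes A B :: "complex mat"
  assumes "A \<in> carrier_mat n k" "B \<in> carrier_mat k m"
  shows "mat_adjoint (A * B) = mat_adjoint B * mat_adjoint A"
proof (rule eq_matI)
  fix i j assume "i < dim_row (mat_adjoint B * mat_adjoint A)" "j < dim_col (mat_adjoint B * mat_adjoint A)"
  hence ij: "i < m" "j < n" using assms by auto
  show "mat_adjoint (A * B) $$ (i, j) = (mat_adjoint B * mat_adjoint A) $$ (i, j)"
    using ij assms
    by (simp add: mat_mult_index[where n = m and k = k and m = n] mat_mult_index[where n = n and k = k and m = m]
          mult.commute del: index_mult_mat(1))
qed (use assms in auto)

lemma mat_adjoint_adjoint [simp]:
  fixes A :: "complex mat"
  shows "mat_adjoint (mat_adjoint A) = A"
  by (rule eq_matI) auto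

lemma mat_adjoint_add:
  fixes A B :: "complex mat"
  assumes "A \<in> carrier_mat n m" "B \<in> carrier_mat n m"
  shows "mat_adjoint (A + B) = mat_adjoint A + mat_adjoint B"
  by (rule eq_matI) (use assms in auto)

lemma mat_adjoint_diag:
  "mat_adjoint (mat_diag n (\<lambda>i. complex_of_real (d i))) = mat_diag n (\<lambda>i. complex_of_real (d i))"
  by (rule eq_matI) (auto simp: mat_diag_def)

lemma mat_mult_one1:
  fixes A :: "complex mat"
  assumes "dim_col A = n" shows "A * 1\<^sub>m n = A" 
proof -
  have "A \<in> carrier_mat (dim_row A) n" using assms by (rule carrier_matI[OF refl])
  thus ?thesis by (rule right_mult_one_mat)
qed
lemma mat_mult_one2:
  fixes A :: "complex mat"
  assumes "dim_row A = n" shows "1\<^sub>m n * A = A" 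
proof -
  have "A \<in> carrier_mat n (dim_col A)" using assms by (rule carrier_matI[OF _ refl])
  thus ?thesis by (rule left_mult_one_mat)
qed
text \<open>
  Associativity and the two lemmas before it are stated with dimensions instead of carrier sets, so
  that the simplifier can discharge their premises in long products.
\<close>

lemma mat_mult_assoc:
  fixes A B C :: "complex mat"
  assumes "dim_col A = dim_row B" "dim_col B = dim_row C"
  shows "A * B * C = A * (B * C)"
proof -
  have 1: "A \<in> carrier_mat (dim_row A) (dim_row B)" using assms(1) by (rule carrier_matI[OF refl])
  have 2: "B \<in> carrier_mat (dim_row B) (dim_row C)" using assms(2) by (rule carrier_matI[OF refl])
  have 3: "C \<in> carrier_mat (dim_row C) (dim_col C)" by (rule carrier_matI[OF refl refl])
  show ?thesis by (rule assoc_mult_mat[OF 1 2 3])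
qed

lemma mat_adjoint_mult':
  fixes A B :: "complex mat"
  assumes "dim_col A = dim_row B"
  shows "mat_adjoint (A * B) = mat_adjoint B * mat_adjoint A"
proof -
  have "A \<in> carrier_mat (dim_row A) (dim_row B)" using assms by (rule carrier_matI[OF refl])
  thus ?thesis by (rule mat_adjoint_mult) (rule carrier_matI[OF refl refl])
qed

lemma mat_diag_dims [simp]: "dim_row (mat_diag n f) = n" "dim_col (mat_diag n f) = n"
  by (simp_all add: mat_diag_def)

lemma unitary_groupD:
  assumes "U \<in> carrier (unitary_group n)"
  shows "U \<in> carrier_mat n n" "mat_adjoint U * U = 1\<^sub>m n" "U * mat_adjoint U = 1\<^sub>m n"
  using assms by (auto simp: unitary_group_def)

lemma unitary_groupI:
  assumes "U \<in> carrier_mat n n" "mat_adjoint U * U = 1\<^sub>m n"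
  shows "U \<in> carrier (unitary_group n)"
  using assms mat_mult_left_right_inverse[of "mat_adjoint U" n U] by (auto simp: unitary_group_def)

lemma unitary_mult:
  assumes "U \<in> carrier (unitary_group n)" "V \<in> carrier (unitary_group n)"
  shows "U * V \<in> carrier (unitary_group n)"
proof (rule unitary_groupI)
  note U = unitary_groupD[OF assms(1)] and V = unitary_groupD[OF assms(2)]
  show "U * V \<in> carrier_mat n n" using U V by auto
  have "mat_adjoint (U * V) * (U * V) = mat_adjoint V * (mat_adjoint U * (U * V))"
    using U(1) V(1) by (simp add: mat_adjoint_mult assoc_mult_mat[of _ n n _ n _ n])
  also have "mat_adjoint U * (U * V) = V"
    using U V assoc_mult_mat[of "mat_adjoint U" n n U n V n] by simp
  finally show "mat_adjoint (U * V) * (U * V) = 1\<^sub>m n" using V by simp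
qed

lemma unitary_adjoint:
  assumes "U \<in> carrier (unitary_group n)"
  shows "mat_adjoint U \<in> carrier (unitary_group n)"
  using assms by (auto simp: unitary_group_def)

lemma unitary_cancel:
  assumes "U \<in> carrier (unitary_group n)" "dim_row X = n"
  shows "U * (mat_adjoint U * X) = X" "mat_adjoint U * (U * X) = X"
proof -
  note U = unitary_groupD[OF assms(1)]
  have "U * (mat_adjoint U * X) = (U * mat_adjoint U) * X"
    by (rule mat_mult_assoc[symmetric]) (use U(1) assms(2) in auto)
  thus "U * (mat_adjoint U * X) = X" using U(3) mat_mult_one2[OF assms(2)] by simp
  have "mat_adjoint U * (U * X) = (mat_adjoint U * U) * X"
    by (rule mat_mult_assoc[symmetric]) (use U(1) assms(2) in auto)
  thus "mat_adjoint U * (U * X) = X" using U(2) mat_mult_one2[OF assms(2)] by simp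
qed

lemma unitary_dims:
  assumes "U \<in> carrier (unitary_group n)"
  shows "dim_row U = n" "dim_col U = n"
  using unitary_groupD(1)[OF assms] by auto

section \<open>The spectral theorem for Hermitian matrices\<close>

text \<open>
  Gram-Schmidt, started from a basis that begins with \<open>v\<close>, yields orthogonal nonzero vectors;
  dividing each by its length gives the columns of \<open>W\<close>.
\<close>

lemma unitary_first_column:
  fixes v :: "complex vec"
  assumes v: "v \<in> carrier_vec n" and v0: "v \<noteq> 0\<^sub>v n" and n: "n > 0"
  shows "\<exists>W \<in> carrier (unitary_group n). \<exists>a. col W 0 = a \<cdot>\<^sub>v v"
proof -
  define b where "b = basis_completion v"
  define ws where "ws = gram_schmidt n b"
  interpret cof_vec_space n "TYPE(complex)" .
  from basis_completion[OF v v0, folded b_def]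
  have dist_b: "distinct b" and indep: "\<not> lin_dep (set b)" and b: "set b \<subseteq> carrier_vec n"
    and hdb: "hd b = v" and len_b: "length b = n" by auto
  from hdb len_b n obtain vs where bv: "b = v # vs" by (cases b, auto)
  from gram_schmidt_result[OF b dist_b indep refl, folded ws_def]
  have ws: "set ws \<subseteq> carrier_vec n" "corthogonal ws" "length ws = n"
    by (auto simp: len_b)
  from gram_schmidt_hd[OF v, of vs, folded bv] have hdws: "hd ws = v" unfolding ws_def .
  have ws0: "ws ! 0 = v" using hdws ws(3) n by (cases ws) auto
  define r where "r j = sqrt (\<Sum>k<n. (cmod (ws ! j $ k))\<^sup>2)" for j
  have wsc: "ws ! j \<in> carrier_vec n" if "j < n" for j using ws that by auto
  have ip: "ws ! j \<bullet>c ws ! i = (\<Sum>k<n. ws ! j $ k * cnj (ws ! i $ k))" if "i < n" "j < n" for i j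
    using wsc[OF that(1)] wsc[OF that(2)]
    by (auto simp: scalar_prod_def lessThan_atLeast0 intro!: sum.cong)
  have ipr: "ws ! j \<bullet>c ws ! j = complex_of_real ((r j)\<^sup>2)" if "j < n" for j
    unfolding ip[OF that that] r_def
    by (simp add: sum_nonneg complex_norm_square[symmetric] del: of_real_power)
  have r0: "r j \<noteq> 0" if "j < n" for j
    using corthogonalD[OF ws(2), of j j] ws(3) that ipr[OF that] by auto
  define W where "W = mat n n (\<lambda>(i, j). ws ! j $ i / complex_of_real (r j))"
  have W: "W \<in> carrier_mat n n" by (simp add: W_def)
  have "mat_adjoint W * W = 1\<^sub>m n"
  proof (rule eq_matI)
    fix i j assume "i < dim_row (1\<^sub>m n :: complex mat)" "j < dim_col (1\<^sub>m n :: complex mat)"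
    hence ij: "i < n" "j < n" by auto
    have "(mat_adjoint W * W) $$ (i, j) = (\<Sum>k<n. cnj (W $$ (k, i)) * W $$ (k, j))"
      using ij W by (simp add: mat_mult_index[where n = n and k = n and m = n] del: index_mult_mat(1))
    also have "\<dots> = (ws ! j \<bullet>c ws ! i) / (complex_of_real (r i) * complex_of_real (r j))"
      unfolding ip[OF ij] sum_divide_distrib using ij
      by (intro sum.cong) (auto simp: W_def mult.commute)
    also have "\<dots> = 1\<^sub>m n $$ (i, j)"
    proof (cases "i = j")
      case True
      thus ?thesis using ij r0[of j] ipr[of j] by (simp add: power2_eq_square)
    next
      case False
      hence "ws ! j \<bullet>c ws ! i = 0" using corthogonalD[OF ws(2), of j i] ws(3) ij by auto
      thus ?thesis using False ij by simp
    qed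
    finally show "(mat_adjoint W * W) $$ (i, j) = 1\<^sub>m n $$ (i, j)" .
  qed (use W in auto)
  hence "W \<in> carrier (unitary_group n)" using W by (rule unitary_groupI[rotated])
  moreover have "col W 0 = (1 / complex_of_real (r 0)) \<cdot>\<^sub>v v"
    by (rule eq_vecI) (use n v ws0 in \<open>auto simp: W_def\<close>)
  ultimately show ?thesis by blast
qed

lemma adjoint_block_diag:
  fixes A D :: "complex mat"
  assumes "A \<in> carrier_mat k k" "D \<in> carrier_mat m m"
  shows "mat_adjoint (four_block_mat A (0\<^sub>m k m) (0\<^sub>m m k) D)
       = four_block_mat (mat_adjoint A) (0\<^sub>m k m) (0\<^sub>m m k) (mat_adjoint D)"
  by (rule eq_matI) (use assms in auto)

lemma mult_block_diag:
  fixes A D :: "complex mat"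
  assumes "A \<in> carrier_mat k k" "D \<in> carrier_mat m m" "A' \<in> carrier_mat k k" "D' \<in> carrier_mat m m"
  shows "four_block_mat A (0\<^sub>m k m) (0\<^sub>m m k) D * four_block_mat A' (0\<^sub>m k m) (0\<^sub>m m k) D'
       = four_block_mat (A * A') (0\<^sub>m k m) (0\<^sub>m m k) (D * D')"
  using assms by (subst mult_four_block_mat[of _ k k _ m _ m _ _ k _ m]) auto

text \<open>
  By induction on the size: a unitary matrix whose first column is an eigenvector conjugates a
  Hermitian matrix into the direct sum of a scalar, which is real, and a smaller Hermitian matrix.
\<close>

theorem hermitian_unitary_diagonalization:
  assumes "A \<in> carrier_mat n n" "mat_adjoint A = A"
  shows "\<exists>U \<in> carrier (unitary_group n). \<exists>d :: nat \<Rightarrow> real.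
           A = U * mat_diag n (\<lambda>i. complex_of_real (d i)) * mat_adjoint U"
  using assms
proof (induction n arbitrary: A)
  case 0
  have "1\<^sub>m 0 \<in> carrier (unitary_group 0)" by (rule unitary_groupI) auto
  moreover have "A = 1\<^sub>m 0 * mat_diag 0 (\<lambda>i. complex_of_real ((\<lambda>_. 0) i)) * mat_adjoint (1\<^sub>m 0)"
    using 0 by (intro eq_matI) auto
  ultimately show ?case by fast
next
  case (Suc m)
  let ?n = "Suc m"
  have A: "A \<in> carrier_mat ?n ?n" by fact
  obtain e where "e \<in> spectrum A" using spectrum_non_empty[OF A] by auto
  then obtain v where v: "v \<in> carrier_vec ?n" "v \<noteq> 0\<^sub>v ?n" "A *\<^sub>v v = e \<cdot>\<^sub>v v"
    using A by (auto simp: spectrum_def eigenvalue_def eigenvector_def)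
  obtain W a where W: "W \<in> carrier (unitary_group ?n)" and Wv: "col W 0 = a \<cdot>\<^sub>v v"
    using unitary_first_column[OF v(1,2)] by auto
  note Wu = unitary_groupD[OF W]
  define A' where "A' = mat_adjoint W * A * W"
  have A': "A' \<in> carrier_mat ?n ?n" using A Wu by (auto simp: A'_def)
  have A'h: "mat_adjoint A' = A'"
    unfolding A'_def using A Wu(1) Suc.prems(2)
    by (simp add: mat_adjoint_mult[of _ ?n ?n _ ?n] assoc_mult_mat[of _ ?n ?n _ ?n _ ?n])
  have AW: "A *\<^sub>v col W 0 = e \<cdot>\<^sub>v col W 0"
    unfolding Wv using v A by (simp add: mult_mat_vec smult_smult_assoc mult.commute)
  have c0: "col A' 0 = e \<cdot>\<^sub>v unit_vec ?n 0"
  proof -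
    have "col A' 0 = mat_adjoint W *\<^sub>v (A *\<^sub>v col W 0)"
      unfolding A'_def using A Wu(1)
      by (simp add: assoc_mult_mat[of _ ?n ?n _ ?n _ ?n] col_mult2[of _ ?n ?n _ ?n] del: col_mult)
    also have "\<dots> = e \<cdot>\<^sub>v (mat_adjoint W *\<^sub>v col W 0)"
      unfolding AW by (rule mult_mat_vec[OF mat_adjoint_carrier[OF Wu(1)]]) (use Wu(1) in \<open>auto intro!: carrier_vecI\<close>)
    also have "mat_adjoint W *\<^sub>v col W 0 = col (mat_adjoint W * W) 0"
      by (rule col_mult2[symmetric, OF mat_adjoint_carrier[OF Wu(1)] Wu(1)]) simp
    also have "\<dots> = unit_vec ?n 0"
      by (simp add: Wu)
    finally show ?thesis .
  qed
  have col0: "A' $$ (i, 0) = (if i = 0 then e else 0)" if "i < ?n" for i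
    using arg_cong[OF c0, of "\<lambda>v. v $ i"] A' that by auto
  have herm: "A' $$ (i, j) = cnj (A' $$ (j, i))" if "i < ?n" "j < ?n" for i j
    using arg_cong[OF A'h, of "\<lambda>M. M $$ (i, j)"] A' that by auto
  have e: "e = complex_of_real (Re e)"
    using herm[of 0 0] col0[of 0] by (simp add: complex_eq_iff)
  define A3 where "A3 = mat m m (\<lambda>(i, j). A' $$ (Suc i, Suc j))"
  have A3: "A3 \<in> carrier_mat m m" by (simp add: A3_def)
  have A3h: "mat_adjoint A3 = A3"
    by (rule eq_matI) (auto simp: A3_def intro: herm[symmetric])
  obtain V d where V: "V \<in> carrier (unitary_group m)"
    and A3d: "A3 = V * mat_diag m (\<lambda>i. complex_of_real (d i)) * mat_adjoint V"
    using Suc.IH[OF A3 A3h] by blast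
  note Vu = unitary_groupD[OF V]
  define E where "E = mat 1 1 (\<lambda>_. e)"
  have E: "E \<in> carrier_mat 1 1" by (simp add: E_def)
  let ?D = "mat_diag m (\<lambda>i. complex_of_real (d i))"
  let ?B = "\<lambda>X Y. four_block_mat X (0\<^sub>m 1 m) (0\<^sub>m m 1) Y"
  have A'b: "A' = ?B E A3"
  proof (rule eq_matI)
    fix i j assume "i < dim_row (?B E A3)" "j < dim_col (?B E A3)"
    hence "i < ?n" "j < ?n" using E A3 by auto
    thus "A' $$ (i, j) = ?B E A3 $$ (i, j)"
      using E A3 col0 herm[of i j] by (auto simp: E_def A3_def)
  qed (use A' E A3 in auto)
  define d' where "d' i = (if i = 0 then Re e else d (i - 1))" for i
  have D': "mat_diag ?n (\<lambda>i. complex_of_real (d' i)) = ?B E ?D"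
    by (rule eq_matI) (auto simp: mat_diag_def E_def d'_def e[symmetric])
  define V' where "V' = ?B (1\<^sub>m 1) V"
  have V'a: "mat_adjoint V' = ?B (1\<^sub>m 1) (mat_adjoint V)"
    unfolding V'_def using Vu(1) by (subst adjoint_block_diag) (auto intro: arg_cong2[where f = "?B"])
  have V'c: "V' \<in> carrier_mat ?n ?n" unfolding V'_def
    using four_block_carrier_mat[of "1\<^sub>m 1" 1 1 V m m] Vu(1) by simp
  have V': "V' \<in> carrier (unitary_group ?n)"
  proof (rule unitary_groupI[OF V'c])
    show "mat_adjoint V' * V' = 1\<^sub>m ?n"
      unfolding V'a unfolding V'_def using Vu by (subst mult_block_diag) auto
  qed
  have "V' * ?B E ?D * mat_adjoint V' = A'"
    unfolding V'a unfolding V'_def using Vu(1) E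
    by (simp add: mult_block_diag[of _ 1 _ m] A'b A3d del: One_nat_def)
  hence "V' * mat_diag ?n (\<lambda>i. complex_of_real (d' i)) * mat_adjoint V' = mat_adjoint W * A * W"
    unfolding D' A'_def .
  hence "W * (V' * mat_diag ?n (\<lambda>i. complex_of_real (d' i)) * mat_adjoint V') * mat_adjoint W
       = W * (mat_adjoint W * A * W) * mat_adjoint W"
    by (simp only:)
  also have "\<dots> = A"
    using carrier_matD[OF A] Wu(3)
    by (simp add: mat_mult_assoc unitary_cancel[OF W] unitary_dims[OF W] mat_mult_one1)
  finally have "A = (W * V') * mat_diag ?n (\<lambda>i. complex_of_real (d' i)) * mat_adjoint (W * V')"
    by (simp add: mat_mult_assoc mat_adjoint_mult' unitary_dims[OF W] unitary_dims[OF V'])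
  thus ?case using unitary_mult[OF W V'] by blast
qed

section \<open>Functional calculus and singular values\<close>

text \<open>
  The matrix \<open>W = V\<^sup>* U\<close> intertwines the two diagonal matrices, so \<open>W\<^sub>i\<^sub>j\<close> vanishes unless
  \<open>d j = e i\<close>; therefore it intertwines the diagonal matrices of \<open>f \<circ> d\<close> and \<open>f \<circ> e\<close> as well. This is
  the uniqueness that the definite description in \<open>hermitian_calculus\<close> needs.
\<close>

lemma unitary_diag_cong:
  assumes U: "U \<in> carrier (unitary_group n)" and V: "V \<in> carrier (unitary_group n)"
    and eq: "U * mat_diag n (\<lambda>i. complex_of_real (d i)) * mat_adjoint U
           = V * mat_diag n (\<lambda>i. complex_of_real (e i)) * mat_adjoint V"
  shows "U * mat_diag n (\<lambda>i. complex_of_real (f (d i))) * mat_adjoint U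
       = V * mat_diag n (\<lambda>i. complex_of_real (f (e i))) * mat_adjoint V"
proof -
  note Uc = unitary_groupD[OF U] and Vc = unitary_groupD[OF V]
  let ?D = "\<lambda>d. mat_diag n (\<lambda>i. complex_of_real (d i))"
  define W where "W = mat_adjoint V * U"
  have W: "W \<in> carrier_mat n n" using Uc Vc by (auto simp: W_def)
  have "mat_adjoint V * (U * ?D d * mat_adjoint U) * U = mat_adjoint V * (V * ?D e * mat_adjoint V) * U"
    by (simp only: eq)
  hence WD: "W * ?D d = ?D e * W"
    unfolding W_def using Uc(2)
    by (simp add: mat_mult_assoc unitary_cancel[OF V] unitary_dims[OF U] unitary_dims[OF V] mat_mult_one1 mat_mult_one2)
  have "W * ?D (\<lambda>i. f (d i)) = ?D (\<lambda>i. f (e i)) * W"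
  proof (rule eq_matI)
    fix i j assume "i < dim_row (?D (\<lambda>i. f (e i)) * W)" "j < dim_col (?D (\<lambda>i. f (e i)) * W)"
    hence ij: "i < n" "j < n" using W by (auto simp: mat_diag_def)
    have "W $$ (i, j) * complex_of_real (d j) = complex_of_real (e i) * W $$ (i, j)"
      using arg_cong[OF WD, of "\<lambda>M. M $$ (i, j)"] ij W
      by (simp add: mat_diag_mult_left[of _ n n] mat_diag_mult_right[of _ n n])
    hence "W $$ (i, j) = 0 \<or> d j = e i" by auto
    hence "W $$ (i, j) * complex_of_real (f (d j)) = complex_of_real (f (e i)) * W $$ (i, j)" by auto
    thus "(W * ?D (\<lambda>i. f (d i))) $$ (i, j) = (?D (\<lambda>i. f (e i)) * W) $$ (i, j)"
      using ij W by (simp add: mat_diag_mult_left[of _ n n] mat_diag_mult_right[of _ n n])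
  qed (use W in \<open>auto simp: mat_diag_def\<close>)
  hence "V * (W * ?D (\<lambda>i. f (d i))) * mat_adjoint U = V * (?D (\<lambda>i. f (e i)) * W) * mat_adjoint U"
    by simp
  thus ?thesis
    unfolding W_def using Uc(3)
    by (simp add: mat_mult_assoc unitary_cancel[OF V] unitary_dims[OF U] unitary_dims[OF V] mat_mult_one1 mat_mult_one2)
qed

lemma hermitian_calculus_eq:
  assumes U: "U \<in> carrier (unitary_group n)"
    and A: "A = U * mat_diag n (\<lambda>i. complex_of_real (d i)) * mat_adjoint U"
  shows "hermitian_calculus f A = U * mat_diag n (\<lambda>i. complex_of_real (f (d i))) * mat_adjoint U"
proof -
  have n: "dim_row A = n" using A unitary_groupD(1)[OF U] by auto
  show ?thesis
    unfolding hermitian_calculus_def Let_def n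
  proof (rule the_equality)
    show "\<exists>V \<in> carrier (unitary_group n). \<exists>e. A = V * mat_diag n (\<lambda>i. complex_of_real (e i)) * mat_adjoint V \<and>
      U * mat_diag n (\<lambda>i. complex_of_real (f (d i))) * mat_adjoint U
       = V * mat_diag n (\<lambda>i. complex_of_real (f (e i))) * mat_adjoint V"
      using U A by blast
  next
    fix B assume "\<exists>V \<in> carrier (unitary_group n). \<exists>e. A = V * mat_diag n (\<lambda>i. complex_of_real (e i)) * mat_adjoint V \<and>
      B = V * mat_diag n (\<lambda>i. complex_of_real (f (e i))) * mat_adjoint V"
    thus "B = U * mat_diag n (\<lambda>i. complex_of_real (f (d i))) * mat_adjoint U"
      using unitary_diag_cong[OF U] A by metis
  qed
qed

text \<open>
  If \<open>v\<^sub>j\<close> denotes the \<open>j\<close>-th column of \<open>V\<close>, then \<open>col_sq (A * V) j\<close> is \<open>\<parallel>A v\<^sub>j\<parallel>\<^sup>2\<close>. All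
  estimates below compare these numbers for two orthonormal bases.
\<close>

definition col_sq :: "complex mat \<Rightarrow> nat \<Rightarrow> real" where
  "col_sq M j = (\<Sum>k<dim_row M. (cmod (M $$ (k, j)))\<^sup>2)"

lemma col_sq_nonneg [simp]: "0 \<le> col_sq M j"
  by (simp add: col_sq_def sum_nonneg)

lemma gram_diag_entry:
  assumes "M \<in> carrier_mat n m" "j < m"
  shows "(mat_adjoint M * M) $$ (j, j) = complex_of_real (col_sq M j)"
  using assms
  by (simp add: mat_mult_index[of _ m n _ m] col_sq_def complex_norm_square mult.commute
           del: index_mult_mat(1) of_real_power)

lemma conj_diag_entry:
  assumes "W \<in> carrier_mat n m" "j < m"
  shows "(mat_adjoint W * mat_diag n (\<lambda>i. complex_of_real (d i)) * W) $$ (j, j)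
       = complex_of_real (\<Sum>i<n. d i * (cmod (W $$ (i, j)))\<^sup>2)"
  using assms
  by (simp add: assoc_mult_mat[of _ m n _ n _ m] mat_diag_mult_left[of _ n m] mat_mult_index[of _ m n _ m]
      complex_norm_square mult_ac del: index_mult_mat(1) of_real_power)

lemma unitary_col_sum:
  assumes "W \<in> carrier (unitary_group n)" "j < n"
  shows "(\<Sum>i<n. (cmod (W $$ (i, j)))\<^sup>2) = 1"
proof -
  have "complex_of_real (col_sq W j) = 1"
    using gram_diag_entry[of W n n j] unitary_groupD[OF assms(1)] assms(2) by simp
  thus ?thesis using unitary_dims[OF assms(1)] by (simp add: col_sq_def del: of_real_sum)
qed

lemma unitary_row_sum:
  assumes "W \<in> carrier (unitary_group n)" "i < n"
  shows "(\<Sum>j<n. (cmod (W $$ (i, j)))\<^sup>2) = 1"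
  using unitary_col_sum[OF unitary_adjoint[OF assms(1)] assms(2)] unitary_groupD(1)[OF assms(1)] assms(2)
  by simp

text \<open>
  The columns of \<open>U\<close> are right singular vectors of \<open>A\<close> and the \<open>d i\<close> are the squares of its singular
  values.
\<close>

definition singular_system :: "nat \<Rightarrow> complex mat \<Rightarrow> complex mat \<Rightarrow> (nat \<Rightarrow> real) \<Rightarrow> bool" where
  "singular_system n A U d \<longleftrightarrow> A \<in> carrier_mat n n \<and> U \<in> carrier (unitary_group n) \<and>
     mat_adjoint A * A = U * mat_diag n (\<lambda>i. complex_of_real (d i)) * mat_adjoint U \<and> (\<forall>i<n. 0 \<le> d i)"

text \<open>
  Both sides are the diagonal entry \<open>(j, j)\<close> of \<open>Y\<^sup>* A\<^sup>* A Y\<close>. For unitary \<open>Y\<close> the squared moduli on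
  the right form a doubly stochastic array.
\<close>

lemma col_sq_mult:
  assumes A: "A \<in> carrier_mat n n" and U: "U \<in> carrier (unitary_group n)" and Y: "Y \<in> carrier_mat n m"
    and eq: "mat_adjoint A * A = U * mat_diag n (\<lambda>i. complex_of_real (d i)) * mat_adjoint U"
    and j: "j < m"
  shows "col_sq (A * Y) j = (\<Sum>i<n. d i * (cmod ((mat_adjoint U * Y) $$ (i, j)))\<^sup>2)"
proof -
  note Uc = unitary_groupD[OF U]
  let ?D = "mat_diag n (\<lambda>i. complex_of_real (d i))"
  have AY: "A * Y \<in> carrier_mat n m" using A Y by auto
  have UY: "mat_adjoint U * Y \<in> carrier_mat n m" using Uc(1) Y by auto
  have "mat_adjoint (A * Y) * (A * Y) = mat_adjoint Y * (mat_adjoint A * A) * Y"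
    using carrier_matD[OF A] carrier_matD[OF Y] by (simp add: mat_adjoint_mult' mat_mult_assoc)
  also have "\<dots> = mat_adjoint (mat_adjoint U * Y) * ?D * (mat_adjoint U * Y)"
    unfolding eq using unitary_dims[OF U] carrier_matD[OF Y] by (simp add: mat_adjoint_mult' mat_mult_assoc)
  finally have "complex_of_real (col_sq (A * Y) j)
      = complex_of_real (\<Sum>i<n. d i * (cmod ((mat_adjoint U * Y) $$ (i, j)))\<^sup>2)"
    using gram_diag_entry[OF AY j] conj_diag_entry[OF UY j, of d]
    by (simp del: index_mult_mat(1))
  thus ?thesis by (simp only: of_real_eq_iff)
qed

lemma col_sq_singular_basis:
  assumes "A \<in> carrier_mat n n" "U \<in> carrier (unitary_group n)"
    and "mat_adjoint A * A = U * mat_diag n (\<lambda>i. complex_of_real (d i)) * mat_adjoint U" and "j < n"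
  shows "col_sq (A * U) j = d j"
proof -
  have "(\<Sum>i<n. d i * (cmod ((1\<^sub>m n :: complex mat) $$ (i, j)))\<^sup>2) = (\<Sum>i<n. if i = j then d i else 0)"
    using assms(4) by (intro sum.cong) auto
  also have "\<dots> = d j" using assms(4) by (simp add: sum.delta)
  finally show ?thesis
    using col_sq_mult[OF assms(1,2) unitary_groupD(1)[OF assms(2)] assms(3,4)]
    unfolding unitary_groupD(2)[OF assms(2)] by simp
qed

lemma singular_systemI:
  assumes "A \<in> carrier_mat n n" "U \<in> carrier (unitary_group n)"
    and "mat_adjoint A * A = U * mat_diag n (\<lambda>i. complex_of_real (d i)) * mat_adjoint U"
  shows "singular_system n A U d"
  unfolding singular_system_def using assms col_sq_singular_basis[OF assms]
  by (metis col_sq_nonneg)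

lemma singular_system_exists:
  assumes A: "A \<in> carrier_mat n n"
  shows "\<exists>U d. singular_system n A U d"
proof -
  have "mat_adjoint (mat_adjoint A * A) = mat_adjoint A * A"
    using A by (simp add: mat_adjoint_mult[of _ n n _ n])
  then obtain U d where "U \<in> carrier (unitary_group n)"
    "mat_adjoint A * A = U * mat_diag n (\<lambda>i. complex_of_real (d i)) * mat_adjoint U"
    using hermitian_unitary_diagonalization[of "mat_adjoint A * A" n] A
    by (metis mat_adjoint_carrier mult_carrier_mat)
  thus ?thesis using singular_systemI[OF A] by blast
qed

text \<open>
  The \<open>p\<close>-th power of the Schatten norm is additive over blocks and avoids roots.
\<close>

definition schatten_energy :: "real \<Rightarrow> complex mat \<Rightarrow> real" where
  "schatten_energy p A = schatten_norm p A powr p"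

lemma schatten_energy_nonneg [simp]: "0 \<le> schatten_energy p A"
  by (simp add: schatten_energy_def)

lemma mat_trace_unitary_conj:
  assumes U: "U \<in> carrier (unitary_group n)"
  shows "mat_trace (U * mat_diag n (\<lambda>i. complex_of_real (d i)) * mat_adjoint U)
       = complex_of_real (\<Sum>i<n. d i)"
proof -
  note Uc = unitary_groupD[OF U]
  have "mat_trace (U * mat_diag n (\<lambda>i. complex_of_real (d i)) * mat_adjoint U)
      = (\<Sum>k<n. complex_of_real (\<Sum>i<n. d i * (cmod (U $$ (k, i)))\<^sup>2))"
    unfolding mat_trace_def
    using conj_diag_entry[of "mat_adjoint U" n n _ d] Uc(1)
    by (intro sum.cong) (auto simp del: index_mult_mat(1))
  also have "\<dots> = complex_of_real (\<Sum>k<n. \<Sum>i<n. d i * (cmod (U $$ (k, i)))\<^sup>2)" by simp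
  also have "(\<Sum>k<n. \<Sum>i<n. d i * (cmod (U $$ (k, i)))\<^sup>2) = (\<Sum>i<n. d i * (\<Sum>k<n. (cmod (U $$ (k, i)))\<^sup>2))"
    by (subst sum.swap) (simp add: sum_distrib_left)
  also have "\<dots> = (\<Sum>i<n. d i)"
    using unitary_col_sum[OF U] by (intro sum.cong) auto
  finally show ?thesis .
qed

lemma schatten_energy_eq:
  assumes "singular_system n A U d" and p: "p > 0"
  shows "schatten_energy p A = (\<Sum>i<n. d i powr (p / 2))"
proof -
  have U: "U \<in> carrier (unitary_group n)" and d: "\<And>i. i < n \<Longrightarrow> 0 \<le> d i"
    and eq: "mat_adjoint A * A = U * mat_diag n (\<lambda>i. complex_of_real (d i)) * mat_adjoint U"
    using assms(1) by (auto simp: singular_system_def)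
  have "mat_abs A = U * mat_diag n (\<lambda>i. complex_of_real (sqrt (d i))) * mat_adjoint U"
    unfolding mat_abs_def by (rule hermitian_calculus_eq[OF U eq])
  hence "hermitian_calculus (\<lambda>s. s powr p) (mat_abs A)
      = U * mat_diag n (\<lambda>i. complex_of_real (sqrt (d i) powr p)) * mat_adjoint U"
    by (rule hermitian_calculus_eq[OF U])
  hence "Re (mat_trace (hermitian_calculus (\<lambda>s. s powr p) (mat_abs A))) = (\<Sum>i<n. sqrt (d i) powr p)"
    using mat_trace_unitary_conj[OF U] by simp
  also have "\<dots> = (\<Sum>i<n. d i powr (p / 2))"
    using d by (intro sum.cong) (auto simp: powr_half_sqrt[symmetric] powr_powr)
  finally have *: "schatten_norm p A = (\<Sum>i<n. d i powr (p / 2)) powr (1 / p)"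
    by (simp add: schatten_norm_def)
  have "(\<Sum>i<n. d i powr (p / 2)) \<ge> 0" by (intro sum_nonneg) auto
  thus ?thesis unfolding schatten_energy_def * using p by (simp add: powr_powr)
qed

section \<open>Jensen inequalities for singular values\<close>

text \<open>
  The graph of \<open>x powr \<theta>\<close> lies below its tangent at \<open>y\<close>; multiplied by \<open>y powr (1 - \<theta>)\<close> this is the
  weighted inequality between arithmetic and geometric mean.
\<close>

lemma powr_concave_tangent:
  fixes x y \<theta> :: real
  assumes "0 \<le> x" "0 < y" "0 \<le> \<theta>" "\<theta> \<le> 1"
  shows "x powr \<theta> * y powr (1 - \<theta>) \<le> \<theta> * x + (1 - \<theta>) * y"
proof (cases "x = 0")
  case False
  thus ?thesis using Youngs_inequality_0[of \<theta> "1 - \<theta>" x y] assms by auto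
qed (use assms in auto)

text \<open>
  Averaging the tangent inequality at \<open>y\<close>. The weights may add up to less than one and \<open>y\<close> may exceed
  the mean, because the tangent is nonnegative at \<open>0\<close> and has nonnegative slope.
\<close>

lemma powr_concave_Jensen:
  fixes m x :: "nat \<Rightarrow> real"
  assumes "\<And>i. i < n \<Longrightarrow> 0 \<le> m i" "\<And>i. i < n \<Longrightarrow> 0 \<le> x i"
    and "(\<Sum>i<n. m i) \<le> 1" "(\<Sum>i<n. m i * x i) \<le> y" "0 < y" "0 \<le> \<theta>" "\<theta> \<le> 1"
  shows "(\<Sum>i<n. m i * x i powr \<theta>) \<le> y powr \<theta>"
proof -
  have "(\<Sum>i<n. m i * x i powr \<theta>) * y powr (1 - \<theta>) = (\<Sum>i<n. m i * (x i powr \<theta> * y powr (1 - \<theta>)))"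
    unfolding sum_distrib_right by (intro sum.cong) auto
  also have "\<dots> \<le> (\<Sum>i<n. m i * (\<theta> * x i + (1 - \<theta>) * y))"
    using assms by (intro sum_mono mult_left_mono powr_concave_tangent) auto
  also have "\<dots> = (\<Sum>i<n. \<theta> * (m i * x i) + (1 - \<theta>) * y * m i)"
    by (intro sum.cong) (auto simp: algebra_simps)
  also have "\<dots> = \<theta> * (\<Sum>i<n. m i * x i) + (1 - \<theta>) * y * (\<Sum>i<n. m i)"
    by (simp only: sum.distrib sum_distrib_left[symmetric])
  also have "\<dots> \<le> \<theta> * y + (1 - \<theta>) * y * 1"
    using assms by (intro add_mono mult_left_mono) auto
  also have "\<dots> = y" by (simp add: algebra_simps)
  also have "y = y powr \<theta> * y powr (1 - \<theta>)"
    using assms(5) by (simp add: powr_add[symmetric])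
  finally show ?thesis using assms(5) by simp
qed

lemma powr_convex_Jensen:
  fixes m x :: "nat \<Rightarrow> real"
  assumes m: "\<And>i. i < n \<Longrightarrow> 0 \<le> m i" and x: "\<And>i. i < n \<Longrightarrow> 0 \<le> x i"
    and sm: "(\<Sum>i<n. m i) = 1" and s: "1 \<le> s"
  shows "(\<Sum>i<n. m i * x i) powr s \<le> (\<Sum>i<n. m i * x i powr s)"
proof -
  define y where "y = (\<Sum>i<n. m i * x i powr s)"
  have y0: "0 \<le> y" unfolding y_def using m by (intro sum_nonneg) auto
  have S0: "0 \<le> (\<Sum>i<n. m i * x i)" using m x by (intro sum_nonneg) auto
  show ?thesis
  proof (cases "y = 0")
    case True
    hence "\<forall>i\<in>{..<n}. m i * x i powr s = 0"
      unfolding y_def using m by (subst (asm) sum_nonneg_eq_0_iff) auto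
    hence "(\<Sum>i<n. m i * x i) = 0" by (intro sum.neutral) auto
    thus ?thesis using m by (auto intro!: sum_nonneg)
  next
    case False
    have "(\<Sum>i<n. m i * x i) = (\<Sum>i<n. m i * (x i powr s) powr (1 / s))"
      using s x by (intro sum.cong) (auto simp: powr_powr)
    also have "\<dots> \<le> y powr (1 / s)"
      using False y0 s m sm by (intro powr_concave_Jensen) (auto simp: y_def)
    finally have "(\<Sum>i<n. m i * x i) powr s \<le> (y powr (1 / s)) powr s"
      using s S0 by (intro powr_mono2) auto
    thus ?thesis using s y0 by (simp add: powr_powr y_def)
  qed
qed

lemma singular_systemD:
  assumes "singular_system n A U d"
  shows "A \<in> carrier_mat n n" "U \<in> carrier (unitary_group n)"
    "mat_adjoint A * A = U * mat_diag n (\<lambda>i. complex_of_real (d i)) * mat_adjoint U"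
    "i < n \<Longrightarrow> 0 \<le> d i"
  using assms by (auto simp: singular_system_def)

text \<open>
  Let \<open>u\<^sub>i\<close> be an eigenbasis of \<open>A\<^sup>* A\<close> with eigenvalues \<open>d i\<close>. Then \<open>\<parallel>A v\<^sub>j\<parallel>\<^sup>2\<close> is the mean of the
  \<open>d i\<close> with weights \<open>|\<langle>u\<^sub>i, v\<^sub>j\<rangle>|\<^sup>2\<close>, and Jensen's inequality for the concave power \<open>p / 2\<close> is summed
  over \<open>j\<close>, where the weights again add up to one.
\<close>

lemma schatten_energy_le_basis:
  assumes A: "A \<in> carrier_mat n n" and V: "V \<in> carrier (unitary_group n)" and p: "0 < p" "p \<le> 2"
  shows "schatten_energy p A \<le> (\<Sum>j<n. col_sq (A * V) j powr (p / 2))"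
proof -
  obtain U d where s: "singular_system n A U d" using singular_system_exists[OF A] by blast
  note sD = singular_systemD[OF s]
  define W where "W = mat_adjoint U * V"
  have W: "W \<in> carrier (unitary_group n)"
    unfolding W_def by (intro unitary_mult unitary_adjoint sD(2) V)
  let ?m = "\<lambda>i j. (cmod (W $$ (i, j)))\<^sup>2"
  have "schatten_energy p A = (\<Sum>i<n. d i powr (p / 2))"
    using schatten_energy_eq[OF s p(1)] .
  also have "\<dots> = (\<Sum>i<n. \<Sum>j<n. ?m i j * d i powr (p / 2))"
    using unitary_row_sum[OF W] by (intro sum.cong) (auto simp: sum_distrib_right[symmetric])
  also have "\<dots> = (\<Sum>j<n. \<Sum>i<n. ?m i j * d i powr (p / 2))" by (rule sum.swap)
  also have "\<dots> \<le> (\<Sum>j<n. col_sq (A * V) j powr (p / 2))"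
  proof (rule sum_mono)
    fix j assume "j \<in> {..<n}"
    hence j: "j < n" by simp
    have c: "col_sq (A * V) j = (\<Sum>i<n. ?m i j * d i)"
      using col_sq_mult[OF sD(1,2) unitary_groupD(1)[OF V] sD(3) j] by (simp add: W_def mult.commute)
    show "(\<Sum>i<n. ?m i j * d i powr (p / 2)) \<le> col_sq (A * V) j powr (p / 2)"
    proof (cases "col_sq (A * V) j = 0")
      case True
      hence "\<forall>i\<in>{..<n}. ?m i j * d i = 0"
        unfolding c using sD(4) by (subst (asm) sum_nonneg_eq_0_iff) auto
      hence "(\<Sum>i<n. ?m i j * d i powr (p / 2)) = 0" by (intro sum.neutral) auto
      thus ?thesis by simp
    next
      case False
      hence "col_sq (A * V) j > 0" using col_sq_nonneg[of "A * V" j] by linarith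
      thus ?thesis
        using p sD(4) unitary_col_sum[OF W j] c by (intro powr_concave_Jensen) auto
    qed
  qed
  finally show ?thesis .
qed

text \<open>
  The same means as before, but now the power \<open>p / 2\<close> is convex and Jensen's inequality is reversed.
\<close>

lemma basis_le_schatten_energy:
  assumes A: "A \<in> carrier_mat n n" and V: "V \<in> carrier (unitary_group n)" and p: "2 \<le> p"
  shows "(\<Sum>j<n. col_sq (A * V) j powr (p / 2)) \<le> schatten_energy p A"
proof -
  obtain U d where s: "singular_system n A U d" using singular_system_exists[OF A] by blast
  note sD = singular_systemD[OF s]
  define W where "W = mat_adjoint U * V"
  have W: "W \<in> carrier (unitary_group n)"
    unfolding W_def by (intro unitary_mult unitary_adjoint sD(2) V)
  let ?m = "\<lambda>i j. (cmod (W $$ (i, j)))\<^sup>2"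
  have "(\<Sum>j<n. col_sq (A * V) j powr (p / 2)) \<le> (\<Sum>j<n. \<Sum>i<n. ?m i j * d i powr (p / 2))"
  proof (rule sum_mono)
    fix j assume "j \<in> {..<n}"
    hence j: "j < n" by simp
    have c: "col_sq (A * V) j = (\<Sum>i<n. ?m i j * d i)"
      using col_sq_mult[OF sD(1,2) unitary_groupD(1)[OF V] sD(3) j] by (simp add: W_def mult.commute)
    show "col_sq (A * V) j powr (p / 2) \<le> (\<Sum>i<n. ?m i j * d i powr (p / 2))"
      unfolding c using p sD(4) unitary_col_sum[OF W j] by (intro powr_convex_Jensen) auto
  qed
  also have "\<dots> = (\<Sum>i<n. \<Sum>j<n. ?m i j * d i powr (p / 2))" by (rule sum.swap)
  also have "\<dots> = (\<Sum>i<n. d i powr (p / 2))"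
    using unitary_row_sum[OF W] by (intro sum.cong) (auto simp: sum_distrib_right[symmetric])
  also have "\<dots> = schatten_energy p A"
    using schatten_energy_eq[OF s] p by simp
  finally show ?thesis .
qed

section \<open>Duality of Schatten classes\<close>

definition conjugate_exponents :: "real \<Rightarrow> real \<Rightarrow> bool" where
  "conjugate_exponents p q \<longleftrightarrow> 1 < p \<and> 1 < q \<and> 1 / p + 1 / q = 1"

lemma conjugate_exponentsD:
  assumes "conjugate_exponents p q"
  shows "1 < p" "1 < q" "1 / p + 1 / q = 1" "0 < p" "0 < q"
  using assms by (auto simp: conjugate_exponents_def)

lemma conjugate_exponents_sym: "conjugate_exponents p q \<Longrightarrow> conjugate_exponents q p"
  by (auto simp: conjugate_exponents_def)

lemma conjugate_exponents_exists:
  assumes "1 < p"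
  shows "conjugate_exponents p (p / (p - 1))"
  using assms by (auto simp: conjugate_exponents_def field_simps)

lemma conjugate_exponents_ge_2:
  assumes "conjugate_exponents p q" "q < 2"
  shows "2 \<le> p"
proof (rule ccontr)
  assume "\<not> 2 \<le> p"
  hence "1 / p > 1 / 2" "1 / q > 1 / 2" using conjugate_exponentsD[OF assms(1)] assms(2) by (auto simp: field_simps)
  thus False using conjugate_exponentsD(3)[OF assms(1)] by linarith
qed

text \<open>
  The Hilbert-Schmidt inner product, linear in the first argument.
\<close>

definition frob :: "complex mat \<Rightarrow> complex mat \<Rightarrow> complex" where
  "frob A B = mat_trace (A * mat_adjoint B)"

lemma frob_eq:
  assumes "A \<in> carrier_mat n m" "B \<in> carrier_mat n m"
  shows "frob A B = (\<Sum>j<m. \<Sum>k<n. A $$ (k, j) * cnj (B $$ (k, j)))"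
proof -
  have "frob A B = (\<Sum>k<n. \<Sum>j<m. A $$ (k, j) * cnj (B $$ (k, j)))"
    unfolding frob_def mat_trace_def using assms
    by (simp add: mat_mult_index[of _ n m _ n] del: index_mult_mat(1))
  thus ?thesis by (subst sum.swap) simp
qed

lemma frob_unitary:
  assumes A: "A \<in> carrier_mat n n" and B: "B \<in> carrier_mat n n" and V: "V \<in> carrier (unitary_group n)"
  shows "frob (A * V) (B * V) = frob A B"
  unfolding frob_def using carrier_matD[OF A] carrier_matD[OF B] unitary_cancel(1)[OF V, of "mat_adjoint B"]
  by (simp add: mat_adjoint_mult' mat_mult_assoc unitary_dims[OF V])

lemma frob_cnj:
  assumes "A \<in> carrier_mat n m" "B \<in> carrier_mat n m"
  shows "frob B A = cnj (frob A B)"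
  using assms by (simp add: frob_eq[of _ n m] mult.commute)

lemma frob_add_left:
  assumes "A \<in> carrier_mat n m" "B \<in> carrier_mat n m" "C \<in> carrier_mat n m"
  shows "frob (A + B) C = frob A C + frob B C"
  using assms by (simp add: frob_eq[of _ n m] sum.distrib ring_distribs)

lemma frob_smult_left:
  assumes "A \<in> carrier_mat n m" "C \<in> carrier_mat n m"
  shows "frob (a \<cdot>\<^sub>m A) C = a * frob A C"
  using assms by (simp add: frob_eq[of _ n m] sum_distrib_left mult_ac)

definition unit_mat :: "nat \<Rightarrow> nat \<Rightarrow> nat \<Rightarrow> complex mat" where
  "unit_mat m i j = mat m m (\<lambda>(k, l). if k = i \<and> l = j then 1 else 0)"

lemma unit_mat_closed [simp]: "unit_mat m i j \<in> carrier_mat m m"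
  by (simp add: unit_mat_def)

lemma frob_unit_mat:
  assumes "A \<in> carrier_mat m m" "i < m" "j < m"
  shows "frob A (unit_mat m i j) = A $$ (i, j)"
proof -
  have "frob A (unit_mat m i j) = (\<Sum>l<m. \<Sum>k<m. if k = i then if l = j then A $$ (k, l) else 0 else 0)"
    unfolding frob_eq[OF assms(1) unit_mat_closed] using assms
    by (intro sum.cong) (auto simp: unit_mat_def)
  thus ?thesis using assms by (simp add: sum.delta)
qed

text \<open>
  A linear functional is determined by its values on matrix units. The induction adds the entries of
  \<open>M\<close> one at a time.
\<close>

lemma matrix_functional_expansion:
  fixes \<psi> :: "complex mat \<Rightarrow> complex"
  assumes add: "\<And>A B. A \<in> carrier_mat m m \<Longrightarrow> B \<in> carrier_mat m m \<Longrightarrow> \<psi> (A + B) = \<psi> A + \<psi> B"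
    and scale: "\<And>a A. A \<in> carrier_mat m m \<Longrightarrow> \<psi> (a \<cdot>\<^sub>m A) = a * \<psi> A"
    and M: "M \<in> carrier_mat m m"
  shows "\<psi> M = (\<Sum>j<m. \<Sum>i<m. M $$ (i, j) * \<psi> (unit_mat m i j))"
proof -
  let ?E = "unit_mat m"
  define part where "part S = mat m m (\<lambda>(k, l). if (l, k) \<in> S then M $$ (k, l) else 0)" for S
  have z: "\<psi> (0\<^sub>m m m) = 0"
    using scale[of "0\<^sub>m m m" 0] by simp
  have "\<psi> (part S) = (\<Sum>(j, i)\<in>S. M $$ (i, j) * \<psi> (?E i j))" if "finite S" "S \<subseteq> {..<m} \<times> {..<m}" for S
    using that
  proof (induction S rule: finite_induct)
    case empty
    have "part {} = 0\<^sub>m m m" by (rule eq_matI) (auto simp: part_def)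
    thus ?case using z by simp
  next
    case (insert x S)
    obtain j i where x: "x = (j, i)" by (cases x)
    have "part (insert x S) = part S + M $$ (i, j) \<cdot>\<^sub>m ?E i j"
      by (rule eq_matI) (use insert.hyps in \<open>auto simp: part_def x unit_mat_def\<close>)
    hence "\<psi> (part (insert x S)) = \<psi> (part S) + M $$ (i, j) * \<psi> (?E i j)"
      using add[of "part S" "M $$ (i, j) \<cdot>\<^sub>m ?E i j"] scale[of "?E i j" "M $$ (i, j)"]
      by (simp add: part_def)
    thus ?case using insert by (simp add: x add.commute)
  qed
  from this[of "{..<m} \<times> {..<m}"]
  have "\<psi> (part ({..<m} \<times> {..<m})) = (\<Sum>j<m. \<Sum>i<m. M $$ (i, j) * \<psi> (?E i j))"
    by (simp add: sum.cartesian_product)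
  moreover have "part ({..<m} \<times> {..<m}) = M"
    by (rule eq_matI) (use M in \<open>auto simp: part_def\<close>)
  ultimately show ?thesis by simp
qed

lemma frob_basis_bound:
  assumes A: "A \<in> carrier_mat n n" and B: "B \<in> carrier_mat n n" and V: "V \<in> carrier (unitary_group n)"
  shows "cmod (frob A B) \<le> (\<Sum>j<n. sqrt (col_sq (A * V) j) * sqrt (col_sq (B * V) j))"
proof -
  have AV: "A * V \<in> carrier_mat n n" and BV: "B * V \<in> carrier_mat n n"
    using A B unitary_groupD(1)[OF V] by auto
  have "cmod (frob A B) = cmod (\<Sum>j<n. \<Sum>k<n. (A * V) $$ (k, j) * cnj ((B * V) $$ (k, j)))"
    using frob_unitary[OF A B V] frob_eq[OF AV BV] by simp
  also have "\<dots> \<le> (\<Sum>j<n. \<Sum>k<n. \<bar>cmod ((A * V) $$ (k, j))\<bar> * \<bar>cmod ((B * V) $$ (k, j))\<bar>)"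
    by (intro order_trans[OF norm_sum] sum_mono) (simp add: norm_mult del: index_mult_mat(1))
  also have "\<dots> \<le> (\<Sum>j<n. L2_set (\<lambda>k. cmod ((A * V) $$ (k, j))) {..<n} * L2_set (\<lambda>k. cmod ((B * V) $$ (k, j))) {..<n})"
    by (intro sum_mono L2_set_mult_ineq)
  also have "\<dots> = (\<Sum>j<n. sqrt (col_sq (A * V) j) * sqrt (col_sq (B * V) j))"
    using carrier_matD[OF AV] carrier_matD[OF BV] by (simp add: L2_set_def col_sq_def del: index_mult_mat(1))
  finally show ?thesis .
qed

text \<open>
  Evaluate the inner product in an eigenbasis of \<open>A\<^sup>* A\<close> and apply Young's inequality to each column.
  The part of \<open>A\<close> is then exactly its energy, and the part of \<open>B\<close> is at most its energy
  because \<open>q \<ge> 2\<close>.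
\<close>

lemma schatten_Young_aux:
  assumes A: "A \<in> carrier_mat n n" and B: "B \<in> carrier_mat n n"
    and ce: "conjugate_exponents p q" and q: "2 \<le> q"
  shows "cmod (frob A B) \<le> schatten_energy p A / p + schatten_energy q B / q"
proof -
  note pq = conjugate_exponentsD[OF ce]
  obtain U d where s: "singular_system n A U d" using singular_system_exists[OF A] by blast
  note sD = singular_systemD[OF s]
  have "cmod (frob A B) \<le> (\<Sum>j<n. sqrt (col_sq (A * U) j) * sqrt (col_sq (B * U) j))"
    by (rule frob_basis_bound[OF A B sD(2)])
  also have "\<dots> \<le> (\<Sum>j<n. sqrt (col_sq (A * U) j) powr p / p + sqrt (col_sq (B * U) j) powr q / q)"
    by (intro sum_mono Youngs_inequality pq) auto
  also have "\<dots> = (\<Sum>j<n. col_sq (A * U) j powr (p / 2)) / p + (\<Sum>j<n. col_sq (B * U) j powr (q / 2)) / q"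
    by (simp add: sum.distrib sum_divide_distrib powr_half_sqrt[symmetric] powr_powr)
  also have "(\<Sum>j<n. col_sq (A * U) j powr (p / 2)) = schatten_energy p A"
    using schatten_energy_eq[OF s] pq(1) col_sq_singular_basis[OF sD(1-3)] by simp
  also have "(\<Sum>j<n. col_sq (B * U) j powr (q / 2)) \<le> schatten_energy q B"
    by (rule basis_le_schatten_energy[OF B sD(2) q])
  finally show ?thesis using pq by (simp add: divide_right_mono)
qed

text \<open>
  One of two conjugate exponents is at least \<open>2\<close>, and the roles of \<open>A\<close> and \<open>B\<close> may be exchanged.
\<close>

lemma schatten_Young:
  assumes A: "A \<in> carrier_mat n n" and B: "B \<in> carrier_mat n n"
    and ce: "conjugate_exponents p q"
  shows "cmod (frob A B) \<le> schatten_energy p A / p + schatten_energy q B / q"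
proof (cases "2 \<le> q")
  case True
  thus ?thesis by (rule schatten_Young_aux[OF A B ce])
next
  case False
  hence "2 \<le> p" using conjugate_exponents_ge_2[OF ce] by simp
  hence "cmod (frob B A) \<le> schatten_energy q B / q + schatten_energy p A / p"
    by (rule schatten_Young_aux[OF B A conjugate_exponents_sym[OF ce]])
  thus ?thesis using frob_cnj[OF A B] by (simp add: add.commute)
qed

lemma mat_diag_mult_mult:
  assumes "dim_row X = n"
  shows "mat_diag n f * (mat_diag n g * X) = mat_diag n (\<lambda>i. f i * g i) * (X :: complex mat)"
  using assms by (simp add: mat_mult_assoc[symmetric])

text \<open>
  The witness is \<open>K = A |A|\<^sup>p\<^sup>-\<^sup>2\<close>. Its squared singular values are \<open>d i powr (p - 1)\<close>, which
  makes its energy at \<open>q\<close> equal to that of \<open>A\<close> at \<open>p\<close> since \<open>(p - 1) q = p\<close>. Kernel directions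
  cause no trouble: \<open>0 powr r = 0\<close> for every \<open>r\<close>.
\<close>

lemma schatten_norming:
  assumes A: "A \<in> carrier_mat n n" and ce: "conjugate_exponents p q"
  shows "\<exists>K \<in> carrier_mat n n. schatten_energy q K = schatten_energy p A \<and>
           frob A K = complex_of_real (schatten_energy p A)"
proof -
  note pq = conjugate_exponentsD[OF ce]
  obtain U d where s: "singular_system n A U d" using singular_system_exists[OF A] by blast
  note sD = singular_systemD[OF s]
  note dims = carrier_matD[OF A] unitary_dims[OF sD(2)]
  let ?D = "\<lambda>f. mat_diag n (\<lambda>i. complex_of_real (f i))"
  \<comment> \<open>The eigenvalues of \<open>|A|\<^sup>p\<^sup>-\<^sup>2\<close>, since those of \<open>|A|\<close> are \<open>sqrt (d i)\<close>.\<close>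
  define e where "e i = d i powr ((p - 2) / 2)" for i
  define K where "K = A * (U * (?D e * mat_adjoint U))"
  have K: "K \<in> carrier_mat n n" using A unitary_groupD(1)[OF sD(2)] unfolding K_def
    by (auto intro!: mult_carrier_mat)
  have AA: "mat_adjoint A * (A * X) = U * (?D d * (mat_adjoint U * X))" if "dim_row X = n" for X
  proof -
    have "mat_adjoint A * (A * X) = (mat_adjoint A * A) * X"
      using that dims by (simp add: mat_mult_assoc)
    thus ?thesis unfolding sD(3) using that dims by (simp add: mat_mult_assoc)
  qed
  have p_half: "(p - 2) / 2 + (p - 2) / 2 + 1 = p - 1" "1 + (p - 2) / 2 = p / 2" for p :: real
    by (auto simp: field_simps)
  have ede: "complex_of_real (e i) * (complex_of_real (d i) * complex_of_real (e i))
      = complex_of_real (d i powr (p - 1))" if "i < n" for i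
  proof (cases "d i = 0")
    case False
    hence di: "d i > 0" using sD(4)[OF that] by simp
    have "e i * (d i * e i) = e i * e i * d i powr 1" using di by simp
    also have "\<dots> = d i powr (p - 1)"
      unfolding e_def powr_add[symmetric] p_half ..
    finally show ?thesis by (metis of_real_mult)
  qed (simp add: e_def)
  have DD: "mat_diag n (\<lambda>i. complex_of_real (e i) * (complex_of_real (d i) * complex_of_real (e i)))
      = ?D (\<lambda>i. d i powr (p - 1))"
    by (rule eq_matI) (auto simp: mat_diag_def ede)
  have "mat_adjoint K * K = U * (?D (\<lambda>i. d i powr (p - 1)) * mat_adjoint U)"
    unfolding K_def using dims
    by (simp add: mat_adjoint_mult' mat_mult_assoc AA mat_adjoint_diag unitary_cancel[OF sD(2)]
        mat_diag_mult_mult DD)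
  hence sK: "singular_system n K U (\<lambda>i. d i powr (p - 1))"
    using dims by (intro singular_systemI K sD(2)) (simp add: mat_mult_assoc)
  have e2: "(p - 1) * (q / 2) = p / 2" using pq by (simp add: field_simps)
  have EA: "schatten_energy p A = (\<Sum>i<n. d i powr (p / 2))"
    using schatten_energy_eq[OF s] pq by simp
  have "schatten_energy q K = (\<Sum>i<n. (d i powr (p - 1)) powr (q / 2))"
    using schatten_energy_eq[OF sK] pq by simp
  hence EK: "schatten_energy q K = schatten_energy p A"
    unfolding EA by (simp only: powr_powr e2)
  have AU: "A * U \<in> carrier_mat n n" and KU: "K * U \<in> carrier_mat n n"
    using A K unitary_groupD(1)[OF sD(2)] by auto
  have KU': "K * U = (A * U) * ?D e"
    unfolding K_def using dims unitary_groupD(2)[OF sD(2)]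
    by (simp add: mat_mult_assoc mat_mult_one1)
  have "frob A K = frob (A * U) (K * U)" using frob_unitary[OF A K sD(2)] by simp
  also have "\<dots> = (\<Sum>j<n. \<Sum>k<n. (A * U) $$ (k, j) * cnj ((A * U) $$ (k, j) * complex_of_real (e j)))"
    unfolding frob_eq[OF AU KU] unfolding KU'
    using AU by (simp add: mat_diag_mult_right[OF AU] del: index_mult_mat(1))
  also have "\<dots> = (\<Sum>j<n. complex_of_real (col_sq (A * U) j * e j))"
    using carrier_matD[OF AU]
    by (simp add: col_sq_def complex_norm_square sum_distrib_left mult_ac del: index_mult_mat(1) of_real_power)
  also have "\<dots> = (\<Sum>j<n. complex_of_real (d j powr (p / 2)))"
  proof (intro sum.cong refl)
    fix j assume "j \<in> {..<n}"
    hence j: "j < n" by simp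
    have "d j * e j = d j powr (p / 2)"
    proof (cases "d j = 0")
      case False
      hence "d j > 0" using sD(4)[OF j] by simp
      hence "d j * e j = d j powr 1 * e j" by simp
      also have "\<dots> = d j powr (p / 2)"
        unfolding e_def powr_add[symmetric] p_half ..
      finally show ?thesis .
    qed simp
    thus "complex_of_real (col_sq (A * U) j * e j) = complex_of_real (d j powr (p / 2))"
      using col_sq_singular_basis[OF sD(1-3) j] by simp
  qed
  finally have "frob A K = complex_of_real (schatten_energy p A)" unfolding EA by simp
  thus ?thesis using K EK by blast
qed

section \<open>The Clarkson-McCarthy inequality\<close>

text \<open>
  With \<open>Z = V diag(z) V\<^sup>*\<close> the hypothesis \<open>dom\<close> says \<open>A\<^sup>* A \<le> Z\<close> and the conclusion says
  \<open>Tr (Z\<^sup>r A\<^sup>* A) \<le> Tr ((A\<^sup>* A)\<^sup>r\<^sup>+\<^sup>1)\<close> with \<open>r = p / 2 - 1\<close>. It would follow from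
  the fact that powers with exponent in \<open>[-1, 0]\<close> reverse the operator order; the weaker trace
  statement needs only the order reversal of the inverse, in the form of the bound
  \<open>\<langle>u, Z\<^sup>-\<^sup>1 u\<rangle> \<le> 1 / d\<close> for a unit eigenvector \<open>u\<close> of \<open>A\<^sup>* A\<close> with eigenvalue \<open>d > 0\<close>, followed by
  Jensen's inequality for the power \<open>1 - p / 2\<close>. The conventions \<open>1 / 0 = 0\<close> and \<open>0 powr r = 0\<close>
  implement the inverse on the range of \<open>Z\<close>.
\<close>

lemma trace_weighted_le_schatten_energy:
  assumes A: "A \<in> carrier_mat n n" and V: "V \<in> carrier (unitary_group n)" and p: "0 < p" "p \<le> 2"
    and z: "\<And>j. j < n \<Longrightarrow> 0 \<le> z j"
    and dom: "\<And>Y. Y \<in> carrier_mat n 1 \<Longrightarrow>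
       col_sq (A * Y) 0 \<le> (\<Sum>j<n. z j * (cmod ((mat_adjoint V * Y) $$ (j, 0)))\<^sup>2)"
  shows "(\<Sum>j<n. z j powr (p / 2 - 1) * col_sq (A * V) j) \<le> schatten_energy p A"
proof -
  obtain U d where s: "singular_system n A U d" using singular_system_exists[OF A] by blast
  note sD = singular_systemD[OF s]
  define W where "W = mat_adjoint U * V"
  have W: "W \<in> carrier (unitary_group n)"
    unfolding W_def by (intro unitary_mult unitary_adjoint sD(2) V)
  let ?m = "\<lambda>i j. (cmod (W $$ (i, j)))\<^sup>2"
  have inv_bound: "(\<Sum>j<n. ?m i j * (1 / z j)) \<le> 1 / d i" if i: "i < n" and di: "d i > 0" for i
  proof -
    define P where "P = (\<Sum>j<n. ?m i j * (1 / z j))"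
    \<comment> \<open>The vector \<open>Z\<^sup>-\<^sup>1 u\<^sub>i\<close> in the basis \<open>V\<close>; it is optimal for the Cauchy-Schwarz argument behind \<open>d i * P\<^sup>2 \<le> P\<close>.\<close>
    define y where "y = mat n 1 (\<lambda>(j, k). cnj (W $$ (i, j)) / complex_of_real (z j))"
    have y: "y \<in> carrier_mat n 1" by (simp add: y_def)
    have Y: "V * y \<in> carrier_mat n 1" using y unitary_groupD(1)[OF V] by auto
    have Vy: "mat_adjoint V * (V * y) = y" using y by (intro unitary_cancel[OF V]) auto
    have UVy: "mat_adjoint U * (V * y) = W * y"
      unfolding W_def using y unitary_dims[OF sD(2)] unitary_dims[OF V] by (simp add: mat_mult_assoc)
    have WY: "(W * y) $$ (i, 0) = complex_of_real P"
      using i y unitary_groupD(1)[OF W]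
      by (simp add: mat_mult_index[of _ n n _ 1] P_def y_def complex_norm_square mult_ac
          del: index_mult_mat(1) of_real_power)
    have "d i * P\<^sup>2 = d i * (cmod ((mat_adjoint U * (V * y)) $$ (i, 0)))\<^sup>2"
      unfolding UVy WY by simp
    also have "\<dots> \<le> (\<Sum>k<n. d k * (cmod ((mat_adjoint U * (V * y)) $$ (k, 0)))\<^sup>2)"
      using i sD(4) by (intro member_le_sum) auto
    also have "\<dots> = col_sq (A * (V * y)) 0"
      by (rule col_sq_mult[OF sD(1,2) Y sD(3), symmetric]) simp
    also have "\<dots> \<le> (\<Sum>j<n. z j * (cmod (y $$ (j, 0)))\<^sup>2)"
      using dom[OF Y] unfolding Vy .
    also have "\<dots> = P"
      unfolding P_def using z
      by (intro sum.cong) (auto simp: y_def norm_divide power2_eq_square)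
    finally have *: "d i * P\<^sup>2 \<le> P" .
    have "d i * P \<le> 1"
    proof (cases "P > 0")
      case True
      have "(d i * P) * P \<le> 1 * P" using * by (simp add: power2_eq_square)
      thus ?thesis using True by (rule mult_right_le_imp_le)
    next
      case False
      hence "d i * P \<le> 0" using di by (simp add: mult_nonneg_nonpos)
      thus ?thesis by linarith
    qed
    hence "P \<le> 1 / d i" using di by (simp add: field_simps)
    thus ?thesis by (simp only: P_def)
  qed
  have "(\<Sum>j<n. z j powr (p / 2 - 1) * col_sq (A * V) j)
      = (\<Sum>j<n. \<Sum>i<n. d i * (?m i j * z j powr (p / 2 - 1)))"
    using col_sq_mult[OF sD(1,2) unitary_groupD(1)[OF V] sD(3)]
    by (intro sum.cong) (auto simp: W_def sum_distrib_left mult_ac)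
  also have "\<dots> = (\<Sum>i<n. d i * (\<Sum>j<n. ?m i j * z j powr (p / 2 - 1)))"
    by (subst sum.swap) (simp add: sum_distrib_left)
  also have "\<dots> \<le> (\<Sum>i<n. d i powr (p / 2))"
  proof (rule sum_mono)
    fix i assume "i \<in> {..<n}"
    hence i: "i < n" by simp
    show "d i * (\<Sum>j<n. ?m i j * z j powr (p / 2 - 1)) \<le> d i powr (p / 2)"
    proof (cases "d i = 0")
      case False
      hence di: "d i > 0" using sD(4)[OF i] by simp
      have zp: "z j powr (p / 2 - 1) = (1 / z j) powr (1 - p / 2)" if "j < n" for j
      proof (cases "z j = 0")
        case False
        hence "z j > 0" using z[OF that] by simp
        thus ?thesis by (simp add: powr_divide powr_minus_divide[symmetric])
      qed simp
      have "(\<Sum>j<n. ?m i j * z j powr (p / 2 - 1)) = (\<Sum>j<n. ?m i j * (1 / z j) powr (1 - p / 2))"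
        using zp by simp
      also have "\<dots> \<le> (1 / d i) powr (1 - p / 2)"
        using p z di inv_bound[OF i di] unitary_row_sum[OF W i] by (intro powr_concave_Jensen) auto
      also have "\<dots> = d i powr (p / 2 - 1)"
        using di by (simp add: powr_divide powr_minus_divide[symmetric])
      finally have "d i * (\<Sum>j<n. ?m i j * z j powr (p / 2 - 1)) \<le> d i powr 1 * d i powr (p / 2 - 1)"
        using di by simp
      also have "\<dots> = d i powr (p / 2)" unfolding powr_add[symmetric] by simp
      finally show ?thesis .
    qed simp
  qed
  also have "\<dots> = schatten_energy p A" using schatten_energy_eq[OF s p(1)] by simp
  finally show ?thesis .
qed

lemma gram_form:
  assumes "A \<in> carrier_mat n n" "Y \<in> carrier_mat n m" "j < m"
  shows "(mat_adjoint Y * (mat_adjoint A * A) * Y) $$ (j, j) = complex_of_real (col_sq (A * Y) j)"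
proof -
  have "mat_adjoint Y * (mat_adjoint A * A) * Y = mat_adjoint (A * Y) * (A * Y)"
    using carrier_matD[OF assms(1)] carrier_matD[OF assms(2)] by (simp add: mat_adjoint_mult' mat_mult_assoc)
  thus ?thesis using gram_diag_entry[of "A * Y" n m j] assms by simp
qed

lemma gram_sum_form:
  assumes A: "A \<in> carrier_mat n n" and B: "B \<in> carrier_mat n n" and V: "V \<in> carrier (unitary_group n)"
    and eq: "mat_adjoint A * A + mat_adjoint B * B = V * mat_diag n (\<lambda>i. complex_of_real (z i)) * mat_adjoint V"
    and Y: "Y \<in> carrier_mat n m" and j: "j < m"
  shows "col_sq (A * Y) j + col_sq (B * Y) j = (\<Sum>i<n. z i * (cmod ((mat_adjoint V * Y) $$ (i, j)))\<^sup>2)"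
proof -
  let ?D = "mat_diag n (\<lambda>i. complex_of_real (z i))"
  have VY: "mat_adjoint V * Y \<in> carrier_mat n m" using unitary_groupD(1)[OF V] Y by auto
  have c: "mat_adjoint Y * (mat_adjoint A * A) \<in> carrier_mat m n" "mat_adjoint Y * (mat_adjoint B * B) \<in> carrier_mat m n"
    "mat_adjoint Y \<in> carrier_mat m n" "mat_adjoint A * A \<in> carrier_mat n n" "mat_adjoint B * B \<in> carrier_mat n n"
    using A B Y by (auto intro!: mult_carrier_mat)
  have "mat_adjoint Y * (mat_adjoint A * A) * Y + mat_adjoint Y * (mat_adjoint B * B) * Y
      = mat_adjoint Y * (mat_adjoint A * A + mat_adjoint B * B) * Y"
    using add_mult_distrib_mat[OF c(1,2) Y] mult_add_distrib_mat[OF c(3-5)] by simp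
  also have "\<dots> = mat_adjoint (mat_adjoint V * Y) * ?D * (mat_adjoint V * Y)"
    unfolding eq using unitary_dims[OF V] carrier_matD[OF Y] by (simp add: mat_adjoint_mult' mat_mult_assoc)
  finally have "(mat_adjoint Y * (mat_adjoint A * A) * Y + mat_adjoint Y * (mat_adjoint B * B) * Y) $$ (j, j)
      = complex_of_real (\<Sum>i<n. z i * (cmod ((mat_adjoint V * Y) $$ (i, j)))\<^sup>2)"
    using conj_diag_entry[OF VY j, of z] by (simp only:)
  moreover have "(mat_adjoint Y * (mat_adjoint A * A) * Y + mat_adjoint Y * (mat_adjoint B * B) * Y) $$ (j, j)
      = complex_of_real (col_sq (A * Y) j + col_sq (B * Y) j)"
    using gram_form[OF A Y j] gram_form[OF B Y j] carrier_matD[OF Y] j by (simp del: index_mult_mat(1))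
  ultimately show ?thesis by (simp only: of_real_eq_iff)
qed

lemma parallelogram_col_sq:
  assumes "A \<in> carrier_mat n m" "B \<in> carrier_mat n m" "j < m"
  shows "col_sq (A + B) j + col_sq (A - B) j = 2 * (col_sq A j + col_sq B j)"
proof -
  have *: "(cmod (a + b))\<^sup>2 + (cmod (a - b))\<^sup>2 = 2 * ((cmod a)\<^sup>2 + (cmod b)\<^sup>2)" for a b
    unfolding cmod_power2 by (simp add: power2_eq_square algebra_simps)
  have "col_sq (A + B) j + col_sq (A - B) j
      = (\<Sum>k<n. (cmod (A $$ (k, j) + B $$ (k, j)))\<^sup>2 + (cmod (A $$ (k, j) - B $$ (k, j)))\<^sup>2)"
    using assms by (simp add: col_sq_def sum.distrib minus_mat_def)
  thus ?thesis using assms by (simp add: * col_sq_def sum_distrib_left sum.distrib ring_distribs)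
qed

lemma powr_midpoint_concave:
  fixes a b :: real
  assumes "0 \<le> a" "0 \<le> b" "0 < \<theta>" "\<theta> \<le> 1"
  shows "a powr \<theta> + b powr \<theta> \<le> 2 * ((a + b) / 2) powr \<theta>"
proof (cases "a + b = 0")
  case False
  define y where "y = (a + b) / 2"
  have y: "0 < y" using assms False by (auto simp: y_def)
  have ab: "a + b = 2 * y" by (simp add: y_def)
  have "(a powr \<theta> + b powr \<theta>) * y powr (1 - \<theta>) = a powr \<theta> * y powr (1 - \<theta>) + b powr \<theta> * y powr (1 - \<theta>)"
    by (rule distrib_right)
  also have "\<dots> \<le> (\<theta> * a + (1 - \<theta>) * y) + (\<theta> * b + (1 - \<theta>) * y)"
    using assms y by (intro add_mono powr_concave_tangent) auto
  also have "\<dots> = \<theta> * (a + b) + 2 * ((1 - \<theta>) * y)" by (simp add: algebra_simps)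
  also have "\<dots> = 2 * y" unfolding ab by (simp add: algebra_simps)
  finally have "(a powr \<theta> + b powr \<theta>) * y powr (1 - \<theta>) \<le> 2 * y" .
  also have "2 * y = (2 * y powr \<theta>) * y powr (1 - \<theta>)" using y by (simp add: powr_add[symmetric])
  finally show ?thesis using y unfolding y_def[symmetric] by (simp del: mult.assoc)
qed (use assms in \<open>auto simp: add_nonneg_eq_0_iff\<close>)

text \<open>
  Let \<open>v\<^sub>j\<close> be an eigenbasis of \<open>Z = A\<^sup>* A + B\<^sup>* B\<close> with eigenvalues \<open>z j\<close>. By the parallelogram law
  the mean of \<open>\<parallel>(A + B) v\<^sub>j\<parallel>\<^sup>2\<close> and \<open>\<parallel>(A - B) v\<^sub>j\<parallel>\<^sup>2\<close> is \<open>z j\<close>, so concavity bounds the left-hand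
  side by twice the sum of the \<open>z j powr (p / 2)\<close>. Writing that power as \<open>z j powr (p / 2 - 1)\<close> times
  \<open>\<parallel>A v\<^sub>j\<parallel>\<^sup>2 + \<parallel>B v\<^sub>j\<parallel>\<^sup>2\<close> splits the sum into two parts, to which the preceding trace inequality
  applies because \<open>Z\<close> dominates both \<open>A\<^sup>* A\<close> and \<open>B\<^sup>* B\<close>.
\<close>

theorem schatten_energy_Clarkson:
  assumes A: "A \<in> carrier_mat n n" and B: "B \<in> carrier_mat n n" and p: "0 < p" "p \<le> 2"
  shows "schatten_energy p (A + B) + schatten_energy p (A - B)
       \<le> 2 * (schatten_energy p A + schatten_energy p B)"
proof -
  define Z where "Z = mat_adjoint A * A + mat_adjoint B * B"
  have Zc: "Z \<in> carrier_mat n n" unfolding Z_def using A B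
    by (intro add_carrier_mat mult_carrier_mat[of _ n n] mat_adjoint_carrier)
  have "mat_adjoint Z = Z"
    unfolding Z_def
    using mat_adjoint_add[OF mult_carrier_mat[OF mat_adjoint_carrier[OF A] A]
        mult_carrier_mat[OF mat_adjoint_carrier[OF B] B]] carrier_matD[OF A] carrier_matD[OF B]
    by (simp add: mat_adjoint_mult')
  then obtain V z where V: "V \<in> carrier (unitary_group n)"
    and Z: "Z = V * mat_diag n (\<lambda>i. complex_of_real (z i)) * mat_adjoint V"
    using hermitian_unitary_diagonalization[OF Zc] by blast
  note form = gram_sum_form[OF A B V Z[unfolded Z_def]]
  have zj: "col_sq (A * V) j + col_sq (B * V) j = z j" if j: "j < n" for j
  proof -
    have "(\<Sum>i<n. z i * (cmod ((1\<^sub>m n :: complex mat) $$ (i, j)))\<^sup>2) = (\<Sum>i<n. if i = j then z i else 0)"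
      using j by (intro sum.cong) auto
    also have "\<dots> = z j" using j by (simp add: sum.delta)
    finally show ?thesis
      using form[OF unitary_groupD(1)[OF V] j] unfolding unitary_groupD(2)[OF V] by simp
  qed
  have z0: "0 \<le> z j" if "j < n" for j
    unfolding zj[OF that, symmetric] by (intro add_nonneg_nonneg col_sq_nonneg)
  have AV: "A * V \<in> carrier_mat n n" and BV: "B * V \<in> carrier_mat n n"
    using A B unitary_groupD(1)[OF V] by auto
  have p2: "0 < p / 2" "p / 2 \<le> 1" using p by auto
  have AB: "A + B \<in> carrier_mat n n" "A - B \<in> carrier_mat n n" using A B by auto
  have "schatten_energy p (A + B) + schatten_energy p (A - B)
     \<le> (\<Sum>j<n. col_sq ((A + B) * V) j powr (p / 2)) + (\<Sum>j<n. col_sq ((A - B) * V) j powr (p / 2))"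
    by (intro add_mono schatten_energy_le_basis AB V p)
  also have "\<dots> = (\<Sum>j<n. col_sq (A * V + B * V) j powr (p / 2) + col_sq (A * V - B * V) j powr (p / 2))"
    using add_mult_distrib_mat[OF A B unitary_groupD(1)[OF V]] minus_mult_distrib_mat[OF A B unitary_groupD(1)[OF V]]
    by (simp add: sum.distrib)
  also have "\<dots> \<le> (\<Sum>j<n. 2 * z j powr (p / 2))"
  proof (rule sum_mono)
    fix j assume "j \<in> {..<n}"
    hence j: "j < n" by simp
    have "(col_sq (A * V + B * V) j + col_sq (A * V - B * V) j) / 2 = z j"
      using parallelogram_col_sq[OF AV BV j] zj[OF j] by simp
    thus "col_sq (A * V + B * V) j powr (p / 2) + col_sq (A * V - B * V) j powr (p / 2) \<le> 2 * z j powr (p / 2)"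
      using powr_midpoint_concave[OF col_sq_nonneg col_sq_nonneg p2, of "A * V + B * V" j "A * V - B * V" j]
      by simp
  qed
  also have "\<dots> = 2 * (\<Sum>j<n. z j powr (p / 2 - 1) * (col_sq (A * V) j + col_sq (B * V) j))"
    unfolding sum_distrib_left
  proof (intro sum.cong refl)
    fix j assume "j \<in> {..<n}"
    hence j: "j < n" by simp
    have "z j powr (p / 2) = z j powr (p / 2 - 1) * z j"
    proof (cases "z j = 0")
      case False
      hence "z j powr (p / 2 - 1) * z j = z j powr (p / 2 - 1) * z j powr 1" using z0[OF j] by simp
      also have "\<dots> = z j powr (p / 2)" unfolding powr_add[symmetric] by simp
      finally show ?thesis by simp
    qed simp
    thus "2 * z j powr (p / 2) = 2 * (z j powr (p / 2 - 1) * (col_sq (A * V) j + col_sq (B * V) j))"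
      using zj[OF j] by simp
  qed
  also have "\<dots> = 2 * ((\<Sum>j<n. z j powr (p / 2 - 1) * col_sq (A * V) j) + (\<Sum>j<n. z j powr (p / 2 - 1) * col_sq (B * V) j))"
    by (simp add: sum.distrib ring_distribs)
  also have "\<dots> \<le> 2 * (schatten_energy p A + schatten_energy p B)"
  proof (intro mult_left_mono add_mono trace_weighted_le_schatten_energy A B V p z0)
    fix Y :: "complex mat" assume Y: "Y \<in> carrier_mat n 1"
    have f: "col_sq (A * Y) 0 + col_sq (B * Y) 0 = (\<Sum>j<n. z j * (cmod ((mat_adjoint V * Y) $$ (j, 0)))\<^sup>2)"
      by (rule form[OF Y]) simp
    show "col_sq (A * Y) 0 \<le> (\<Sum>j<n. z j * (cmod ((mat_adjoint V * Y) $$ (j, 0)))\<^sup>2)"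
      using f col_sq_nonneg[of "B * Y" 0] by linarith
    show "col_sq (B * Y) 0 \<le> (\<Sum>j<n. z j * (cmod ((mat_adjoint V * Y) $$ (j, 0)))\<^sup>2)"
      using f col_sq_nonneg[of "A * Y" 0] by linarith
  qed auto
  finally show ?thesis .
qed

section \<open>Behaviour of the energy under scaling and the gram map\<close>

lemma smult_smult_mat:
  "a \<cdot>\<^sub>m (b \<cdot>\<^sub>m A) = (a * b) \<cdot>\<^sub>m (A :: complex mat)"
  by (rule eq_matI) auto

lemma mat_adjoint_smult:
  "mat_adjoint (a \<cdot>\<^sub>m A) = cnj a \<cdot>\<^sub>m mat_adjoint (A :: complex mat)"
  by (rule eq_matI) auto

lemma schatten_energy_smult:
  assumes A: "A \<in> carrier_mat n n" and p: "p > 0"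
  shows "schatten_energy p (a \<cdot>\<^sub>m A) = cmod a powr p * schatten_energy p A"
proof -
  obtain U d where s: "singular_system n A U d" using singular_system_exists[OF A] by blast
  note sD = singular_systemD[OF s]
  have c: "U * mat_diag n (\<lambda>i. complex_of_real (d i)) \<in> carrier_mat n n"
    using unitary_groupD(1)[OF sD(2)] by auto
  have "mat_adjoint (a \<cdot>\<^sub>m A) * (a \<cdot>\<^sub>m A) = (cnj a * a) \<cdot>\<^sub>m (mat_adjoint A * A)"
    unfolding mat_adjoint_smult using A
    by (simp add: mult_smult_assoc_mat[of _ n n _ n] mult_smult_distrib[of _ n n _ n] smult_smult_mat mult.commute[of a])
  also have "\<dots> = U * ((cnj a * a) \<cdot>\<^sub>m mat_diag n (\<lambda>i. complex_of_real (d i))) * mat_adjoint U"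
    unfolding sD(3)
    using mult_smult_assoc_mat[OF c mat_adjoint_carrier[OF unitary_groupD(1)[OF sD(2)]], of "cnj a * a"]
       mult_smult_distrib[OF unitary_groupD(1)[OF sD(2)], of "mat_diag n (\<lambda>i. complex_of_real (d i))" n "cnj a * a"] by simp
  also have "(cnj a * a) \<cdot>\<^sub>m mat_diag n (\<lambda>i. complex_of_real (d i)) = mat_diag n (\<lambda>i. complex_of_real ((cmod a)\<^sup>2 * d i))"
    by (rule eq_matI) (auto simp: mat_diag_def complex_norm_square mult_ac simp del: of_real_power)
  finally have s': "singular_system n (a \<cdot>\<^sub>m A) U (\<lambda>i. (cmod a)\<^sup>2 * d i)"
    using A by (intro singular_systemI sD(2)) auto
  have "((cmod a)\<^sup>2 * d i) powr (p / 2) = cmod a powr p * d i powr (p / 2)" if "i < n" for i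
  proof -
    have "(cmod a)\<^sup>2 powr (p / 2) = cmod a powr p"
      using p by (cases "a = 0") (auto simp: powr_powr simp flip: powr_numeral)
    thus ?thesis using sD(4)[OF that] by (simp add: powr_mult)
  qed
  thus ?thesis using schatten_energy_eq[OF s' p] schatten_energy_eq[OF s p] by (simp add: sum_distrib_left)
qed

lemma schatten_energy_gram:
  assumes A: "A \<in> carrier_mat n n" and p: "p > 0"
  shows "schatten_energy p (mat_adjoint A * A) = schatten_energy (2 * p) A"
proof -
  obtain U d where s: "singular_system n A U d" using singular_system_exists[OF A] by blast
  note sD = singular_systemD[OF s]
  let ?G = "mat_adjoint A * A"
  have G: "?G \<in> carrier_mat n n" using A by auto
  have "mat_adjoint ?G = ?G" using A by (simp add: mat_adjoint_mult[of _ n n _ n])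
  hence "mat_adjoint ?G * ?G = U * mat_diag n (\<lambda>i. complex_of_real (d i * d i)) * mat_adjoint U"
    unfolding sD(3)
    by (simp add: mat_mult_assoc unitary_cancel[OF sD(2)] unitary_dims[OF sD(2)] mat_diag_mult_mult)
  hence s': "singular_system n ?G U (\<lambda>i. d i * d i)" by (intro singular_systemI G sD(2))
  have "(d i * d i) powr (p / 2) = d i powr (2 * p / 2)" if "i < n" for i
    using sD(4)[OF that] by (simp add: powr_mult powr_add[symmetric])
  thus ?thesis using schatten_energy_eq[OF s' p] schatten_energy_eq[OF s, of "2 * p"] p by simp
qed

lemma schatten_energy_eq_0_iff:
  assumes A: "A \<in> carrier_mat n n" and p: "p > 0"
  shows "schatten_energy p A = 0 \<longleftrightarrow> A = 0\<^sub>m n n"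
proof
  assume 0: "schatten_energy p A = 0"
  obtain U d where s: "singular_system n A U d" using singular_system_exists[OF A] by blast
  note sD = singular_systemD[OF s]
  have "\<forall>i\<in>{..<n}. d i powr (p / 2) = 0"
    using 0 unfolding schatten_energy_eq[OF s p] by (subst (asm) sum_nonneg_eq_0_iff) auto
  hence "col_sq (A * 1\<^sub>m n) j = 0" if "j < n" for j
    using col_sq_mult[OF sD(1,2) one_carrier_mat sD(3) that] by simp
  hence "\<forall>k\<in>{..<n}. (cmod (A $$ (k, j)))\<^sup>2 = 0" if "j < n" for j
    using that A by (subst sum_nonneg_eq_0_iff[symmetric]) (auto simp: col_sq_def)
  thus "A = 0\<^sub>m n n" using A by (intro eq_matI) auto
next
  assume "A = 0\<^sub>m n n"
  hence "A = 0 \<cdot>\<^sub>m A" using A by (intro eq_matI) auto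
  thus "schatten_energy p A = 0" using schatten_energy_smult[OF A p, of 0] p by simp
qed

text \<open>
  The middle coefficient is \<open>A\<^sup>* B + B\<^sup>* A\<close>, expressed by polarization through two gram matrices. In
  this form its norm can be estimated by the triangle inequality.
\<close>

lemma gram_of_line:
  fixes t :: real
  assumes A: "A \<in> carrier_mat m m" and B: "B \<in> carrier_mat m m"
  shows "mat_adjoint (A + complex_of_real t \<cdot>\<^sub>m B) * (A + complex_of_real t \<cdot>\<^sub>m B)
    = (mat_adjoint A * A + complex_of_real t \<cdot>\<^sub>m (complex_of_real (1 / 2) \<cdot>\<^sub>m
        (mat_adjoint (A + B) * (A + B) - mat_adjoint (A - B) * (A - B))))
      + complex_of_real (t\<^sup>2) \<cdot>\<^sub>m (mat_adjoint B * B)" (is "?l = ?r")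
proof (rule eq_matI)
  have G: "(mat_adjoint M * M) $$ (i, j) = (\<Sum>k<m. cnj (M $$ (k, i)) * M $$ (k, j))"
    if "M \<in> carrier_mat m m" "i < m" "j < m" for M :: "complex mat" and i j
    using that by (simp add: mat_mult_index[of _ m m _ m] del: index_mult_mat(1))
  fix i j assume "i < dim_row ?r" "j < dim_col ?r"
  hence ij: "i < m" "j < m" using A B by auto
  have c: "A + complex_of_real t \<cdot>\<^sub>m B \<in> carrier_mat m m" "A + B \<in> carrier_mat m m" "A - B \<in> carrier_mat m m"
    using A B by auto
  have lin: "((X + a \<cdot>\<^sub>m (b \<cdot>\<^sub>m (Y - Z))) + e \<cdot>\<^sub>m W) $$ (i, j)
      = X $$ (i, j) + a * (b * (Y $$ (i, j) - Z $$ (i, j))) + e * W $$ (i, j)"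
    if "X \<in> carrier_mat m m" "Y \<in> carrier_mat m m" "Z \<in> carrier_mat m m" "W \<in> carrier_mat m m" "i < m" "j < m"
    for X Y Z W :: "complex mat" and a b e i j
    using that by auto
  have d: "dim_row A = m" "dim_col A = m" "dim_row B = m" "dim_col B = m" using A B by auto
  have "?r $$ (i, j) = (\<Sum>k<m. cnj (A $$ (k, i)) * A $$ (k, j))
      + complex_of_real t * (complex_of_real (1 / 2) * ((\<Sum>k<m. cnj ((A + B) $$ (k, i)) * (A + B) $$ (k, j))
        - (\<Sum>k<m. cnj ((A - B) $$ (k, i)) * (A - B) $$ (k, j))))
      + complex_of_real (t\<^sup>2) * (\<Sum>k<m. cnj (B $$ (k, i)) * B $$ (k, j))"
    unfolding G[OF A ij, symmetric] G[OF B ij, symmetric] G[OF c(2) ij, symmetric] G[OF c(3) ij, symmetric]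
    using A B c(2,3) ij by (intro lin mult_carrier_mat[of _ m m] mat_adjoint_carrier)
  also have "\<dots> = (\<Sum>k<m. cnj (A $$ (k, i)) * A $$ (k, j)
      + complex_of_real t * (complex_of_real (1 / 2) * (cnj ((A + B) $$ (k, i)) * (A + B) $$ (k, j)
        - cnj ((A - B) $$ (k, i)) * (A - B) $$ (k, j)))
      + complex_of_real (t\<^sup>2) * (cnj (B $$ (k, i)) * B $$ (k, j)))"
    by (simp only: sum.distrib sum_distrib_left[symmetric] sum_subtractf)
  also have "\<dots> = (\<Sum>k<m. cnj ((A + complex_of_real t \<cdot>\<^sub>m B) $$ (k, i)) * (A + complex_of_real t \<cdot>\<^sub>m B) $$ (k, j))"
    using ij d by (intro sum.cong) (auto simp: algebra_simps power2_eq_square)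
  also have "\<dots> = ?l $$ (i, j)" using G[OF c(1) ij] by simp
  finally show "?l $$ (i, j) = ?r $$ (i, j)" by simp
qed (use A B in auto)

section \<open>Elementary inequalities\<close>

lemma sum_le_of_powr_sum_le:
  fixes a b p u :: real
  assumes "0 \<le> a" "0 \<le> b" "1 < p" "0 \<le> u" "a powr p + b powr p \<le> 2 * (1 + u)"
  shows "a + b \<le> 2 + 2 * u"
proof -
  have "a + b = (a powr p) powr (1 / p) + (b powr p) powr (1 / p)"
    using assms by (simp add: powr_powr)
  also have "\<dots> \<le> 2 * ((a powr p + b powr p) / 2) powr (1 / p)"
    using assms by (intro powr_midpoint_concave) auto
  also have "\<dots> \<le> 2 * (1 + u) powr (1 / p)"
    using assms by (intro mult_left_mono powr_mono2) auto
  also have "\<dots> \<le> 2 * (1 + u) powr 1"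
    using assms by (intro mult_left_mono powr_mono) auto
  finally show ?thesis using assms by simp
qed

lemma sum_le_of_squares_sum_le:
  fixes a b w :: real
  assumes "0 \<le> w" "a\<^sup>2 + b\<^sup>2 \<le> 2 + 2 * w"
  shows "a + b \<le> 2 + w"
proof (rule power2_le_imp_le)
  have "(a + b)\<^sup>2 + (a - b)\<^sup>2 = 2 * (a\<^sup>2 + b\<^sup>2)" by (simp add: power2_eq_square algebra_simps)
  hence "(a + b)\<^sup>2 \<le> 2 * (a\<^sup>2 + b\<^sup>2)" using zero_le_power2[of "a - b"] by linarith
  also have "\<dots> \<le> 4 + 4 * w" using assms by simp
  also have "\<dots> \<le> 4 + 4 * w + w\<^sup>2" by simp
  also have "\<dots> = (2 + w)\<^sup>2" by (simp add: power2_eq_square algebra_simps)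
  finally show "(a + b)\<^sup>2 \<le> (2 + w)\<^sup>2" .
qed (use assms in auto)

section \<open>Dual spaces\<close>

lemma dual_spaceD:
  assumes "f \<in> carrier (dual_space X)"
  shows "f \<in> extensional (carrier X)"
    "x \<in> carrier X \<Longrightarrow> y \<in> carrier X \<Longrightarrow> f (x \<oplus>\<^bsub>X\<^esub> y) = f x + f y"
    "x \<in> carrier X \<Longrightarrow> f (a \<odot>\<^bsub>X\<^esub> x) = a * f x"
    "\<exists>C. \<forall>x \<in> carrier X. cmod (f x) \<le> C * \<parallel>x\<parallel>\<^bsub>X\<^esub>"
  using assms by (auto simp: dual_space_def)

lemma dual_spaceI:
  assumes "f \<in> extensional (carrier X)"
    "\<And>x y. x \<in> carrier X \<Longrightarrow> y \<in> carrier X \<Longrightarrow> f (x \<oplus>\<^bsub>X\<^esub> y) = f x + f y"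
    "\<And>a x. x \<in> carrier X \<Longrightarrow> f (a \<odot>\<^bsub>X\<^esub> x) = a * f x"
    "\<And>x. x \<in> carrier X \<Longrightarrow> cmod (f x) \<le> C * \<parallel>x\<parallel>\<^bsub>X\<^esub>"
  shows "f \<in> carrier (dual_space X)"
  using assms by (auto simp: dual_space_def intro!: exI[of _ C])

lemma dual_space_sel:
  "add (dual_space X) f g = (\<lambda>x \<in> carrier X. f x + g x)"
  "smult (dual_space X) a f = (\<lambda>x \<in> carrier X. a * f x)"
  "mnorm (dual_space X) f = (SUP x \<in> {x \<in> carrier X. \<parallel>x\<parallel>\<^bsub>X\<^esub> \<le> 1}. cmod (f x))"
  by (simp_all add: dual_space_def)

section \<open>Weighted sums of Schatten classes\<close>

text \<open>
  The points of \<open>D\<close> stand for the classes in the unitary dual and \<open>N\<close> for the dimensions of their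
  representatives. Each dimension occurs twice: as the size of the matrices and as the weight of their
  energy.
\<close>

locale schatten_sum =
  fixes D :: "'i set" and N :: "'i \<Rightarrow> nat"
  assumes nonempty: "D \<noteq> {}" and dim_pos: "c \<in> D \<Longrightarrow> 0 < N c"
begin

definition op_fields :: "('i \<Rightarrow> complex mat) set" where
  "op_fields = (\<Pi>\<^sub>E c \<in> D. carrier_mat (N c) (N c))"

definition fzero :: "'i \<Rightarrow> complex mat" where
  "fzero = (\<lambda>c \<in> D. 0\<^sub>m (N c) (N c))"

definition fadd :: "('i \<Rightarrow> complex mat) \<Rightarrow> ('i \<Rightarrow> complex mat) \<Rightarrow> 'i \<Rightarrow> complex mat" where
  "fadd H K = (\<lambda>c \<in> D. H c + K c)"

definition fscale :: "complex \<Rightarrow> ('i \<Rightarrow> complex mat) \<Rightarrow> 'i \<Rightarrow> complex mat" where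
  "fscale a H = (\<lambda>c \<in> D. a \<cdot>\<^sub>m H c)"

definition fdiff :: "('i \<Rightarrow> complex mat) \<Rightarrow> ('i \<Rightarrow> complex mat) \<Rightarrow> 'i \<Rightarrow> complex mat" where
  "fdiff H K = fadd H (fscale (-1) K)"

lemma op_fieldsD: "H \<in> op_fields \<Longrightarrow> c \<in> D \<Longrightarrow> H c \<in> carrier_mat (N c) (N c)"
  by (auto simp: op_fields_def)

lemma op_fieldsI: "(\<And>c. c \<in> D \<Longrightarrow> f c \<in> carrier_mat (N c) (N c)) \<Longrightarrow> (\<lambda>c \<in> D. f c) \<in> op_fields"
  by (auto simp: op_fields_def)

lemma op_fields_eqI:
  "H \<in> op_fields \<Longrightarrow> K \<in> op_fields \<Longrightarrow> (\<And>c. c \<in> D \<Longrightarrow> H c = K c) \<Longrightarrow> H = K"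
  unfolding op_fields_def by (rule PiE_ext)

lemma field_ops_closed [simp]:
  "fzero \<in> op_fields"
  "H \<in> op_fields \<Longrightarrow> K \<in> op_fields \<Longrightarrow> fadd H K \<in> op_fields"
  "H \<in> op_fields \<Longrightarrow> fscale a H \<in> op_fields"
  "H \<in> op_fields \<Longrightarrow> K \<in> op_fields \<Longrightarrow> fdiff H K \<in> op_fields"
  unfolding fzero_def fadd_def fscale_def fdiff_def
  by (auto intro!: op_fieldsI dest: op_fieldsD)

lemma fzero_app: "c \<in> D \<Longrightarrow> fzero c = 0\<^sub>m (N c) (N c)"
  and fadd_app: "c \<in> D \<Longrightarrow> fadd H K c = H c + K c"
  and fscale_app: "c \<in> D \<Longrightarrow> fscale a H c = a \<cdot>\<^sub>m H c"
  by (auto simp: fzero_def fadd_def fscale_def)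

lemma fdiff_app:
  assumes "H \<in> op_fields" "K \<in> op_fields" "c \<in> D"
  shows "fdiff H K c = H c - K c"
  using op_fieldsD[OF assms(1,3)] op_fieldsD[OF assms(2,3)] assms(3)
  unfolding fdiff_def by (simp add: fadd_app fscale_app) (rule eq_matI; auto)

definition local_energy :: "real \<Rightarrow> ('i \<Rightarrow> complex mat) \<Rightarrow> 'i \<Rightarrow> real" where
  "local_energy p H c = real (N c) * schatten_energy p (H c)"

lemma local_energy_nonneg [simp]: "0 \<le> local_energy p H c"
  by (simp add: local_energy_def)

definition energy :: "real \<Rightarrow> ('i \<Rightarrow> complex mat) \<Rightarrow> real" where
  "energy p H = (\<Sum>\<^sub>\<infinity>c \<in> D. local_energy p H c)"

definition lp :: "real \<Rightarrow> ('i \<Rightarrow> complex mat) set" where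
  "lp p = {H \<in> op_fields. local_energy p H summable_on D}"

definition lp_norm :: "real \<Rightarrow> ('i \<Rightarrow> complex mat) \<Rightarrow> real" where
  "lp_norm p H = energy p H powr (1 / p)"

lemma energy_nonneg [simp]: "0 \<le> energy p H"
  unfolding energy_def by (rule infsum_nonneg) simp

lemma lp_norm_nonneg [simp]: "0 \<le> lp_norm p H"
  by (simp add: lp_norm_def)

lemma energy_lp_norm: "p > 0 \<Longrightarrow> energy p H = lp_norm p H powr p"
  by (simp add: lp_norm_def powr_powr)

lemma lp_op_fields: "H \<in> lp p \<Longrightarrow> H \<in> op_fields"
  by (simp add: lp_def)

lemma partial_energy_le:
  assumes "H \<in> lp p" "finite F" "F \<subseteq> D"
  shows "sum (local_energy p H) F \<le> energy p H"
  unfolding energy_def using assms by (intro finite_sum_le_infsum) (auto simp: lp_def)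

lemma lp_energy_boundedI:
  assumes "H \<in> op_fields" and b: "\<And>F. finite F \<Longrightarrow> F \<subseteq> D \<Longrightarrow> sum (local_energy p H) F \<le> C"
  shows "H \<in> lp p" "energy p H \<le> C"
proof -
  have s: "local_energy p H summable_on D"
    by (rule nonneg_bdd_above_summable_on) (use b in \<open>auto intro!: bdd_aboveI2[where M = C]\<close>)
  thus "H \<in> lp p" using assms(1) by (simp add: lp_def)
  show "energy p H \<le> C" unfolding energy_def by (rule infsum_le_finite_sums[OF s b])
qed

lemma local_energy_scale:
  assumes "H \<in> op_fields" "c \<in> D" "0 < p"
  shows "local_energy p (fscale a H) c = cmod a powr p * local_energy p H c"
  using schatten_energy_smult[OF op_fieldsD[OF assms(1,2)] assms(3), of a] assms(2)
  by (simp add: local_energy_def fscale_app)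

lemma lp_scale:
  assumes H: "H \<in> lp p" and p: "0 < p"
  shows "fscale a H \<in> lp p" "energy p (fscale a H) = cmod a powr p * energy p H"
    "lp_norm p (fscale a H) = cmod a * lp_norm p H"
proof -
  have Hf: "H \<in> op_fields" and s: "local_energy p H summable_on D" using H by (auto simp: lp_def)
  have eq: "\<And>c. c \<in> D \<Longrightarrow> local_energy p (fscale a H) c = cmod a powr p * local_energy p H c"
    using local_energy_scale[OF Hf _ p] .
  have "(\<lambda>c. cmod a powr p * local_energy p H c) summable_on D"
    using s by (rule summable_on_cmult_right)
  thus "fscale a H \<in> lp p" using eq Hf by (simp add: lp_def cong: summable_on_cong)
  show e: "energy p (fscale a H) = cmod a powr p * energy p H"
    unfolding energy_def infsum_cmult_right'[symmetric] by (rule infsum_cong) (rule eq)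
  show "lp_norm p (fscale a H) = cmod a * lp_norm p H"
    unfolding lp_norm_def e using p by (simp add: powr_mult powr_powr)
qed

lemma local_energy_eq_0D:
  assumes "H \<in> op_fields" "c \<in> D" "0 < p" "local_energy p H c = 0"
  shows "H c = 0\<^sub>m (N c) (N c)"
  using assms schatten_energy_eq_0_iff[OF op_fieldsD[OF assms(1,2)] assms(3)] dim_pos[OF assms(2)]
  by (simp add: local_energy_def)

lemma local_energy_fzero: "c \<in> D \<Longrightarrow> 0 < p \<Longrightarrow> local_energy p fzero c = 0"
  using schatten_energy_eq_0_iff[of "0\<^sub>m (N c) (N c)" "N c" p] by (simp add: local_energy_def fzero_app)

lemma lp_zero:
  assumes "0 < p"
  shows "fzero \<in> lp p" "energy p fzero = 0" "lp_norm p fzero = 0"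
proof -
  have e: "\<And>F. F \<subseteq> D \<Longrightarrow> sum (local_energy p fzero) F \<le> 0"
    using local_energy_fzero[OF _ assms] by (intro sum_nonpos) auto
  show "fzero \<in> lp p" by (rule lp_energy_boundedI[OF _ e]) auto
  have "energy p fzero \<le> 0" by (rule lp_energy_boundedI[OF _ e]) auto
  thus "energy p fzero = 0" using energy_nonneg[of p fzero] by linarith
  thus "lp_norm p fzero = 0" by (simp add: lp_norm_def)
qed

lemma lp_norm_eq_0D:
  assumes H: "H \<in> lp p" and p: "0 < p" and 0: "lp_norm p H = 0"
  shows "H = fzero"
proof (rule op_fields_eqI)
  fix c assume c: "c \<in> D"
  have "energy p H \<le> 0" using 0 p by (simp add: lp_norm_def)
  hence "local_energy p H c = 0"
    using nonneg_infsum_le_0D[of "local_energy p H" D c] H c by (simp add: energy_def lp_def)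
  thus "H c = fzero c" using local_energy_eq_0D[OF lp_op_fields[OF H] c p] by (simp add: fzero_app c)
qed (use H lp_op_fields in auto)

section \<open>Hoelder duality and completeness\<close>

definition local_pairing :: "('i \<Rightarrow> complex mat) \<Rightarrow> ('i \<Rightarrow> complex mat) \<Rightarrow> 'i \<Rightarrow> complex" where
  "local_pairing H K c = of_nat (N c) * frob (H c) (K c)"

lemma local_pairing_add:
  assumes "H \<in> op_fields" "H' \<in> op_fields" "K \<in> op_fields" "c \<in> D"
  shows "local_pairing (fadd H H') K c = local_pairing H K c + local_pairing H' K c"
  using assms frob_add_left[OF op_fieldsD[OF assms(1,4)] op_fieldsD[OF assms(2,4)] op_fieldsD[OF assms(3,4)]]
  by (simp add: local_pairing_def fadd_app ring_distribs)

lemma local_pairing_scale: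
  assumes "H \<in> op_fields" "K \<in> op_fields" "c \<in> D"
  shows "local_pairing (fscale a H) K c = a * local_pairing H K c"
  using assms frob_smult_left[OF op_fieldsD[OF assms(1,3)] op_fieldsD[OF assms(2,3)]]
  by (simp add: local_pairing_def fscale_app)

lemma local_pairing_cnj:
  assumes "H \<in> op_fields" "K \<in> op_fields" "c \<in> D"
  shows "local_pairing K H c = cnj (local_pairing H K c)"
  using frob_cnj[OF op_fieldsD[OF assms(1,3)] op_fieldsD[OF assms(2,3)]]
  by (simp add: local_pairing_def)

lemma local_pairing_scale_right:
  assumes "H \<in> op_fields" "K \<in> op_fields" "c \<in> D"
  shows "local_pairing H (fscale a K) c = cnj a * local_pairing H K c"
  using local_pairing_cnj[OF field_ops_closed(3)[OF assms(2)] assms(1,3)]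
    local_pairing_scale[OF assms(2,1,3)] local_pairing_cnj[OF assms] by simp

lemma local_Young:
  assumes "H \<in> op_fields" "K \<in> op_fields" "c \<in> D" and pq: "conjugate_exponents p q"
  shows "cmod (local_pairing H K c) \<le> local_energy p H c / p + local_energy q K c / q"
proof -
  have "cmod (local_pairing H K c) = real (N c) * cmod (frob (H c) (K c))"
    by (simp add: local_pairing_def norm_mult)
  also have "\<dots> \<le> real (N c) * (schatten_energy p (H c) / p + schatten_energy q (K c) / q)"
    by (intro mult_left_mono schatten_Young[OF op_fieldsD[OF assms(1,3)] op_fieldsD[OF assms(2,3)] pq]) auto
  finally show ?thesis by (simp add: local_energy_def ring_distribs)
qed

text \<open>
  Young's inequality is applied after both fields have been scaled to energy one on \<open>F\<close>. If one of
  the energies vanishes, so does the corresponding field on \<open>F\<close>.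
\<close>

lemma finite_Hoelder:
  assumes H: "H \<in> op_fields" and K: "K \<in> op_fields" and F: "finite F" "F \<subseteq> D" and pq: "conjugate_exponents p q"
  shows "cmod (sum (local_pairing H K) F)
    \<le> sum (local_energy p H) F powr (1 / p) * sum (local_energy q K) F powr (1 / q)"
proof -
  note pqD = conjugate_exponentsD[OF pq]
  define a b where "a = sum (local_energy p H) F" and "b = sum (local_energy q K) F"
  have ab: "0 \<le> a" "0 \<le> b" by (auto simp: a_def b_def intro: sum_nonneg)
  show ?thesis
  proof (cases "a = 0 \<or> b = 0")
    case True
    have z: "H c = 0\<^sub>m (N c) (N c) \<or> K c = 0\<^sub>m (N c) (N c)" if c: "c \<in> F" for c
    proof -
      have "local_energy p H c = 0 \<or> local_energy q K c = 0"
        using True c F unfolding a_def b_def by (auto simp: sum_nonneg_eq_0_iff)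
      moreover have "c \<in> D" using c F by auto
      ultimately show ?thesis using local_energy_eq_0D[OF H _ pqD(4)] local_energy_eq_0D[OF K _ pqD(5)] by blast
    qed
    have "local_pairing H K c = 0" if c: "c \<in> F" for c
    proof -
      have cD: "c \<in> D" using c F by auto
      show ?thesis
        using z[OF c] op_fieldsD[OF H cD] op_fieldsD[OF K cD]
        by (auto simp: local_pairing_def frob_eq[of _ "N c" "N c"])
    qed
    hence "sum (local_pairing H K) F = 0" by (intro sum.neutral) auto
    thus ?thesis by simp
  next
    case False
    hence ab0: "a > 0" "b > 0" using ab by auto
    define r s where "r = a powr (-(1 / p))" and "s = b powr (-(1 / q))"
    have rs: "r > 0" "s > 0" using ab0 by (auto simp: r_def s_def)
    have ra: "r powr p * a = 1" "s powr q * b = 1"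
      using ab0 pqD by (simp_all add: r_def s_def powr_powr powr_neg_one)
    let ?H = "fscale (complex_of_real r) H" and ?K = "fscale (complex_of_real s) K"
    have Hs: "?H \<in> op_fields" and Ks: "?K \<in> op_fields" using H K by auto
    have FD: "\<And>c. c \<in> F \<Longrightarrow> c \<in> D" using F by auto
    have "r * s * cmod (sum (local_pairing H K) F) = cmod (\<Sum>c\<in>F. r * s * local_pairing H K c)"
      unfolding sum_distrib_left[symmetric] using rs by (simp add: norm_mult)
    also have "\<dots> = cmod (sum (local_pairing ?H ?K) F)"
      using FD H K by (intro arg_cong[where f = cmod] sum.cong)
        (auto simp: local_pairing_scale local_pairing_scale_right)
    also have "\<dots> \<le> (\<Sum>c\<in>F. local_energy p ?H c / p + local_energy q ?K c / q)"
      by (intro sum_norm_le local_Young Hs Ks pq FD)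
    also have "\<dots> = (\<Sum>c\<in>F. r powr p * local_energy p H c / p + s powr q * local_energy q K c / q)"
      using FD H K pqD rs by (intro sum.cong) (auto simp: local_energy_scale)
    also have "\<dots> = r powr p * a / p + s powr q * b / q"
      by (simp add: sum.distrib a_def b_def sum_distrib_left sum_divide_distrib)
    also have "\<dots> = 1" using ra pqD(3) by simp
    finally have "r * s * cmod (sum (local_pairing H K) F) \<le> 1" .
    hence "cmod (sum (local_pairing H K) F) \<le> 1 / (r * s)"
      using rs by (simp add: field_simps)
    also have "\<dots> = a powr (1 / p) * b powr (1 / q)"
      unfolding r_def s_def by (simp add: powr_minus field_simps)
    finally show ?thesis by (simp add: a_def b_def)
  qed
qed

lemma finite_Hoelder_norm:
  assumes H: "H \<in> lp p" and K: "K \<in> op_fields" and F: "finite F" "F \<subseteq> D" and pq: "conjugate_exponents p q"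
  shows "cmod (sum (local_pairing H K) F) \<le> lp_norm p H * sum (local_energy q K) F powr (1 / q)"
proof -
  note pqD = conjugate_exponentsD[OF pq]
  have "sum (local_energy p H) F powr (1 / p) \<le> lp_norm p H"
    unfolding lp_norm_def using partial_energy_le[OF H F] pqD
    by (intro powr_mono2) (auto intro: sum_nonneg)
  thus ?thesis
    using finite_Hoelder[OF lp_op_fields[OF H] K F pq] by (meson mult_right_mono order_trans powr_ge_zero)
qed

text \<open>
  The norming matrices are chosen separately at each point. The equality of their energies with those
  of \<open>H\<close> holds pointwise, so it survives summation.
\<close>

lemma norming_field:
  assumes H: "H \<in> op_fields" and pq: "conjugate_exponents p q"
  obtains K where "K \<in> op_fields"
    "\<And>c. c \<in> D \<Longrightarrow> local_energy q K c = local_energy p H c"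
    "\<And>c. c \<in> D \<Longrightarrow> local_pairing H K c = complex_of_real (local_energy p H c)"
proof -
  note pqD = conjugate_exponentsD[OF pq]
  have "\<forall>c\<in>D. \<exists>M. M \<in> carrier_mat (N c) (N c) \<and> schatten_energy q M = schatten_energy p (H c) \<and>
       frob (H c) M = complex_of_real (schatten_energy p (H c))"
    using schatten_norming[OF op_fieldsD[OF H] pq] by blast
  then obtain k where k: "\<forall>c\<in>D. k c \<in> carrier_mat (N c) (N c) \<and> schatten_energy q (k c) = schatten_energy p (H c) \<and>
       frob (H c) (k c) = complex_of_real (schatten_energy p (H c))"
    using bchoice[of D "\<lambda>c M. M \<in> carrier_mat (N c) (N c) \<and> schatten_energy q M = schatten_energy p (H c) \<and>
       frob (H c) M = complex_of_real (schatten_energy p (H c))"] by blast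
  show thesis
    by (rule that[of "\<lambda>c\<in>D. k c"]) (use k in \<open>auto intro!: op_fieldsI simp: local_energy_def local_pairing_def\<close>)
qed

text \<open>
  The converse of Hoelder's inequality. Tested against the norming field, the bound reads
  \<open>S \<le> C * S powr (1 / q)\<close> for the partial energies \<open>S\<close> of \<open>H\<close>, that is \<open>S \<le> C powr p\<close>.
  Finite pairings are linear in \<open>H\<close> and continuous in its entries, so the triangle inequality,
  completeness and the description of functionals follow from this criterion.
\<close>

lemma lp_by_duality:
  assumes H: "H \<in> op_fields" and C: "0 \<le> C" and pq: "conjugate_exponents p q"
    and b: "\<And>F K. finite F \<Longrightarrow> F \<subseteq> D \<Longrightarrow> K \<in> op_fields \<Longrightarrow>
      cmod (sum (local_pairing H K) F) \<le> C * sum (local_energy q K) F powr (1 / q)"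
  shows "H \<in> lp p" "lp_norm p H \<le> C"
proof -
  note pqD = conjugate_exponentsD[OF pq]
  obtain K where K: "K \<in> op_fields"
    "\<And>c. c \<in> D \<Longrightarrow> local_energy q K c = local_energy p H c"
    "\<And>c. c \<in> D \<Longrightarrow> local_pairing H K c = complex_of_real (local_energy p H c)"
    using norming_field[OF H pq] by blast
  have bound: "sum (local_energy p H) F \<le> C powr p" if F: "finite F" "F \<subseteq> D" for F
  proof -
    define S where "S = sum (local_energy p H) F"
    have S0: "0 \<le> S" unfolding S_def by (rule sum_nonneg) simp
    have 1: "sum (local_pairing H K) F = complex_of_real S"
      unfolding S_def of_real_sum using F K(3) by (intro sum.cong) auto
    have 2: "sum (local_energy q K) F = S"
      unfolding S_def using F K(2) by (intro sum.cong) auto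
    have *: "S \<le> C * S powr (1 / q)" using b[OF F K(1)] S0 unfolding 1 2 by simp
    show "S \<le> C powr p"
    proof (cases "S = 0")
      case False
      hence S: "S > 0" using S0 by simp
      have "S powr (1 / p) * S powr (1 / q) = S"
        unfolding powr_add[symmetric] pqD(3) using S by simp
      hence "S powr (1 / p) * S powr (1 / q) \<le> C * S powr (1 / q)" using * by simp
      hence "S powr (1 / p) \<le> C" using S by simp
      hence "(S powr (1 / p)) powr p \<le> C powr p" using pqD by (intro powr_mono2) auto
      thus ?thesis using S pqD by (simp add: powr_powr)
    qed simp
  qed
  show "H \<in> lp p" by (rule lp_energy_boundedI(1)[OF H bound])
  have "energy p H \<le> C powr p" by (rule lp_energy_boundedI(2)[OF H bound])
  hence "lp_norm p H \<le> (C powr p) powr (1 / p)"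
    unfolding lp_norm_def using pqD by (intro powr_mono2) auto
  thus "lp_norm p H \<le> C" using C pqD by (simp add: powr_powr)
qed

lemma sum_local_pairing_add:
  assumes "H \<in> op_fields" "H' \<in> op_fields" "K \<in> op_fields" "F \<subseteq> D"
  shows "sum (local_pairing (fadd H H') K) F = sum (local_pairing H K) F + sum (local_pairing H' K) F"
  unfolding sum.distrib[symmetric] using assms by (intro sum.cong local_pairing_add) auto

lemma lp_add:
  assumes H: "H \<in> lp p" and H': "H' \<in> lp p" and p: "1 < p"
  shows "fadd H H' \<in> lp p" "lp_norm p (fadd H H') \<le> lp_norm p H + lp_norm p H'"
proof -
  note pq = conjugate_exponents_exists[OF p]
  let ?q = "p / (p - 1)"
  have b: "cmod (sum (local_pairing (fadd H H') K) F)
      \<le> (lp_norm p H + lp_norm p H') * sum (local_energy ?q K) F powr (1 / ?q)"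
    if F: "finite F" "F \<subseteq> D" and K: "K \<in> op_fields" for F K
    unfolding sum_local_pairing_add[OF lp_op_fields[OF H] lp_op_fields[OF H'] K F(2)] ring_distribs
    by (intro order_trans[OF norm_triangle_ineq] add_mono finite_Hoelder_norm H H' F K pq)
  note c = field_ops_closed(2)[OF lp_op_fields[OF H] lp_op_fields[OF H']]
  show "fadd H H' \<in> lp p" "lp_norm p (fadd H H') \<le> lp_norm p H + lp_norm p H'"
    using lp_by_duality[OF c _ pq b] by auto
qed

lemma lp_diff:
  assumes H: "H \<in> lp p" and H': "H' \<in> lp p" and p: "1 < p"
  shows "fdiff H H' \<in> lp p" "lp_norm p (fdiff H H') \<le> lp_norm p H + lp_norm p H'"
proof -
  note s = lp_scale[OF H', of "-1"]
  show "fdiff H H' \<in> lp p" "lp_norm p (fdiff H H') \<le> lp_norm p H + lp_norm p H'"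
    unfolding fdiff_def using lp_add[OF H s(1) p] s(3) p by auto
qed

definition fsingle :: "'i \<Rightarrow> complex mat \<Rightarrow> 'i \<Rightarrow> complex mat" where
  "fsingle c M = (\<lambda>b \<in> D. if b = c then M else 0\<^sub>m (N b) (N b))"

lemma fsingle_closed [simp]:
  "M \<in> carrier_mat (N c) (N c) \<Longrightarrow> fsingle c M \<in> op_fields"
  unfolding fsingle_def by (auto intro!: op_fieldsI)

text \<open>
  Convergence in norm implies convergence of every matrix entry: an entry is a pairing with a matrix
  unit.
\<close>

lemma entry_bound:
  assumes c: "c \<in> D" and ij: "i < N c" "j < N c" and pq: "conjugate_exponents p q"
  obtains B where "\<And>H. H \<in> lp p \<Longrightarrow> cmod (H c $$ (i, j)) \<le> lp_norm p H * B"
proof -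
  define K where "K = fsingle c (unit_mat (N c) i j)"
  have K: "K \<in> op_fields" unfolding K_def by simp
  have Nc: "1 \<le> real (N c)" using dim_pos[OF c] by simp
  show thesis
  proof (rule that)
    fix H assume H: "H \<in> lp p"
    have "cmod (H c $$ (i, j)) = 1 * cmod (frob (H c) (K c))"
      using frob_unit_mat[OF op_fieldsD[OF lp_op_fields[OF H] c] ij] c by (simp add: K_def fsingle_def)
    also have "\<dots> \<le> real (N c) * cmod (frob (H c) (K c))" using Nc by (intro mult_right_mono) auto
    also have "\<dots> = cmod (sum (local_pairing H K) {c})" by (simp add: local_pairing_def norm_mult)
    also have "\<dots> \<le> lp_norm p H * sum (local_energy q K) {c} powr (1 / q)"
      using c by (intro finite_Hoelder_norm H K pq) auto
    finally show "cmod (H c $$ (i, j)) \<le> lp_norm p H * (sum (local_energy q K) {c} powr (1 / q))" .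
  qed
qed

text \<open>
  The entrywise limit of a Cauchy sequence is its limit in norm, because the bounds on finite pairings
  of \<open>s m - s k\<close> pass to the limit in \<open>k\<close>.
\<close>

lemma lp_complete:
  assumes p: "1 < p" and s: "\<And>m. s m \<in> lp p"
    and Cauchy: "\<And>e. e > 0 \<Longrightarrow> \<exists>M. \<forall>m \<ge> M. \<forall>k \<ge> M. lp_norm p (fdiff (s m) (s k)) < e"
  shows "\<exists>L \<in> lp p. (\<lambda>m. lp_norm p (fdiff (s m) L)) \<longlonglongrightarrow> 0"
proof -
  note pq = conjugate_exponents_exists[OF p]
  let ?q = "p / (p - 1)"
  have sf: "s m \<in> op_fields" for m using lp_op_fields[OF s] .
  have conv: "convergent (\<lambda>m. s m c $$ (i, j))" if c: "c \<in> D" and ij: "i < N c" "j < N c" for c i j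
  proof -
    obtain B where B: "\<And>H. H \<in> lp p \<Longrightarrow> cmod (H c $$ (i, j)) \<le> lp_norm p H * B"
      using entry_bound[OF c ij pq] by blast
    define B' where "B' = max B 1"
    have B': "B' > 0" "\<And>H. H \<in> lp p \<Longrightarrow> cmod (H c $$ (i, j)) \<le> lp_norm p H * B'"
      unfolding B'_def by (simp, rule order_trans[OF B]) (auto intro: mult_left_mono)
    have "Cauchy (\<lambda>m. s m c $$ (i, j))"
    proof (rule CauchyI)
      fix e :: real assume e: "e > 0"
      then obtain M where M: "\<And>m k. m \<ge> M \<Longrightarrow> k \<ge> M \<Longrightarrow> lp_norm p (fdiff (s m) (s k)) < e / B'"
        using Cauchy[of "e / B'"] B' by auto
      have "norm (s m c $$ (i, j) - s k c $$ (i, j)) < e" if "m \<ge> M" "k \<ge> M" for m k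
      proof -
        have "s m c $$ (i, j) - s k c $$ (i, j) = fdiff (s m) (s k) c $$ (i, j)"
          using fdiff_app[OF sf sf c] op_fieldsD[OF sf c, of m] op_fieldsD[OF sf c, of k] ij by simp
        hence "norm (s m c $$ (i, j) - s k c $$ (i, j)) \<le> lp_norm p (fdiff (s m) (s k)) * B'"
          using B'(2)[OF lp_diff(1)[OF s s p]] by simp
        also have "\<dots> < e / B' * B'" using M[OF that] B' by (intro mult_strict_right_mono) auto
        finally show ?thesis using B' by simp
      qed
      thus "\<exists>M. \<forall>m\<ge>M. \<forall>k\<ge>M. norm (s m c $$ (i, j) - s k c $$ (i, j)) < e" by blast
    qed
    thus ?thesis by (rule Cauchy_convergent)
  qed
  define L where "L = (\<lambda>c\<in>D. mat (N c) (N c) (\<lambda>(i, j). lim (\<lambda>m. s m c $$ (i, j))))"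
  have L: "L \<in> op_fields" unfolding L_def by (rule op_fieldsI) simp
  have lim: "(\<lambda>m. s m c $$ (i, j)) \<longlonglongrightarrow> L c $$ (i, j)" if "c \<in> D" "i < N c" "j < N c" for c i j
    using conv[OF that] that
    by (simp add: L_def convergent_LIMSEQ_iff)
  have tail: "fdiff (s m) L \<in> lp p \<and> lp_norm p (fdiff (s m) L) \<le> e"
    if e: "e > 0" and M: "\<And>k. k \<ge> M \<Longrightarrow> lp_norm p (fdiff (s m) (s k)) < e" for e m M
  proof -
    have "cmod (sum (local_pairing (fdiff (s m) L) K) F) \<le> e * sum (local_energy ?q K) F powr (1 / ?q)"
      if F: "finite F" "F \<subseteq> D" and K: "K \<in> op_fields" for F K
    proof (rule tendsto_upperbound)
      have "(\<lambda>k. frob (fdiff (s m) (s k) c) (K c)) \<longlonglongrightarrow> frob (fdiff (s m) L c) (K c)" if "c \<in> F" for c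
      proof -
        have c: "c \<in> D" using that F by auto
        have cs: "s m c - s k c \<in> carrier_mat (N c) (N c)" "s m c - L c \<in> carrier_mat (N c) (N c)"
          "K c \<in> carrier_mat (N c) (N c)" for k
          using op_fieldsD[OF sf c] op_fieldsD[OF L c] op_fieldsD[OF K c] by (auto intro!: minus_carrier_mat)
        show ?thesis
          unfolding fdiff_app[OF sf sf c] fdiff_app[OF sf L c] frob_eq[OF cs(1) cs(3)] frob_eq[OF cs(2) cs(3)]
        proof (intro tendsto_sum tendsto_mult tendsto_const)
          fix j i assume "j \<in> {..<N c}" "i \<in> {..<N c}"
          hence ij: "i < N c" "j < N c" by auto
          have "(s m c - s k c) $$ (i, j) = s m c $$ (i, j) - s k c $$ (i, j)" for k
            using op_fieldsD[OF sf c, of m] op_fieldsD[OF sf c, of k] ij by simp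
          moreover have "(s m c - L c) $$ (i, j) = s m c $$ (i, j) - L c $$ (i, j)"
            using op_fieldsD[OF sf c, of m] op_fieldsD[OF L c] ij by simp
          ultimately show "(\<lambda>k. (s m c - s k c) $$ (i, j)) \<longlonglongrightarrow> (s m c - L c) $$ (i, j)"
            using tendsto_diff[OF tendsto_const lim[OF c ij]] by simp
        qed
      qed
      thus "(\<lambda>k. cmod (sum (local_pairing (fdiff (s m) (s k)) K) F)) \<longlonglongrightarrow> cmod (sum (local_pairing (fdiff (s m) L) K) F)"
        unfolding local_pairing_def by (intro tendsto_intros) auto
      show "\<forall>\<^sub>F k in sequentially. cmod (sum (local_pairing (fdiff (s m) (s k)) K) F)
          \<le> e * sum (local_energy ?q K) F powr (1 / ?q)"
      proof (rule eventually_sequentiallyI[of M])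
        fix k assume k: "k \<ge> M"
        have "cmod (sum (local_pairing (fdiff (s m) (s k)) K) F)
          \<le> lp_norm p (fdiff (s m) (s k)) * sum (local_energy ?q K) F powr (1 / ?q)"
          by (intro finite_Hoelder_norm lp_diff s p K F pq)
        also have "\<dots> \<le> e * sum (local_energy ?q K) F powr (1 / ?q)"
          using M[OF k] by (intro mult_right_mono) auto
        finally show "cmod (sum (local_pairing (fdiff (s m) (s k)) K) F)
          \<le> e * sum (local_energy ?q K) F powr (1 / ?q)" .
      qed
    qed simp
    note b = this
    have "fdiff (s m) L \<in> op_fields" using sf L by simp
    thus ?thesis using lp_by_duality[OF _ less_imp_le[OF e] pq b] by blast
  qed
  have Llp: "L \<in> lp p"
  proof -
    obtain M where M: "\<And>m k. m \<ge> M \<Longrightarrow> k \<ge> M \<Longrightarrow> lp_norm p (fdiff (s m) (s k)) < 1"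
      using Cauchy[of 1] by auto
    have "fdiff (s M) L \<in> lp p" using tail[of 1 M M] M by auto
    hence "fdiff (s M) (fdiff (s M) L) \<in> lp p" by (rule lp_diff(1)[OF s _ p])
    also have "fdiff (s M) (fdiff (s M) L) = L"
    proof (rule op_fields_eqI)
      fix c assume c: "c \<in> D"
      show "fdiff (s M) (fdiff (s M) L) c = L c"
        using op_fieldsD[OF sf c, of M] op_fieldsD[OF L c]
        by (simp add: fdiff_app sf L c) (rule eq_matI; auto)
    qed (use sf L in auto)
    finally show ?thesis .
  qed
  have "(\<lambda>m. lp_norm p (fdiff (s m) L)) \<longlonglongrightarrow> 0"
  proof (rule LIMSEQ_I)
    fix e :: real assume e: "e > 0"
    then obtain M where M: "\<And>m k. m \<ge> M \<Longrightarrow> k \<ge> M \<Longrightarrow> lp_norm p (fdiff (s m) (s k)) < e / 2"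
      using Cauchy[of "e / 2"] by auto
    have "norm (lp_norm p (fdiff (s m) L) - 0) < e" if "m \<ge> M" for m
      using tail[of "e / 2" M m] M[OF that] e by auto
    thus "\<exists>M. \<forall>m\<ge>M. norm (lp_norm p (fdiff (s m) L) - 0) < e" by blast
  qed
  thus ?thesis using Llp by blast
qed

section \<open>Truncation and the representation of functionals\<close>

definition fpart :: "'i set \<Rightarrow> ('i \<Rightarrow> complex mat) \<Rightarrow> 'i \<Rightarrow> complex mat" where
  "fpart F H = (\<lambda>c \<in> D. if c \<in> F then H c else 0\<^sub>m (N c) (N c))"

lemma fpart_closed [simp]: "H \<in> op_fields \<Longrightarrow> fpart F H \<in> op_fields"
  unfolding fpart_def by (auto intro!: op_fieldsI dest: op_fieldsD)

lemma local_energy_fpart: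
  assumes "c \<in> D" "0 < p"
  shows "local_energy p (fpart F H) c = (if c \<in> F then local_energy p H c else 0)"
  using local_energy_fzero[OF assms] assms by (simp add: local_energy_def fpart_def fzero_app)

lemma finite_fpart_lp:
  assumes H: "H \<in> op_fields" and F: "finite F" "F \<subseteq> D" and p: "0 < p"
  shows "fpart F H \<in> lp p" "energy p (fpart F H) = sum (local_energy p H) F"
proof -
  have "(local_energy p (fpart F H) has_sum sum (local_energy p H) F) D"
    using F p by (intro has_sum_finite_neutralI sum.cong) (auto simp: local_energy_fpart)
  thus "fpart F H \<in> lp p" "energy p (fpart F H) = sum (local_energy p H) F"
    using H by (auto simp: lp_def energy_def infsumI summable_on_def)
qed

lemma fpart_tail:
  assumes H: "H \<in> lp p" and F: "finite F" "F \<subseteq> D" and p: "0 < p"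
  shows "energy p (fdiff H (fpart F H)) = energy p H - sum (local_energy p H) F"
proof -
  have s: "local_energy p H summable_on D" using H by (simp add: lp_def)
  have Hf: "H \<in> op_fields" using H by (rule lp_op_fields)
  have eq: "fdiff H (fpart F H) = fpart (- F) H"
  proof (rule op_fields_eqI)
    fix c assume c: "c \<in> D"
    show "fdiff H (fpart F H) c = fpart (- F) H c"
      unfolding fdiff_app[OF Hf fpart_closed[OF Hf] c] using op_fieldsD[OF Hf c] c by (auto simp: fpart_def)
  qed (use Hf in auto)
  have "energy p (fdiff H (fpart F H)) = (\<Sum>\<^sub>\<infinity>c \<in> D. if c \<in> F then 0 else local_energy p H c)"
    unfolding eq energy_def using p by (intro infsum_cong) (simp add: local_energy_fpart)
  also have "\<dots> = (\<Sum>\<^sub>\<infinity>c \<in> D - F. local_energy p H c)"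
    by (rule infsum_cong_neutral) auto
  also have "\<dots> = energy p H - (\<Sum>\<^sub>\<infinity>c \<in> F. local_energy p H c)"
    unfolding energy_def using s F summable_on_subset_banach[OF s F(2)] by (intro infsum_Diff) auto
  finally show ?thesis using F by simp
qed

text \<open>
  Fields with finite support are dense, since the energy of the remainder is the tail of a
  convergent sum.
\<close>

lemma fpart_tendsto:
  assumes H: "H \<in> lp p" and p: "0 < p"
  shows "((\<lambda>F. lp_norm p (fdiff H (fpart F H))) \<longlongrightarrow> 0) (finite_subsets_at_top D)"
proof -
  have s: "local_energy p H summable_on D" using H by (simp add: lp_def)
  have "((\<lambda>F. energy p H - sum (local_energy p H) F) \<longlongrightarrow> energy p H - energy p H) (finite_subsets_at_top D)"
    unfolding energy_def by (intro tendsto_diff tendsto_const infsum_tendsto s)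
  moreover have "\<forall>\<^sub>F F in finite_subsets_at_top D.
      energy p H - sum (local_energy p H) F = energy p (fdiff H (fpart F H))"
    using fpart_tail[OF H _ _ p] by (intro eventually_finite_subsets_at_top_weakI) auto
  ultimately have "((\<lambda>F. energy p (fdiff H (fpart F H))) \<longlongrightarrow> 0) (finite_subsets_at_top D)"
    using tendsto_cong by fastforce
  hence "((\<lambda>F. energy p (fdiff H (fpart F H)) powr (1 / p)) \<longlongrightarrow> 0 powr (1 / p)) (finite_subsets_at_top D)"
    using p by (intro tendsto_powr2 tendsto_const) auto
  thus ?thesis by (simp add: lp_norm_def)
qed

definition pairing :: "('i \<Rightarrow> complex mat) \<Rightarrow> ('i \<Rightarrow> complex mat) \<Rightarrow> complex" where
  "pairing H K = (\<Sum>\<^sub>\<infinity>c \<in> D. local_pairing H K c)"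

lemma local_pairing_summable:
  assumes H: "H \<in> lp p" and K: "K \<in> lp q" and pq: "conjugate_exponents p q"
  shows "local_pairing H K summable_on D"
proof (rule abs_summable_summable, rule abs_summable_on_comparison_test')
  show "(\<lambda>c. local_energy p H c * (1 / p) + local_energy q K c * (1 / q)) summable_on D"
    using H K by (intro summable_on_add summable_on_cmult_left) (auto simp: lp_def)
  show "\<And>c. c \<in> D \<Longrightarrow> norm (local_pairing H K c) \<le> local_energy p H c * (1 / p) + local_energy q K c * (1 / q)"
    using local_Young[OF lp_op_fields[OF H] lp_op_fields[OF K] _ pq] by simp
qed

lemma Hoelder:
  assumes H: "H \<in> lp p" and K: "K \<in> lp q" and pq: "conjugate_exponents p q"
  shows "cmod (pairing H K) \<le> lp_norm p H * lp_norm q K"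
proof -
  note pqD = conjugate_exponentsD[OF pq]
  have "((\<lambda>F. cmod (sum (local_pairing H K) F)) \<longlongrightarrow> cmod (pairing H K)) (finite_subsets_at_top D)"
    unfolding pairing_def by (intro tendsto_norm infsum_tendsto local_pairing_summable[OF H K pq])
  moreover have "\<forall>\<^sub>F F in finite_subsets_at_top D. cmod (sum (local_pairing H K) F) \<le> lp_norm p H * lp_norm q K"
  proof (rule eventually_finite_subsets_at_top_weakI)
    fix F assume F: "finite F" "F \<subseteq> D"
    have "cmod (sum (local_pairing H K) F) \<le> lp_norm p H * sum (local_energy q K) F powr (1 / q)"
      by (rule finite_Hoelder_norm[OF H lp_op_fields[OF K] F pq])
    also have "\<dots> \<le> lp_norm p H * lp_norm q K"
      unfolding lp_norm_def[of q] using partial_energy_le[OF K F] pqD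
      by (intro mult_left_mono powr_mono2) (auto intro: sum_nonneg)
    finally show "cmod (sum (local_pairing H K) F) \<le> lp_norm p H * lp_norm q K" .
  qed
  ultimately show ?thesis by (rule tendsto_upperbound) simp
qed

lemma pairing_add_left:
  assumes "H \<in> lp p" "H' \<in> lp p" "K \<in> lp q" "conjugate_exponents p q"
  shows "pairing (fadd H H') K = pairing H K + pairing H' K"
proof -
  have "pairing (fadd H H') K = (\<Sum>\<^sub>\<infinity>c \<in> D. local_pairing H K c + local_pairing H' K c)"
    unfolding pairing_def using assms
    by (intro infsum_cong local_pairing_add) (auto dest: lp_op_fields)
  thus ?thesis unfolding pairing_def using local_pairing_summable assms by (simp add: infsum_add)
qed

lemma pairing_scale_left:
  assumes "H \<in> op_fields" "K \<in> op_fields"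
  shows "pairing (fscale a H) K = a * pairing H K"
proof -
  have "pairing (fscale a H) K = (\<Sum>\<^sub>\<infinity>c \<in> D. a * local_pairing H K c)"
    unfolding pairing_def using assms by (intro infsum_cong local_pairing_scale) auto
  thus ?thesis unfolding pairing_def by (simp add: infsum_cmult_right')
qed

lemma pairing_cnj:
  assumes "H \<in> op_fields" "K \<in> op_fields"
  shows "pairing K H = cnj (pairing H K)"
proof -
  have "pairing K H = (\<Sum>\<^sub>\<infinity>c \<in> D. cnj (local_pairing H K c))"
    unfolding pairing_def using assms by (intro infsum_cong local_pairing_cnj) auto
  thus ?thesis unfolding pairing_def by simp
qed

lemma pairing_diff_left:
  assumes "H \<in> lp p" "H' \<in> lp p" "K \<in> lp q" "conjugate_exponents p q"
  shows "pairing (fdiff H H') K = pairing H K - pairing H' K"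
proof -
  note pqD = conjugate_exponentsD[OF assms(4)]
  show ?thesis
    unfolding fdiff_def
    using pairing_add_left[OF assms(1) lp_scale(1)[OF assms(2) pqD(4)] assms(3,4), of "-1"]
      pairing_scale_left[OF lp_op_fields[OF assms(2)] lp_op_fields[OF assms(3)], of "-1"] by simp
qed

text \<open>
  A norming field of \<open>H\<close>, divided by its norm. The field \<open>0\<close>, normed by itself, is the reason why the
  norm of \<open>K\<close> is only bounded by one.
\<close>

lemma norming_functional:
  assumes H: "H \<in> lp p" and pq: "conjugate_exponents p q"
  obtains K where "K \<in> lp q" "lp_norm q K \<le> 1" "pairing H K = complex_of_real (lp_norm p H)"
proof -
  note pqD = conjugate_exponentsD[OF pq]
  have Hf: "H \<in> op_fields" and s: "local_energy p H summable_on D" using H by (auto simp: lp_def)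
  obtain K where K: "K \<in> op_fields"
    "\<And>c. c \<in> D \<Longrightarrow> local_energy q K c = local_energy p H c"
    "\<And>c. c \<in> D \<Longrightarrow> local_pairing H K c = complex_of_real (local_energy p H c)"
    using norming_field[OF Hf pq] by blast
  have Klp: "K \<in> lp q" using K s by (simp add: lp_def cong: summable_on_cong)
  have eK: "energy q K = energy p H" unfolding energy_def using K(2) by (rule infsum_cong)
  have "(local_energy p H has_sum energy p H) D" unfolding energy_def using s by (rule has_sum_infsum)
  hence "((\<lambda>c. complex_of_real (local_energy p H c)) has_sum complex_of_real (energy p H)) D"
    by (rule has_sum_of_real)
  hence pHK: "pairing H K = complex_of_real (energy p H)"
    unfolding pairing_def using K(3) infsumI by (metis (no_types, lifting) infsum_cong)
  show thesis
  proof (cases "energy p H = 0")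
    case True
    hence "lp_norm p H = 0" "lp_norm q K = 0" unfolding lp_norm_def eK by auto
    thus thesis using that[OF Klp] pHK True by simp
  next
    case False
    hence S: "energy p H > 0" using energy_nonneg[of p H] by linarith
    define r where "r = energy p H powr (- (1 / q))"
    have r: "r > 0" using S by (simp add: r_def)
    let ?K = "fscale (complex_of_real r) K"
    have "lp_norm q ?K = r * energy p H powr (1 / q)"
      using lp_scale(3)[OF Klp pqD(5), of "complex_of_real r"] r by (simp add: lp_norm_def eK)
    also have "\<dots> = 1" unfolding r_def powr_add[symmetric] using S by simp
    finally have n: "lp_norm q ?K \<le> 1" by simp
    have "pairing H ?K = cnj (pairing ?K H)" by (rule pairing_cnj) (use Hf K in auto)
    also have "pairing ?K H = complex_of_real r * cnj (pairing H K)"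
      using pairing_scale_left[OF K(1) Hf] pairing_cnj[OF Hf K(1)] by simp
    also have "cnj \<dots> = complex_of_real (energy p H powr (- (1 / q)) * energy p H powr 1)"
      unfolding pHK r_def using S by simp
    also have "\<dots> = complex_of_real (lp_norm p H)"
    proof -
      have "- (1 / q) + 1 = 1 / p" using pqD(3) by simp
      thus ?thesis unfolding powr_add[symmetric] lp_norm_def by simp
    qed
    finally show thesis using that[OF lp_scale(1)[OF Klp pqD(5)] n] by simp
  qed
qed

lemma fsingle_lp: "c \<in> D \<Longrightarrow> M \<in> carrier_mat (N c) (N c) \<Longrightarrow> 0 < p \<Longrightarrow> fsingle c M \<in> lp p"
proof -
  assume c: "c \<in> D" "M \<in> carrier_mat (N c) (N c)" "0 < p"
  have "fpart {c} (fsingle c M) = fsingle c M"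
    by (auto simp: fpart_def fsingle_def restrict_def fun_eq_iff)
  thus "fsingle c M \<in> lp p" using finite_fpart_lp(1)[of "fsingle c M" "{c}" p] c by simp
qed

text \<open>
  The values of \<open>\<phi>\<close> on fields supported at one point determine a candidate \<open>K\<close>. On fields with finite
  support \<open>\<phi>\<close> is the pairing with \<open>K\<close>, so the bound on \<open>\<phi>\<close> puts \<open>K\<close> into the \<open>q\<close>-space by the
  converse of Hoelder's inequality; density extends the formula to all fields.
\<close>

lemma lp_dual_representation:
  assumes pq: "conjugate_exponents p q" and C: "0 \<le> C"
    and add: "\<And>H K. H \<in> lp p \<Longrightarrow> K \<in> lp p \<Longrightarrow> \<phi> (fadd H K) = \<phi> H + \<phi> K"
    and scale: "\<And>a H. H \<in> lp p \<Longrightarrow> \<phi> (fscale a H) = a * \<phi> H"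
    and bound: "\<And>H. H \<in> lp p \<Longrightarrow> cmod (\<phi> H) \<le> C * lp_norm p H"
  obtains K where "K \<in> lp q" "lp_norm q K \<le> C" "\<And>H. H \<in> lp p \<Longrightarrow> \<phi> H = pairing H K"
proof -
  note pqD = conjugate_exponentsD[OF pq]
  \<comment> \<open>The division by \<open>N c\<close> cancels the weight in the pairing.\<close>
  define K where "K = (\<lambda>c \<in> D. mat (N c) (N c) (\<lambda>(i, j). cnj (\<phi> (fsingle c (unit_mat (N c) i j))) / of_nat (N c)))"
  have K: "K \<in> op_fields" unfolding K_def by (rule op_fieldsI) simp
  have single: "\<phi> (fsingle c (H c)) = local_pairing H K c" if H: "H \<in> op_fields" and c: "c \<in> D" for H c
  proof -
    have Hc: "H c \<in> carrier_mat (N c) (N c)" and Kc: "K c \<in> carrier_mat (N c) (N c)"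
      using op_fieldsD H K c by auto
    have "\<phi> (fsingle c (H c)) = (\<Sum>j<N c. \<Sum>i<N c. H c $$ (i, j) * \<phi> (fsingle c (unit_mat (N c) i j)))"
    proof (rule matrix_functional_expansion[OF _ _ Hc])
      fix A B :: "complex mat" assume AB: "A \<in> carrier_mat (N c) (N c)" "B \<in> carrier_mat (N c) (N c)"
      have "fsingle c (A + B) = fadd (fsingle c A) (fsingle c B)"
        unfolding fsingle_def fadd_def by (auto simp: restrict_def fun_eq_iff)
      thus "\<phi> (fsingle c (A + B)) = \<phi> (fsingle c A) + \<phi> (fsingle c B)"
        using add[OF fsingle_lp[OF c AB(1) pqD(4)] fsingle_lp[OF c AB(2) pqD(4)]] by simp
    next
      fix a and A :: "complex mat" assume A: "A \<in> carrier_mat (N c) (N c)"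
      have "fsingle c (a \<cdot>\<^sub>m A) = fscale a (fsingle c A)"
        unfolding fsingle_def fscale_def by (auto simp: restrict_def fun_eq_iff)
      thus "\<phi> (fsingle c (a \<cdot>\<^sub>m A)) = a * \<phi> (fsingle c A)"
        using scale[OF fsingle_lp[OF c A pqD(4)]] by simp
    qed
    also have "\<dots> = local_pairing H K c"
      unfolding local_pairing_def frob_eq[OF Hc Kc] sum_distrib_left
      using c dim_pos[OF c] by (intro sum.cong) (auto simp: K_def)
    finally show ?thesis .
  qed
  have finite_part: "\<phi> (fpart F H) = sum (local_pairing H K) F"
    if "finite F" "F \<subseteq> D" and H: "H \<in> op_fields" for F H
    using that(1,2)
  proof (induction F rule: finite_induct)
    case empty
    have "fpart {} H = fscale 0 fzero" unfolding fpart_def fscale_def fzero_def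
      by (auto simp: restrict_def fun_eq_iff)
    thus ?case using scale[OF lp_zero(1)[OF pqD(4)], of 0] by simp
  next
    case (insert c F)
    have cD: "c \<in> D" and FD: "F \<subseteq> D" using insert.prems by auto
    have "fpart (insert c F) H = fadd (fpart F H) (fsingle c (H c))"
    proof (rule op_fields_eqI)
      fix b assume b: "b \<in> D"
      show "fpart (insert c F) H b = fadd (fpart F H) (fsingle c (H c)) b"
        using op_fieldsD[OF H b] b insert.hyps by (auto simp: fadd_app fpart_def fsingle_def)
    qed (use H op_fieldsD[OF H cD] in auto)
    hence "\<phi> (fpart (insert c F) H) = \<phi> (fpart F H) + \<phi> (fsingle c (H c))"
      using add[OF finite_fpart_lp(1)[OF H insert.hyps(1) FD pqD(4)] fsingle_lp[OF cD op_fieldsD[OF H cD] pqD(4)]]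
      by simp
    thus ?case using insert.IH[OF FD] single[OF H cD] insert.hyps by simp
  qed
  have b: "cmod (sum (local_pairing K H) F) \<le> C * sum (local_energy p H) F powr (1 / p)"
    if F: "finite F" "F \<subseteq> D" and H: "H \<in> op_fields" for F H
  proof -
    have "sum (local_pairing K H) F = cnj (sum (local_pairing H K) F)"
      unfolding cnj_sum using F H K by (intro sum.cong local_pairing_cnj) auto
    hence "cmod (sum (local_pairing K H) F) = cmod (\<phi> (fpart F H))"
      unfolding finite_part[OF F H] by (simp only: complex_mod_cnj)
    also have "\<dots> \<le> C * lp_norm p (fpart F H)" by (rule bound[OF finite_fpart_lp(1)[OF H F pqD(4)]])
    finally show ?thesis unfolding lp_norm_def finite_fpart_lp(2)[OF H F pqD(4)] .
  qed
  note Kq = lp_by_duality[OF K C conjugate_exponents_sym[OF pq] b]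
  have "\<phi> H = pairing H K" if H: "H \<in> lp p" for H
  proof -
    have Hf: "H \<in> op_fields" using H by (rule lp_op_fields)
    have "((\<lambda>F. \<phi> H - \<phi> (fpart F H)) \<longlongrightarrow> 0) (finite_subsets_at_top D)"
    proof (rule tendsto_0_le[where K = 1])
      show "((\<lambda>F. C * lp_norm p (fdiff H (fpart F H))) \<longlongrightarrow> 0) (finite_subsets_at_top D)"
        using tendsto_mult_right_zero[OF fpart_tendsto[OF H pqD(4)]] .
      show "\<forall>\<^sub>F F in finite_subsets_at_top D. norm (\<phi> H - \<phi> (fpart F H)) \<le> norm (C * lp_norm p (fdiff H (fpart F H))) * 1"
      proof (rule eventually_finite_subsets_at_top_weakI)
        fix F assume F: "finite F" "F \<subseteq> D"
        note P = finite_fpart_lp(1)[OF Hf F pqD(4)]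
        have "\<phi> (fdiff H (fpart F H)) = \<phi> H - \<phi> (fpart F H)"
          unfolding fdiff_def using add[OF H lp_scale(1)[OF P pqD(4)]] scale[OF P] by simp
        thus "norm (\<phi> H - \<phi> (fpart F H)) \<le> norm (C * lp_norm p (fdiff H (fpart F H))) * 1"
          using bound[OF lp_diff(1)[OF H P pqD(1)]] C by simp
      qed
    qed
    hence "((\<lambda>F. \<phi> H - (\<phi> H - \<phi> (fpart F H))) \<longlongrightarrow> \<phi> H - 0) (finite_subsets_at_top D)"
      by (intro tendsto_diff tendsto_const)
    hence "((\<lambda>F. \<phi> (fpart F H)) \<longlongrightarrow> \<phi> H) (finite_subsets_at_top D)" by simp
    moreover have "\<forall>\<^sub>F F in finite_subsets_at_top D. \<phi> (fpart F H) = sum (local_pairing H K) F"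
      using finite_part[OF _ _ Hf] by (intro eventually_finite_subsets_at_top_weakI) auto
    ultimately have "((\<lambda>F. sum (local_pairing H K) F) \<longlongrightarrow> \<phi> H) (finite_subsets_at_top D)"
      using tendsto_cong by fastforce
    hence "(local_pairing H K has_sum \<phi> H) D" by (simp add: has_sum_def)
    thus ?thesis unfolding pairing_def by (simp add: infsumI)
  qed
  thus thesis using that[OF Kq] by blast
qed

section \<open>Uniform smoothness\<close>

text \<open>
  Uniform smoothness in a form that suits estimates: it asks for vectors in the unit ball instead of
  the unit sphere, so that no normalization is needed when it is applied.
\<close>

definition lp_smooth :: "real \<Rightarrow> bool" where
  "lp_smooth p \<longleftrightarrow> (\<forall>e>0. \<exists>\<delta>>0. \<forall>t x y. 0 < t \<longrightarrow> t < \<delta> \<longrightarrow> x \<in> lp p \<longrightarrow> y \<in> lp p \<longrightarrow>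
     lp_norm p x \<le> 1 \<longrightarrow> lp_norm p y \<le> 1 \<longrightarrow>
     lp_norm p (fadd x (fscale (complex_of_real t) y)) + lp_norm p (fdiff x (fscale (complex_of_real t) y))
       \<le> 2 + 2 * e * t)"

lemma energy_Clarkson:
  assumes x: "x \<in> lp p" and y: "y \<in> lp p" and p: "1 < p" "p \<le> 2"
  shows "energy p (fadd x y) + energy p (fdiff x y) \<le> 2 * (energy p x + energy p y)"
proof -
  have s: "local_energy p z summable_on D" if "z \<in> lp p" for z using that by (simp add: lp_def)
  note s1 = s[OF lp_add(1)[OF x y p(1)]] and s2 = s[OF lp_diff(1)[OF x y p(1)]]
  have "energy p (fadd x y) + energy p (fdiff x y)
      = (\<Sum>\<^sub>\<infinity>c \<in> D. local_energy p (fadd x y) c + local_energy p (fdiff x y) c)"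
    unfolding energy_def by (rule infsum_add[OF s1 s2, symmetric])
  also have "\<dots> \<le> (\<Sum>\<^sub>\<infinity>c \<in> D. 2 * (local_energy p x c + local_energy p y c))"
  proof (rule infsum_mono)
    show "(\<lambda>c. local_energy p (fadd x y) c + local_energy p (fdiff x y) c) summable_on D"
      by (rule summable_on_add[OF s1 s2])
    show "(\<lambda>c. 2 * (local_energy p x c + local_energy p y c)) summable_on D"
      by (intro summable_on_cmult_right summable_on_add s x y)
    fix c assume c: "c \<in> D"
    note xc = op_fieldsD[OF lp_op_fields[OF x] c] and yc = op_fieldsD[OF lp_op_fields[OF y] c]
    have "real (N c) * (schatten_energy p (x c + y c) + schatten_energy p (x c - y c))
       \<le> real (N c) * (2 * (schatten_energy p (x c) + schatten_energy p (y c)))"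
      using p by (intro mult_left_mono schatten_energy_Clarkson[OF xc yc]) auto
    thus "local_energy p (fadd x y) c + local_energy p (fdiff x y) c \<le> 2 * (local_energy p x c + local_energy p y c)"
      using fdiff_app[OF lp_op_fields[OF x] lp_op_fields[OF y] c] c
      by (simp add: local_energy_def fadd_app ring_distribs)
  qed
  also have "\<dots> = 2 * (energy p x + energy p y)"
    unfolding energy_def infsum_cmult_right' by (simp add: infsum_add[OF s[OF x] s[OF y]])
  finally show ?thesis .
qed

text \<open>
  By Clarkson's inequality \<open>\<parallel>x + t y\<parallel>\<^sup>p + \<parallel>x - t y\<parallel>\<^sup>p \<le> 2 (1 + t\<^sup>p)\<close>, and \<open>t\<^sup>p\<close> is small compared
  with \<open>t\<close> because \<open>p > 1\<close>.
\<close>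

lemma lp_smooth_le_2:
  assumes p: "1 < p" "p \<le> 2"
  shows "lp_smooth p"
  unfolding lp_smooth_def
proof (intro allI impI)
  fix e :: real assume e: "e > 0"
  \<comment> \<open>Chosen so that \<open>t powr (p - 1) \<le> e\<close> for \<open>t \<le> \<delta>\<close>.\<close>
  define \<delta> where "\<delta> = e powr (1 / (p - 1))"
  show "\<exists>\<delta>>0. \<forall>t x y. 0 < t \<longrightarrow> t < \<delta> \<longrightarrow> x \<in> lp p \<longrightarrow> y \<in> lp p \<longrightarrow>
     lp_norm p x \<le> 1 \<longrightarrow> lp_norm p y \<le> 1 \<longrightarrow>
     lp_norm p (fadd x (fscale (complex_of_real t) y)) + lp_norm p (fdiff x (fscale (complex_of_real t) y))
       \<le> 2 + 2 * e * t"
  proof (intro exI[of _ \<delta>] conjI allI impI)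
    show "\<delta> > 0" using e by (simp add: \<delta>_def)
    fix t x y assume t: "0 < t" "t < \<delta>" and x: "x \<in> lp p" and y: "y \<in> lp p"
      and n: "lp_norm p x \<le> 1" "lp_norm p y \<le> 1"
    let ?y = "fscale (complex_of_real t) y"
    have p0: "0 < p" using p by simp
    note ty = lp_scale[OF y p0, of "complex_of_real t"]
    have ex: "energy p x \<le> 1" "energy p y \<le> 1"
      unfolding energy_lp_norm[OF p0] using n p0 by (auto intro: powr_le_one_le powr_le1)
    have "lp_norm p (fadd x ?y) powr p + lp_norm p (fdiff x ?y) powr p
        = energy p (fadd x ?y) + energy p (fdiff x ?y)"
      using p0 by (simp add: energy_lp_norm)
    also have "\<dots> \<le> 2 * (energy p x + energy p ?y)" by (rule energy_Clarkson[OF x ty(1) p])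
    also have "\<dots> \<le> 2 * (1 + t powr p)"
      unfolding ty(2) using ex t by (intro mult_left_mono add_mono) (auto intro: mult_left_le)
    finally have "lp_norm p (fadd x ?y) + lp_norm p (fdiff x ?y) \<le> 2 + 2 * t powr p"
      using p by (intro sum_le_of_powr_sum_le[of _ _ p]) auto
    also have "t powr p \<le> e * t"
    proof -
      have "t powr p = t powr (p - 1) * t powr 1" unfolding powr_add[symmetric] by simp
      also have "\<dots> \<le> \<delta> powr (p - 1) * t powr 1"
        using t p by (intro mult_right_mono powr_mono2) auto
      also have "\<dots> = e * t" using p e t by (simp add: \<delta>_def powr_powr)
      finally show ?thesis .
    qed
    finally show "lp_norm p (fadd x ?y) + lp_norm p (fdiff x ?y) \<le> 2 + 2 * e * t" by simp
  qed
qed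

definition fgram :: "('i \<Rightarrow> complex mat) \<Rightarrow> 'i \<Rightarrow> complex mat" where
  "fgram H = (\<lambda>c \<in> D. mat_adjoint (H c) * H c)"

text \<open>
  The singular values of \<open>H\<^sup>* H\<close> are the squares of those of \<open>H\<close>.
\<close>

lemma fgram_lp:
  assumes H: "H \<in> lp (2 * s)" and s: "0 < s"
  shows "fgram H \<in> lp s" "lp_norm s (fgram H) = (lp_norm (2 * s) H)\<^sup>2"
proof -
  have Hf: "H \<in> op_fields" and sm: "local_energy (2 * s) H summable_on D" using H by (auto simp: lp_def)
  have e: "\<And>c. c \<in> D \<Longrightarrow> local_energy s (fgram H) c = local_energy (2 * s) H c"
    using schatten_energy_gram[OF op_fieldsD[OF Hf] s] by (simp add: local_energy_def fgram_def)
  have "fgram H \<in> op_fields"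
    unfolding fgram_def using op_fieldsD[OF Hf]
    by (intro op_fieldsI mult_carrier_mat mat_adjoint_carrier)
  thus "fgram H \<in> lp s" using e sm by (simp add: lp_def cong: summable_on_cong)
  have "energy s (fgram H) = energy (2 * s) H" unfolding energy_def using e by (rule infsum_cong)
  hence "lp_norm s (fgram H) = energy (2 * s) H powr (1 / (2 * s) + 1 / (2 * s))"
    using s by (simp add: lp_norm_def field_simps)
  thus "lp_norm s (fgram H) = (lp_norm (2 * s) H)\<^sup>2"
    by (simp only: powr_add lp_norm_def power2_eq_square)
qed

lemma fscale_fscale:
  "H \<in> op_fields \<Longrightarrow> fscale a (fscale b H) = fscale (a * b) H"
  unfolding fscale_def by (auto simp: smult_smult_mat restrict_def fun_eq_iff)

lemma fdiff_scale:
  "K \<in> op_fields \<Longrightarrow> fdiff H (fscale (complex_of_real t) K) = fadd H (fscale (complex_of_real (- t)) K)"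
  unfolding fdiff_def by (simp add: fscale_fscale)

lemma fgram_line:
  assumes x: "x \<in> op_fields" and y: "y \<in> op_fields"
  defines "R \<equiv> fscale (complex_of_real (1 / 2)) (fdiff (fgram (fadd x y)) (fgram (fdiff x y)))"
  shows "fgram (fadd x (fscale (complex_of_real t) y))
    = fadd (fadd (fgram x) (fscale (complex_of_real t) R)) (fscale (complex_of_real (t\<^sup>2)) (fgram y))"
proof -
  have g: "fgram H \<in> op_fields" if "H \<in> op_fields" for H
    unfolding fgram_def using op_fieldsD[OF that] by (intro op_fieldsI mult_carrier_mat mat_adjoint_carrier)
  show ?thesis
  proof (rule op_fields_eqI)
    fix c assume c: "c \<in> D"
    have d: "fdiff x y c = x c - y c" "fdiff (fgram (fadd x y)) (fgram (fdiff x y)) c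
        = fgram (fadd x y) c - fgram (fdiff x y) c"
      using g x y c by (auto intro!: fdiff_app)
    have fg: "fgram H c = mat_adjoint (H c) * H c" for H using c by (simp add: fgram_def)
    show "fgram (fadd x (fscale (complex_of_real t) y)) c
      = fadd (fadd (fgram x) (fscale (complex_of_real t) R)) (fscale (complex_of_real (t\<^sup>2)) (fgram y)) c"
      using gram_of_line[OF op_fieldsD[OF x c] op_fieldsD[OF y c], of t] c
      by (simp add: R_def fadd_app fscale_app d fg del: of_real_power of_real_divide)
  qed (use g x y in \<open>auto simp: R_def\<close>)
qed

text \<open>
  The gram map turns norms at \<open>2s\<close> into squared norms at \<open>s\<close>, and
  \<open>(x \<plusminus> t y)\<^sup>* (x \<plusminus> t y) = (x\<^sup>* x \<plusminus> t R) + t\<^sup>2 y\<^sup>* y\<close>, where polarization gives \<open>\<parallel>R\<parallel> \<le> 4\<close> on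
  the unit ball. Smoothness at \<open>s\<close> in the direction \<open>R\<close> controls the sum of the squares of
  \<open>\<parallel>x + t y\<parallel>\<close> and \<open>\<parallel>x - t y\<parallel>\<close> up to the quadratic error.
\<close>

lemma lp_smooth_double:
  assumes s: "1 < s" and sm: "lp_smooth s"
  shows "lp_smooth (2 * s)"
  unfolding lp_smooth_def
proof (intro allI impI)
  let ?p = "2 * s"
  have s0: "0 < s" and p: "1 < ?p" "0 < ?p" using s by auto
  fix e :: real assume e: "e > 0"
  hence "e / 4 > 0" by simp
  then obtain \<delta> where \<delta>: "\<delta> > 0" and sms: "\<And>t x y. 0 < t \<Longrightarrow> t < \<delta> \<Longrightarrow> x \<in> lp s \<Longrightarrow> y \<in> lp s \<Longrightarrow>
     lp_norm s x \<le> 1 \<Longrightarrow> lp_norm s y \<le> 1 \<Longrightarrow>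
     lp_norm s (fadd x (fscale (complex_of_real t) y)) + lp_norm s (fdiff x (fscale (complex_of_real t) y))
       \<le> 2 + 2 * (e / 4) * t"
    using sm unfolding lp_smooth_def by blast
  show "\<exists>\<delta>>0. \<forall>t x y. 0 < t \<longrightarrow> t < \<delta> \<longrightarrow> x \<in> lp ?p \<longrightarrow> y \<in> lp ?p \<longrightarrow>
     lp_norm ?p x \<le> 1 \<longrightarrow> lp_norm ?p y \<le> 1 \<longrightarrow>
     lp_norm ?p (fadd x (fscale (complex_of_real t) y)) + lp_norm ?p (fdiff x (fscale (complex_of_real t) y))
       \<le> 2 + 2 * e * t"
  proof (intro exI[of _ "min (\<delta> / 4) e"] conjI allI impI)
    show "min (\<delta> / 4) e > 0" using e \<delta> by simp
    fix t x y assume t: "0 < t" "t < min (\<delta> / 4) e" and x: "x \<in> lp ?p" and y: "y \<in> lp ?p"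
      and n: "lp_norm ?p x \<le> 1" "lp_norm ?p y \<le> 1"
    note xf = lp_op_fields[OF x] and yf = lp_op_fields[OF y]
    define R where "R = fscale (complex_of_real (1 / 2)) (fdiff (fgram (fadd x y)) (fgram (fdiff x y)))"
    note gx = fgram_lp[OF x s0] and gy = fgram_lp[OF y s0]
    note gp = fgram_lp[OF lp_add(1)[OF x y p(1)] s0] and gm = fgram_lp[OF lp_diff(1)[OF x y p(1)] s0]
    have R: "R \<in> lp s" unfolding R_def by (intro lp_scale(1) lp_diff(1) gp(1) gm(1) s s0)
    have le2: "lp_norm ?p (fadd x y) \<le> 2" "lp_norm ?p (fdiff x y) \<le> 2"
      using lp_add(2)[OF x y p(1)] lp_diff(2)[OF x y p(1)] n by linarith+
    have "lp_norm s (fgram (fadd x y)) \<le> 2\<^sup>2" "lp_norm s (fgram (fdiff x y)) \<le> 2\<^sup>2"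
      unfolding gp(2) gm(2) by (rule power_mono[OF le2(1) lp_norm_nonneg], rule power_mono[OF le2(2) lp_norm_nonneg])
    hence "lp_norm s (fdiff (fgram (fadd x y)) (fgram (fdiff x y))) \<le> 8"
      using lp_diff(2)[OF gp(1) gm(1) s] by simp
    hence Rn: "lp_norm s R \<le> 4"
      unfolding R_def using lp_scale(3)[OF lp_diff(1)[OF gp(1) gm(1) s] s0, of "complex_of_real (1 / 2)"] by simp
    \<comment> \<open>Smoothness at \<open>s\<close> is applied in the direction \<open>R / 4\<close> of the unit ball with parameter \<open>4 * t\<close>.\<close>
    let ?R4 = "fscale (complex_of_real (1 / 4)) R"
    have R4: "?R4 \<in> lp s" "lp_norm s ?R4 \<le> 1"
      using lp_scale(1,3)[OF R s0, of "complex_of_real (1 / 4)"] Rn by auto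
    have R4t: "fscale (complex_of_real (4 * t)) ?R4 = fscale (complex_of_real t) R"
      using fscale_fscale[OF lp_op_fields[OF R]] by simp
    have x1: "lp_norm s (fgram x) \<le> 1" and y1: "lp_norm s (fgram y) \<le> 1"
      unfolding gx(2) gy(2) using n by (auto intro: power_le_one)
    have base: "lp_norm s (fadd (fgram x) (fscale (complex_of_real t) R))
        + lp_norm s (fdiff (fgram x) (fscale (complex_of_real t) R)) \<le> 2 + 2 * e * t"
      using sms[of "4 * t" "fgram x" ?R4] t gx(1) x1 R4 unfolding R4t by simp
    have upper: "(lp_norm ?p (fadd x (fscale (complex_of_real r) y)))\<^sup>2
        \<le> lp_norm s (fadd (fgram x) (fscale (complex_of_real r) R)) + r\<^sup>2" for r
    proof -
      have c: "fadd x (fscale (complex_of_real r) y) \<in> lp ?p" by (intro lp_add lp_scale x y p)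
      have "(lp_norm ?p (fadd x (fscale (complex_of_real r) y)))\<^sup>2
          = lp_norm s (fadd (fadd (fgram x) (fscale (complex_of_real r) R)) (fscale (complex_of_real (r\<^sup>2)) (fgram y)))"
        using fgram_lp(2)[OF c s0] fgram_line[OF xf yf, of r] by (simp add: R_def)
      also have "\<dots> \<le> lp_norm s (fadd (fgram x) (fscale (complex_of_real r) R))
          + lp_norm s (fscale (complex_of_real (r\<^sup>2)) (fgram y))"
        by (intro lp_add(2) lp_add(1) lp_scale(1) gx(1) gy(1) R s s0)
      also have "lp_norm s (fscale (complex_of_real (r\<^sup>2)) (fgram y)) \<le> r\<^sup>2"
        unfolding lp_scale(3)[OF gy(1) s0] using y1 by (simp add: norm_power mult_left_le del: of_real_power)
      finally show ?thesis by simp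
    qed
    have "(lp_norm ?p (fadd x (fscale (complex_of_real t) y)))\<^sup>2 + (lp_norm ?p (fdiff x (fscale (complex_of_real t) y)))\<^sup>2
        \<le> (lp_norm s (fadd (fgram x) (fscale (complex_of_real t) R)) + t\<^sup>2)
          + (lp_norm s (fdiff (fgram x) (fscale (complex_of_real t) R)) + (- t)\<^sup>2)"
      unfolding fdiff_scale[OF yf] fdiff_scale[OF lp_op_fields[OF R]]
      by (rule add_mono[OF upper upper])
    also have "\<dots> = (lp_norm s (fadd (fgram x) (fscale (complex_of_real t) R))
        + lp_norm s (fdiff (fgram x) (fscale (complex_of_real t) R))) + 2 * t\<^sup>2"
      by (simp only: power2_minus mult_2 add_ac)
    also have "\<dots> \<le> (2 + 2 * e * t) + 2 * t\<^sup>2" by (rule add_right_mono[OF base])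
    also have "\<dots> = 2 + 2 * (e * t + t\<^sup>2)" by (simp only: distrib_left mult.assoc add.assoc)
    finally have "(lp_norm ?p (fadd x (fscale (complex_of_real t) y)))\<^sup>2
        + (lp_norm ?p (fdiff x (fscale (complex_of_real t) y)))\<^sup>2 \<le> 2 + 2 * (e * t + t\<^sup>2)" .
    hence "lp_norm ?p (fadd x (fscale (complex_of_real t) y)) + lp_norm ?p (fdiff x (fscale (complex_of_real t) y))
        \<le> 2 + (e * t + t\<^sup>2)"
      by (rule sum_le_of_squares_sum_le[rotated])
        (rule add_nonneg_nonneg[OF mult_nonneg_nonneg[OF less_imp_le[OF e] less_imp_le[OF t(1)]] zero_le_power2])
    also have "t\<^sup>2 \<le> e * t" unfolding power2_eq_square using t by (intro mult_right_mono) auto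
    finally show "lp_norm ?p (fadd x (fscale (complex_of_real t) y)) + lp_norm ?p (fdiff x (fscale (complex_of_real t) y))
       \<le> 2 + 2 * e * t" by (simp only: mult_2 distrib_right)
  qed
qed

theorem lp_smooth:
  assumes "1 < p"
  shows "lp_smooth p"
proof -
  have "lp_smooth p" if "1 < p" "p \<le> 2 ^ Suc k" for k p
    using that
  proof (induction k arbitrary: p)
    case 0
    thus ?case using lp_smooth_le_2 by simp
  next
    case (Suc k)
    show ?case
    proof (cases "p \<le> 2")
      case False
      hence "lp_smooth (2 * (p / 2))" using Suc.prems by (intro lp_smooth_double Suc.IH) auto
      thus ?thesis by simp
    qed (use Suc.prems lp_smooth_le_2 in auto)
  qed
  moreover obtain k where "p < 2 ^ k" using real_arch_pow[of 2 p] by auto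
  hence "p \<le> 2 ^ Suc k" by simp (use assms in linarith)
  ultimately show ?thesis using assms by blast
qed

section \<open>Uniform convexity by duality\<close>

text \<open>
  Let \<open>f\<close> norm \<open>x + y\<close> and \<open>g\<close> norm \<open>x - y\<close>. Then \<open>\<parallel>x + y\<parallel> + t \<parallel>x - y\<parallel>\<close> is the sum of the pairings
  of \<open>x\<close> with \<open>f + t g\<close> and of \<open>y\<close> with \<open>f - t g\<close>, hence at most \<open>\<parallel>f + t g\<parallel> + \<parallel>f - t g\<parallel>\<close>, which
  smoothness at \<open>q\<close> bounds by \<open>2 + t \<epsilon> / 2\<close>. As \<open>\<parallel>x - y\<parallel> \<ge> \<epsilon>\<close>, half of the gain \<open>t \<epsilon>\<close> remains.
\<close>

lemma lp_midpoint_bound: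
  assumes pq: "conjugate_exponents p q" and \<epsilon>: "0 < \<epsilon>"
  obtains \<eta> where "0 < \<eta>"
    "\<And>x y. x \<in> lp p \<Longrightarrow> y \<in> lp p \<Longrightarrow> lp_norm p x \<le> 1 \<Longrightarrow> lp_norm p y \<le> 1 \<Longrightarrow> \<epsilon> \<le> lp_norm p (fdiff x y) \<Longrightarrow>
      \<eta> \<le> 1 - lp_norm p (fadd x y) / 2"
proof -
  note pqD = conjugate_exponentsD[OF pq] and qp = conjugate_exponents_sym[OF pq]
  have "\<epsilon> / 4 > 0" using \<epsilon> by simp
  then obtain \<delta> where \<delta>: "\<delta> > 0" and sm: "\<And>t f g. 0 < t \<Longrightarrow> t < \<delta> \<Longrightarrow> f \<in> lp q \<Longrightarrow> g \<in> lp q \<Longrightarrow>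
     lp_norm q f \<le> 1 \<Longrightarrow> lp_norm q g \<le> 1 \<Longrightarrow>
     lp_norm q (fadd f (fscale (complex_of_real t) g)) + lp_norm q (fdiff f (fscale (complex_of_real t) g))
       \<le> 2 + 2 * (\<epsilon> / 4) * t"
    using lp_smooth[OF pqD(2)] unfolding lp_smooth_def by blast
  define t where "t = \<delta> / 2"
  have t: "0 < t" "t < \<delta>" using \<delta> by (auto simp: t_def)
  show thesis
  proof (rule that)
    show "0 < t * \<epsilon> / 4" using t \<epsilon> by simp
    fix x y assume x: "x \<in> lp p" and y: "y \<in> lp p" and n: "lp_norm p x \<le> 1" "lp_norm p y \<le> 1"
      and xy: "\<epsilon> \<le> lp_norm p (fdiff x y)"
    note a = lp_add(1)[OF x y pqD(1)] and d = lp_diff(1)[OF x y pqD(1)]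
    obtain f where f: "f \<in> lp q" "lp_norm q f \<le> 1" "pairing (fadd x y) f = complex_of_real (lp_norm p (fadd x y))"
      using norming_functional[OF a pq] by blast
    obtain g where g: "g \<in> lp q" "lp_norm q g \<le> 1" "pairing (fdiff x y) g = complex_of_real (lp_norm p (fdiff x y))"
      using norming_functional[OF d pq] by blast
    let ?g = "fscale (complex_of_real t) g"
    have tg: "?g \<in> lp q" by (rule lp_scale(1)[OF g(1) pqD(5)])
    have right: "pairing z (fadd f ?g) = pairing z f + t * pairing z g"
      "pairing z (fdiff f ?g) = pairing z f - t * pairing z g" if z: "z \<in> lp p" for z
    proof -
      note zf = lp_op_fields[OF z] and ff = lp_op_fields[OF f(1)] and gf = lp_op_fields[OF g(1)]
      have c: "pairing z h = cnj (pairing h z)" if "h \<in> op_fields" for h using that zf by (rule pairing_cnj)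
      show "pairing z (fadd f ?g) = pairing z f + t * pairing z g"
        using ff gf pairing_add_left[OF f(1) tg z qp] pairing_scale_left[OF gf zf] by (simp add: c)
      show "pairing z (fdiff f ?g) = pairing z f - t * pairing z g"
        using ff gf pairing_diff_left[OF f(1) tg z qp] pairing_scale_left[OF gf zf] by (simp add: c)
    qed
    have "complex_of_real (lp_norm p (fadd x y) + t * lp_norm p (fdiff x y))
        = pairing x (fadd f ?g) + pairing y (fdiff f ?g)"
    proof -
      have "complex_of_real (lp_norm p (fadd x y) + t * lp_norm p (fdiff x y))
          = pairing (fadd x y) f + t * pairing (fdiff x y) g"
        unfolding f(3) g(3) by simp
      also have "\<dots> = pairing x (fadd f ?g) + pairing y (fdiff f ?g)"
        unfolding pairing_add_left[OF x y f(1) pq] pairing_diff_left[OF x y g(1) pq] right[OF x] right[OF y]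
        by (simp add: algebra_simps)
      finally show ?thesis .
    qed
    hence "lp_norm p (fadd x y) + t * lp_norm p (fdiff x y)
        = cmod (pairing x (fadd f ?g) + pairing y (fdiff f ?g))"
      using t by (metis abs_of_nonneg add_nonneg_nonneg less_imp_le lp_norm_nonneg mult_nonneg_nonneg norm_of_real)
    also have "\<dots> \<le> lp_norm p x * lp_norm q (fadd f ?g) + lp_norm p y * lp_norm q (fdiff f ?g)"
      by (intro order_trans[OF norm_triangle_ineq] add_mono Hoelder x y lp_add lp_diff f tg pq pqD)
    also have "\<dots> \<le> lp_norm q (fadd f ?g) + lp_norm q (fdiff f ?g)"
      using n by (intro add_mono mult_left_le_one_le) auto
    also have "\<dots> \<le> 2 + 2 * (\<epsilon> / 4) * t" by (rule sm[OF t f(1) g(1) f(2) g(2)])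
    finally have "lp_norm p (fadd x y) + t * lp_norm p (fdiff x y) \<le> 2 + 2 * (\<epsilon> / 4) * t" .
    moreover have "t * \<epsilon> \<le> t * lp_norm p (fdiff x y)" using t xy by (intro mult_left_mono) auto
    ultimately show "t * \<epsilon> / 4 \<le> 1 - lp_norm p (fadd x y) / 2" by (simp add: field_simps)
  qed
qed

section \<open>The normed module\<close>

definition lp_space :: "real \<Rightarrow> (complex, 'i \<Rightarrow> complex mat) normed_module" where
  "lp_space p = \<lparr>carrier = lp p, mult = undefined, one = undefined, zero = fzero,
     add = fadd, smult = fscale, mnorm = lp_norm p\<rparr>"

lemma lp_space_sel [simp]:
  "carrier (lp_space p) = lp p" "zero (lp_space p) = fzero" "add (lp_space p) = fadd"
  "smult (lp_space p) = fscale" "mnorm (lp_space p) = lp_norm p"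
  by (simp_all add: lp_space_def)

lemma fscale_minus_inverse: "H \<in> op_fields \<Longrightarrow> fadd (fscale (-1) H) H = fzero"
  by (rule op_fields_eqI) (auto simp: fadd_app fscale_app fzero_app dest!: op_fieldsD intro!: eq_matI)

lemma abelian_group_lp:
  assumes p: "1 < p"
  shows "abelian_group (lp_space p)"
proof (rule abelian_groupI)
  fix x y z assume x: "x \<in> carrier (lp_space p)" and y: "y \<in> carrier (lp_space p)" and z: "z \<in> carrier (lp_space p)"
  note xyz = lp_op_fields[of x p] lp_op_fields[of y p] lp_op_fields[of z p]
  show "x \<oplus>\<^bsub>lp_space p\<^esub> y \<in> carrier (lp_space p)" using x y lp_add(1)[OF _ _ p] by simp
  show "x \<oplus>\<^bsub>lp_space p\<^esub> y \<oplus>\<^bsub>lp_space p\<^esub> z = x \<oplus>\<^bsub>lp_space p\<^esub> (y \<oplus>\<^bsub>lp_space p\<^esub> z)"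
    using x y z xyz
    by (simp, intro op_fields_eqI)
      (auto simp: fadd_app intro!: assoc_add_mat op_fieldsD)
next
  fix x y assume x: "x \<in> carrier (lp_space p)" and y: "y \<in> carrier (lp_space p)"
  show "x \<oplus>\<^bsub>lp_space p\<^esub> y = y \<oplus>\<^bsub>lp_space p\<^esub> x"
    using x y lp_op_fields[of x p] lp_op_fields[of y p]
    by (simp, intro op_fields_eqI) (auto simp: fadd_app intro!: comm_add_mat op_fieldsD)
next
  show "\<zero>\<^bsub>lp_space p\<^esub> \<in> carrier (lp_space p)" using lp_zero(1)[of p] p by simp
next
  fix x assume x: "x \<in> carrier (lp_space p)"
  show "\<zero>\<^bsub>lp_space p\<^esub> \<oplus>\<^bsub>lp_space p\<^esub> x = x"
    using x lp_op_fields[of x p]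
    by (simp, intro op_fields_eqI) (auto simp: fadd_app fzero_app intro!: left_add_zero_mat op_fieldsD)
  show "\<exists>y\<in>carrier (lp_space p). y \<oplus>\<^bsub>lp_space p\<^esub> x = \<zero>\<^bsub>lp_space p\<^esub>"
    using x p lp_scale(1)[of x p "-1"] fscale_minus_inverse[OF lp_op_fields[of x p]]
    by (intro bexI[of _ "fscale (-1) x"]) auto
qed

lemma lp_space_minus:
  assumes "1 < p" "x \<in> lp p" "y \<in> lp p"
  shows "x \<ominus>\<^bsub>lp_space p\<^esub> y = fdiff x y"
proof -
  interpret abelian_group "lp_space p" by (rule abelian_group_lp[OF assms(1)])
  have "\<ominus>\<^bsub>lp_space p\<^esub> y = fscale (-1) y"
    by (rule minus_equality)
      (use assms lp_scale(1)[of y p "-1"] fscale_minus_inverse[OF lp_op_fields[of y p]] in auto)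
  thus ?thesis by (simp add: a_minus_def fdiff_def)
qed

lemma vectorspace_lp:
  assumes p: "1 < p"
  shows "vectorspace class_ring (lp_space p)"
proof -
  have p0: "0 < p" using p by simp
  have f: "x \<in> op_fields" if "x \<in> lp p" for x using that by (rule lp_op_fields)
  have "module class_ring (lp_space p)"
  proof (rule moduleI[OF _ abelian_group_lp[OF p]])
    show "cring (class_ring :: complex ring)" using class_field[where 'a = complex] field.is_ring
      by (metis domain_def fieldE(1) field_def class_field)
    fix a b :: complex and x y
    assume x: "x \<in> carrier (lp_space p)"
    hence xf: "x \<in> op_fields" using f by simp
    show "a \<odot>\<^bsub>lp_space p\<^esub> x \<in> carrier (lp_space p)" using x lp_scale(1)[OF _ p0] by simp
    show "(a \<oplus>\<^bsub>class_ring\<^esub> b) \<odot>\<^bsub>lp_space p\<^esub> x = a \<odot>\<^bsub>lp_space p\<^esub> x \<oplus>\<^bsub>lp_space p\<^esub> b \<odot>\<^bsub>lp_space p\<^esub> x"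
      using xf by (simp add: class_ring_simps, intro op_fields_eqI)
        (auto simp: fadd_app fscale_app intro!: add_smult_distrib_right_mat op_fieldsD)
    show "(a \<otimes>\<^bsub>class_ring\<^esub> b) \<odot>\<^bsub>lp_space p\<^esub> x = a \<odot>\<^bsub>lp_space p\<^esub> (b \<odot>\<^bsub>lp_space p\<^esub> x)"
      using fscale_fscale[OF xf] by (simp add: class_ring_simps)
    show "\<one>\<^bsub>class_ring\<^esub> \<odot>\<^bsub>lp_space p\<^esub> x = x"
      using xf by (simp add: class_ring_simps, intro op_fields_eqI) (auto simp: fscale_app intro!: eq_matI)
    assume y: "y \<in> carrier (lp_space p)"
    hence yf: "y \<in> op_fields" using f by simp
    show "a \<odot>\<^bsub>lp_space p\<^esub> (x \<oplus>\<^bsub>lp_space p\<^esub> y) = a \<odot>\<^bsub>lp_space p\<^esub> x \<oplus>\<^bsub>lp_space p\<^esub> a \<odot>\<^bsub>lp_space p\<^esub> y"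
      using xf yf by (simp, intro op_fields_eqI)
        (auto simp: fadd_app fscale_app intro!: add_smult_distrib_left_mat op_fieldsD)
  qed
  thus ?thesis by (simp add: vectorspace_def class_field)
qed

theorem complex_banach_space_lp:
  assumes p: "1 < p"
  shows "complex_banach_space (lp_space p)"
proof -
  interpret vectorspace class_ring "lp_space p" by (rule vectorspace_lp[OF p])
  have p0: "0 < p" using p by simp
  show ?thesis
  proof unfold_locales
    fix x y and a :: complex
    assume x: "x \<in> carrier (lp_space p)"
    show "(\<parallel>x\<parallel>\<^bsub>lp_space p\<^esub> = 0) = (x = \<zero>\<^bsub>lp_space p\<^esub>)"
      using x lp_norm_eq_0D[OF _ p0] lp_zero(3)[OF p0] by auto
    show "\<parallel>a \<odot>\<^bsub>lp_space p\<^esub> x\<parallel>\<^bsub>lp_space p\<^esub> = cmod a * \<parallel>x\<parallel>\<^bsub>lp_space p\<^esub>"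
      using x lp_scale(3)[OF _ p0] by simp
    assume "y \<in> carrier (lp_space p)"
    thus "\<parallel>x \<oplus>\<^bsub>lp_space p\<^esub> y\<parallel>\<^bsub>lp_space p\<^esub> \<le> \<parallel>x\<parallel>\<^bsub>lp_space p\<^esub> + \<parallel>y\<parallel>\<^bsub>lp_space p\<^esub>"
      using x lp_add(2)[OF _ _ p] by simp
  next
    fix s :: "nat \<Rightarrow> _"
    assume s: "\<And>n. s n \<in> carrier (lp_space p)"
      and C: "\<And>e. e > 0 \<Longrightarrow> \<exists>M. \<forall>m\<ge>M. \<forall>n\<ge>M. \<parallel>s m \<ominus>\<^bsub>lp_space p\<^esub> s n\<parallel>\<^bsub>lp_space p\<^esub> < e"
    have s': "s n \<in> lp p" for n using s by simp
    have "\<exists>L\<in>lp p. (\<lambda>m. lp_norm p (fdiff (s m) L)) \<longlonglongrightarrow> 0"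
      using C by (intro lp_complete[OF p s']) (simp add: lp_space_minus[OF p s' s'])
    thus "\<exists>x\<in>carrier (lp_space p). (\<lambda>n. \<parallel>s n \<ominus>\<^bsub>lp_space p\<^esub> x\<parallel>\<^bsub>lp_space p\<^esub>) \<longlonglongrightarrow> 0"
      using lp_space_minus[OF p s'] by auto
  qed
qed

text \<open>
  This excludes the zero space, for which the infimum and the supremum in the two moduli would range
  over empty sets.
\<close>

lemma unit_vector_exists:
  assumes p: "0 < p"
  obtains u where "u \<in> lp p" "lp_norm p u = 1"
proof -
  obtain c where c: "c \<in> D" using nonempty by blast
  let ?u = "fsingle c (1\<^sub>m (N c))"
  have u: "?u \<in> lp p" by (rule fsingle_lp[OF c _ p]) simp
  have "?u c $$ (0, 0) \<noteq> fzero c $$ (0, 0)" using c dim_pos[OF c] by (simp add: fsingle_def fzero_def)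
  hence "lp_norm p ?u \<noteq> 0" using lp_norm_eq_0D[OF u p] by auto
  thus thesis
    using that[of "fscale (complex_of_real (1 / lp_norm p ?u)) ?u"] lp_scale[OF u p, of "complex_of_real (1 / lp_norm p ?u)"]
      lp_norm_nonneg[of p ?u] by (simp add: norm_divide)
qed

theorem uniformly_convex_lp:
  assumes p: "1 < p"
  shows "uniformly_convex (lp_space p)"
  unfolding uniformly_convex_def
proof (intro allI impI)
  have p0: "0 < p" using p by simp
  fix \<epsilon> :: real assume \<epsilon>: "0 < \<epsilon> \<and> \<epsilon> \<le> 2"
  obtain \<eta> where \<eta>: "0 < \<eta>"
    "\<And>x y. x \<in> lp p \<Longrightarrow> y \<in> lp p \<Longrightarrow> lp_norm p x \<le> 1 \<Longrightarrow> lp_norm p y \<le> 1 \<Longrightarrow> \<epsilon> \<le> lp_norm p (fdiff x y) \<Longrightarrow>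
      \<eta> \<le> 1 - lp_norm p (fadd x y) / 2"
    using lp_midpoint_bound[OF conjugate_exponents_exists[OF p]] \<epsilon> by blast
  obtain u where u: "u \<in> lp p" "lp_norm p u = 1" using unit_vector_exists[OF p0] .
  \<comment> \<open>A complex number of modulus one at distance \<open>\<epsilon>\<close> from \<open>1\<close>: then \<open>u\<close> and \<open>w u\<close> have distance \<open>\<epsilon>\<close>.\<close>
  define w where "w = Complex (1 - \<epsilon>\<^sup>2 / 2) (sqrt (1 - (1 - \<epsilon>\<^sup>2 / 2)\<^sup>2))"
  have "\<epsilon>\<^sup>2 \<le> 2\<^sup>2" using \<epsilon> by (intro power_mono) auto
  hence "\<bar>1 - \<epsilon>\<^sup>2 / 2\<bar> \<le> 1" by (simp add: abs_le_iff)
  hence sq: "(1 - \<epsilon>\<^sup>2 / 2)\<^sup>2 \<le> 1" by (simp add: abs_square_le_1)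
  have w1: "cmod w = 1" using sq by (simp add: w_def cmod_def)
  have "(cmod (1 - w))\<^sup>2 = \<epsilon>\<^sup>2"
    using sq by (simp add: w_def cmod_power2) (simp add: power2_eq_square algebra_simps)
  hence w2: "cmod (1 - w) = \<epsilon>" using \<epsilon> by (simp add: power2_eq_iff_nonneg)
  have wu: "fscale w u \<in> lp p" "lp_norm p (fscale w u) = 1"
    using lp_scale[OF u(1) p0, of w] u(2) w1 by auto
  have "fdiff u (fscale w u) = fscale (1 - w) u"
  proof (rule op_fields_eqI)
    fix c assume c: "c \<in> D"
    show "fdiff u (fscale w u) c = fscale (1 - w) u c"
      unfolding fdiff_app[OF lp_op_fields[OF u(1)] lp_op_fields[OF wu(1)] c]
      using op_fieldsD[OF lp_op_fields[OF u(1)] c] c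
      by (auto simp: fscale_app algebra_simps intro!: eq_matI)
  qed (use lp_op_fields[OF u(1)] in auto)
  hence dist: "lp_norm p (fdiff u (fscale w u)) = \<epsilon>"
    using lp_scale(3)[OF u(1) p0] u(2) w2 by simp
  have "\<eta> \<le> modulus_of_convexity (lp_space p) \<epsilon>"
    unfolding modulus_of_convexity_def
  proof (rule cInf_greatest)
    show "{1 - \<parallel>complex_of_real (1 / 2) \<odot>\<^bsub>lp_space p\<^esub> (x \<oplus>\<^bsub>lp_space p\<^esub> y)\<parallel>\<^bsub>lp_space p\<^esub> |x y.
      x \<in> carrier (lp_space p) \<and> y \<in> carrier (lp_space p) \<and> \<parallel>x\<parallel>\<^bsub>lp_space p\<^esub> = 1 \<and> \<parallel>y\<parallel>\<^bsub>lp_space p\<^esub> = 1 \<and>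
      \<parallel>x \<ominus>\<^bsub>lp_space p\<^esub> y\<parallel>\<^bsub>lp_space p\<^esub> = \<epsilon>} \<noteq> {}"
      unfolding ex_in_conv[symmetric]
      by (rule exI, rule CollectI, rule exI[of _ u], rule exI[of _ "fscale w u"], rule conjI[OF refl])
        (use u wu dist lp_space_minus[OF p u(1) wu(1)] in simp)
  next
    fix r assume "r \<in> {1 - \<parallel>complex_of_real (1 / 2) \<odot>\<^bsub>lp_space p\<^esub> (x \<oplus>\<^bsub>lp_space p\<^esub> y)\<parallel>\<^bsub>lp_space p\<^esub> |x y.
      x \<in> carrier (lp_space p) \<and> y \<in> carrier (lp_space p) \<and> \<parallel>x\<parallel>\<^bsub>lp_space p\<^esub> = 1 \<and> \<parallel>y\<parallel>\<^bsub>lp_space p\<^esub> = 1 \<and>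
      \<parallel>x \<ominus>\<^bsub>lp_space p\<^esub> y\<parallel>\<^bsub>lp_space p\<^esub> = \<epsilon>}"
    then obtain x y where xy: "x \<in> lp p" "y \<in> lp p" "lp_norm p x = 1" "lp_norm p y = 1"
      "lp_norm p (x \<ominus>\<^bsub>lp_space p\<^esub> y) = \<epsilon>" "r = 1 - lp_norm p (fscale (complex_of_real (1 / 2)) (fadd x y))"
      by auto
    have "r = 1 - lp_norm p (fadd x y) / 2"
      unfolding xy(6) lp_scale(3)[OF lp_add(1)[OF xy(1,2) p] p0] by simp
    thus "\<eta> \<le> r" using \<eta>(2)[OF xy(1,2)] xy(3-5) by (simp add: lp_space_minus[OF p xy(1,2)])
  qed
  thus "0 < modulus_of_convexity (lp_space p) \<epsilon>" using \<eta>(1) by linarith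
qed

text \<open>
  The elements of the set in the modulus of smoothness lie between \<open>0\<close>, by the triangle inequality
  for \<open>2 x = (x + t y) + (x - t y)\<close>, and \<open>e / 2 * t\<close>, by \<open>lp_smooth\<close>.
\<close>

theorem uniformly_smooth_lp:
  assumes p: "1 < p"
  shows "uniformly_smooth (lp_space p)"
  unfolding uniformly_smooth_def
proof (rule tendstoI)
  have p0: "0 < p" using p by simp
  fix e :: real assume e: "e > 0"
  hence "e / 2 > 0" by simp
  then obtain \<delta> where \<delta>: "\<delta> > 0" and sm: "\<And>t x y. 0 < t \<Longrightarrow> t < \<delta> \<Longrightarrow> x \<in> lp p \<Longrightarrow> y \<in> lp p \<Longrightarrow>
     lp_norm p x \<le> 1 \<Longrightarrow> lp_norm p y \<le> 1 \<Longrightarrow>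
     lp_norm p (fadd x (fscale (complex_of_real t) y)) + lp_norm p (fdiff x (fscale (complex_of_real t) y))
       \<le> 2 + 2 * (e / 2) * t"
    using lp_smooth[OF p] unfolding lp_smooth_def by blast
  have "dist (modulus_of_smoothness (lp_space p) t / t) 0 < e" if t: "0 < t" "t < \<delta>" for t
  proof -
    define S where "S = {(\<parallel>x \<oplus>\<^bsub>lp_space p\<^esub> complex_of_real t \<odot>\<^bsub>lp_space p\<^esub> y\<parallel>\<^bsub>lp_space p\<^esub>
           + \<parallel>x \<ominus>\<^bsub>lp_space p\<^esub> complex_of_real t \<odot>\<^bsub>lp_space p\<^esub> y\<parallel>\<^bsub>lp_space p\<^esub>) / 2 - 1 | x y.
            x \<in> carrier (lp_space p) \<and> y \<in> carrier (lp_space p) \<and> \<parallel>x\<parallel>\<^bsub>lp_space p\<^esub> = 1 \<and> \<parallel>y\<parallel>\<^bsub>lp_space p\<^esub> = 1}"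
    have half: "0 \<le> a / 2 - 1 \<and> a / 2 - 1 \<le> e / 2 * t" if "2 \<le> a" "a \<le> 2 + 2 * (e / 2) * t" for a
      using that by (auto simp: field_simps)
    have bounds: "0 \<le> r \<and> r \<le> e / 2 * t" if "r \<in> S" for r
    proof -
      obtain x y where xy: "x \<in> lp p" "y \<in> lp p" "lp_norm p x = 1" "lp_norm p y = 1"
        and r: "r = (lp_norm p (fadd x (fscale (complex_of_real t) y))
           + lp_norm p (x \<ominus>\<^bsub>lp_space p\<^esub> fscale (complex_of_real t) y)) / 2 - 1"
      proof -
        obtain x y where "x \<in> carrier (lp_space p)" "y \<in> carrier (lp_space p)"
          "\<parallel>x\<parallel>\<^bsub>lp_space p\<^esub> = 1" "\<parallel>y\<parallel>\<^bsub>lp_space p\<^esub> = 1"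
          "r = (\<parallel>x \<oplus>\<^bsub>lp_space p\<^esub> complex_of_real t \<odot>\<^bsub>lp_space p\<^esub> y\<parallel>\<^bsub>lp_space p\<^esub>
             + \<parallel>x \<ominus>\<^bsub>lp_space p\<^esub> complex_of_real t \<odot>\<^bsub>lp_space p\<^esub> y\<parallel>\<^bsub>lp_space p\<^esub>) / 2 - 1"
          using \<open>r \<in> S\<close> unfolding S_def by blast
        thus thesis by (intro that[of x y]) simp_all
      qed
      let ?y = "fscale (complex_of_real t) y"
      note ty = lp_scale(1)[OF xy(2) p0, of "complex_of_real t"]
      note r' = r[unfolded lp_space_minus[OF p xy(1) ty]]
      have "fadd (fadd x ?y) (fdiff x ?y) = fscale 2 x"
      proof (rule op_fields_eqI)
        fix c assume c: "c \<in> D"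
        show "fadd (fadd x ?y) (fdiff x ?y) c = fscale 2 x c"
          using op_fieldsD[OF lp_op_fields[OF xy(1)] c] op_fieldsD[OF lp_op_fields[OF ty] c] c
            fdiff_app[OF lp_op_fields[OF xy(1)] lp_op_fields[OF ty] c]
          by (auto simp: fadd_app fscale_app[of c 2] intro!: eq_matI)
      qed (use lp_op_fields[OF xy(1)] lp_op_fields[OF ty] in auto)
      hence "2 \<le> lp_norm p (fadd x ?y) + lp_norm p (fdiff x ?y)"
        using lp_add(2)[OF lp_add(1)[OF xy(1) ty p] lp_diff(1)[OF xy(1) ty p] p] lp_scale(3)[OF xy(1) p0, of 2] xy(3)
        by simp
      moreover have "lp_norm p (fadd x ?y) + lp_norm p (fdiff x ?y) \<le> 2 + 2 * (e / 2) * t"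
        using xy by (intro sm t) auto
      ultimately show ?thesis unfolding r' by (rule half)
    qed
    obtain u where u: "u \<in> lp p" "lp_norm p u = 1" using unit_vector_exists[OF p0] .
    hence ne: "S \<noteq> {}" unfolding S_def by auto
    have up: "Sup S \<le> e / 2 * t" using bounds by (intro cSup_least ne) auto
    obtain r where r: "r \<in> S" using ne by blast
    have "bdd_above S" using bounds by (intro bdd_aboveI[of _ "e / 2 * t"]) auto
    hence "r \<le> Sup S" using r by (rule cSup_upper[rotated])
    hence "0 \<le> Sup S" using bounds[OF r] by linarith
    hence "dist (Sup S / t) 0 = Sup S / t" using t by simp
    also have "\<dots> \<le> e / 2" using up t by (simp add: field_simps)
    also have "\<dots> < e" using e by simp
    finally show ?thesis unfolding modulus_of_smoothness_def S_def .
  qed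
  thus "\<forall>\<^sub>F t in at_right 0. dist (modulus_of_smoothness (lp_space p) t / t) 0 < e"
    using \<delta> by (auto simp: eventually_at_right_field)
qed

section \<open>Reflexivity\<close>

definition lp_functional :: "real \<Rightarrow> ('i \<Rightarrow> complex mat) \<Rightarrow> ('i \<Rightarrow> complex mat) \<Rightarrow> complex" where
  "lp_functional p K = (\<lambda>H \<in> lp p. pairing H K)"

lemma lp_functional_dual:
  assumes pq: "conjugate_exponents p q" and K: "K \<in> lp q"
  shows "lp_functional p K \<in> carrier (dual_space (lp_space p))"
    "mnorm (dual_space (lp_space p)) (lp_functional p K) \<le> lp_norm q K"
proof -
  note pqD = conjugate_exponentsD[OF pq]
  show "lp_functional p K \<in> carrier (dual_space (lp_space p))"
  proof (rule dual_spaceI[where C = "lp_norm q K"])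
    fix x y and a :: complex assume "x \<in> carrier (lp_space p)"
    hence x: "x \<in> lp p" by simp
    show "lp_functional p K (a \<odot>\<^bsub>lp_space p\<^esub> x) = a * lp_functional p K x"
      using pairing_scale_left[OF lp_op_fields[OF x] lp_op_fields[OF K]] x lp_scale(1)[OF x pqD(4)]
      by (simp add: lp_functional_def)
    show "cmod (lp_functional p K x) \<le> lp_norm q K * \<parallel>x\<parallel>\<^bsub>lp_space p\<^esub>"
      using Hoelder[OF x K pq] x by (simp add: lp_functional_def mult.commute)
    assume "y \<in> carrier (lp_space p)"
    hence y: "y \<in> lp p" by simp
    show "lp_functional p K (x \<oplus>\<^bsub>lp_space p\<^esub> y) = lp_functional p K x + lp_functional p K y"
      using pairing_add_left[OF x y K pq] x y lp_add(1)[OF x y pqD(1)] by (simp add: lp_functional_def)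
  qed (simp add: lp_functional_def)
  show "mnorm (dual_space (lp_space p)) (lp_functional p K) \<le> lp_norm q K"
    unfolding dual_space_sel
  proof (rule cSUP_least)
    show "{x \<in> carrier (lp_space p). \<parallel>x\<parallel>\<^bsub>lp_space p\<^esub> \<le> 1} \<noteq> {}"
      using lp_zero[OF pqD(4)] by auto
    fix x assume "x \<in> {x \<in> carrier (lp_space p). \<parallel>x\<parallel>\<^bsub>lp_space p\<^esub> \<le> 1}"
    hence x: "x \<in> lp p" "lp_norm p x \<le> 1" by auto
    have "cmod (lp_functional p K x) \<le> lp_norm p x * lp_norm q K"
      using Hoelder[OF x(1) K pq] x by (simp add: lp_functional_def)
    also have "\<dots> \<le> lp_norm q K" using x by (intro mult_left_le_one_le) auto
    finally show "cmod (lp_functional p K x) \<le> lp_norm q K" .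
  qed
qed

text \<open>
  The constant in the definition of boundedness need not be nonnegative, whence the absolute value
  in the proof.
\<close>

lemma lp_functional_surj:
  assumes pq: "conjugate_exponents p q" and f: "f \<in> carrier (dual_space (lp_space p))"
  obtains K where "K \<in> lp q" "f = lp_functional p K"
proof -
  note fD = dual_spaceD[OF f]
  obtain C where C: "\<And>x. x \<in> lp p \<Longrightarrow> cmod (f x) \<le> C * lp_norm p x" using fD(4) by auto
  have C': "cmod (f x) \<le> \<bar>C\<bar> * lp_norm p x" if "x \<in> lp p" for x
    using C[OF that] by (rule order_trans) (intro mult_right_mono, auto)
  have "f (fadd x y) = f x + f y" "f (fscale a x) = a * f x" if "x \<in> lp p" "y \<in> lp p" for x y a
    using fD(2,3)[of x] that by auto
  then obtain K where K: "K \<in> lp q" "\<And>H. H \<in> lp p \<Longrightarrow> f H = pairing H K"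
    using lp_dual_representation[OF pq abs_ge_zero, of f C] C' by metis
  have "f = lp_functional p K"
    by (rule extensionalityI[of _ "lp p"]) (use fD(1) K in \<open>auto simp: lp_functional_def\<close>)
  thus thesis using that K by blast
qed

lemma dual_norm_bound:
  assumes p: "1 < p" and f: "f \<in> carrier (dual_space (lp_space p))" and x: "x \<in> lp p"
  shows "cmod (f x) \<le> lp_norm p x * mnorm (dual_space (lp_space p)) f"
proof -
  note fD = dual_spaceD[OF f]
  have p0: "0 < p" using p by simp
  obtain C where C: "\<And>x. x \<in> lp p \<Longrightarrow> cmod (f x) \<le> C * lp_norm p x" using fD(4) by auto
  show ?thesis
  proof (cases "lp_norm p x = 0")
    case True
    thus ?thesis using C[OF x] by simp
  next
    case False
    hence n: "lp_norm p x > 0" using lp_norm_nonneg[of p x] by linarith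
    let ?u = "fscale (complex_of_real (1 / lp_norm p x)) x"
    have u: "?u \<in> lp p" "lp_norm p ?u = 1"
      using lp_scale[OF x p0, of "complex_of_real (1 / lp_norm p x)"] n by (auto simp: norm_divide)
    have bdd: "bdd_above ((\<lambda>x. cmod (f x)) ` {x \<in> carrier (lp_space p). \<parallel>x\<parallel>\<^bsub>lp_space p\<^esub> \<le> 1})"
    proof (rule bdd_aboveI2[where M = "\<bar>C\<bar>"])
      fix y assume "y \<in> {x \<in> carrier (lp_space p). \<parallel>x\<parallel>\<^bsub>lp_space p\<^esub> \<le> 1}"
      hence y: "y \<in> lp p" "lp_norm p y \<le> 1" by auto
      have "cmod (f y) \<le> \<bar>C\<bar> * lp_norm p y" using C[OF y(1)] by (rule order_trans) (intro mult_right_mono, auto)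
      also have "\<dots> \<le> \<bar>C\<bar>" using y by (intro mult_left_le) auto
      finally show "cmod (f y) \<le> \<bar>C\<bar>" .
    qed
    have "cmod (f ?u) \<le> mnorm (dual_space (lp_space p)) f"
      unfolding dual_space_sel by (rule cSUP_upper[OF _ bdd]) (use u in simp)
    moreover have "cmod (f ?u) = cmod (f x) / lp_norm p x"
    proof -
      have "f ?u = complex_of_real (1 / lp_norm p x) * f x" using fD(3)[of x "complex_of_real (1 / lp_norm p x)"] x by simp
      thus ?thesis using n by (simp only: norm_mult norm_of_real) simp
    qed
    ultimately show ?thesis using n by (simp add: pos_divide_le_eq mult.commute)
  qed
qed

text \<open>
  A functional \<open>\<Phi>\<close> on the dual gives the functional \<open>K \<mapsto> cnj (\<Phi> (lp_functional p K))\<close> on the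
  \<open>q\<close>-space; the conjugation restores linearity, since the pairing is conjugate-linear in its second
  argument. Its representing field \<open>H\<close> in the \<open>p\<close>-space satisfies \<open>\<Phi> f = f H\<close> for all \<open>f\<close>, as every
  \<open>f\<close> is of the form \<open>lp_functional p K\<close>.
\<close>

theorem reflexive_lp:
  assumes p: "1 < p"
  shows "reflexive_space (lp_space p)"
proof -
  define q where "q = p / (p - 1)"
  have pq: "conjugate_exponents p q" unfolding q_def by (rule conjugate_exponents_exists[OF p])
  note pqD = conjugate_exponentsD[OF pq] and qp = conjugate_exponents_sym[OF pq]
  let ?X = "lp_space p"
  let ?F = "lp_functional p"
  have dual_add: "add (dual_space ?X) (?F K) (?F L) = ?F (fadd K L)" if K: "K \<in> lp q" and L: "L \<in> lp q" for K L
  proof -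
    have "pairing H (fadd K L) = pairing H K + pairing H L" if H: "H \<in> lp p" for H
      using pairing_add_left[OF K L H qp] lp_op_fields[OF H] lp_op_fields[OF K] lp_op_fields[OF L]
      by (simp add: pairing_cnj[of _ H])
    thus ?thesis by (auto simp: dual_space_sel lp_functional_def fun_eq_iff restrict_def)
  qed
  have dual_scale: "smult (dual_space ?X) a (?F K) = ?F (fscale (cnj a) K)" if K: "K \<in> lp q" for a K
  proof -
    have "pairing H (fscale (cnj a) K) = a * pairing H K" if H: "H \<in> lp p" for H
      using pairing_scale_left[OF lp_op_fields[OF K] lp_op_fields[OF H], of "cnj a"] lp_op_fields[OF H] lp_op_fields[OF K]
      by (simp add: pairing_cnj[of _ H])
    thus ?thesis by (auto simp: dual_space_sel lp_functional_def fun_eq_iff restrict_def)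
  qed
  show ?thesis
    unfolding reflexive_space_def
  proof (intro equalityI subsetI)
    fix \<Phi> assume "\<Phi> \<in> canonical_embedding ?X ` carrier ?X"
    then obtain H where H: "H \<in> lp p" and \<Phi>: "\<Phi> = (\<lambda>f \<in> carrier (dual_space ?X). f H)"
      by (auto simp: canonical_embedding_def)
    show "\<Phi> \<in> carrier (dual_space (dual_space ?X))"
    proof (rule dual_spaceI[where C = "lp_norm p H"])
      fix f g and a :: complex assume f: "f \<in> carrier (dual_space ?X)"
      obtain K where K: "K \<in> lp q" "f = ?F K" using lp_functional_surj[OF pq f] .
      have "smult (dual_space ?X) a f \<in> carrier (dual_space ?X)"
        unfolding K(2) dual_scale[OF K(1)] by (intro lp_functional_dual[OF pq] lp_scale K pqD)
      thus "\<Phi> (a \<odot>\<^bsub>dual_space ?X\<^esub> f) = a * \<Phi> f" using f H by (simp add: \<Phi> dual_space_sel)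
      show "cmod (\<Phi> f) \<le> lp_norm p H * \<parallel>f\<parallel>\<^bsub>dual_space ?X\<^esub>"
        using dual_norm_bound[OF p f H] f by (simp add: \<Phi>)
      assume g: "g \<in> carrier (dual_space ?X)"
      obtain L where L: "L \<in> lp q" "g = ?F L" using lp_functional_surj[OF pq g] .
      have "add (dual_space ?X) f g \<in> carrier (dual_space ?X)"
        unfolding K(2) L(2) dual_add[OF K(1) L(1)] by (intro lp_functional_dual[OF pq] lp_add K L pqD)
      thus "\<Phi> (f \<oplus>\<^bsub>dual_space ?X\<^esub> g) = \<Phi> f + \<Phi> g" using f g H by (simp add: \<Phi> dual_space_sel)
    qed (simp add: \<Phi>)
  next
    fix \<Phi> assume \<Phi>: "\<Phi> \<in> carrier (dual_space (dual_space ?X))"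
    note \<Phi>D = dual_spaceD[OF \<Phi>]
    note F = lp_functional_dual[OF pq]
    obtain C where C: "\<And>f. f \<in> carrier (dual_space ?X) \<Longrightarrow> cmod (\<Phi> f) \<le> C * \<parallel>f\<parallel>\<^bsub>dual_space ?X\<^esub>"
      using \<Phi>D(4) by auto
    define \<psi> where "\<psi> K = cnj (\<Phi> (?F K))" for K
    have "\<psi> (fadd K L) = \<psi> K + \<psi> L" if "K \<in> lp q" "L \<in> lp q" for K L
      using \<Phi>D(2)[OF F(1)[OF that(1)] F(1)[OF that(2)]] by (simp add: \<psi>_def dual_add[OF that])
    moreover have "\<psi> (fscale a K) = a * \<psi> K" if "K \<in> lp q" for a K
      using \<Phi>D(3)[OF F(1)[OF that], of "cnj a"] by (simp add: \<psi>_def dual_scale[OF that])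
    moreover have "cmod (\<psi> K) \<le> \<bar>C\<bar> * lp_norm q K" if K: "K \<in> lp q" for K
    proof -
      obtain H0 where H0: "H0 \<in> lp p" "lp_norm p H0 = 1" using unit_vector_exists[OF pqD(4)] .
      have "0 \<le> cmod (?F K H0)" by simp
      also have "\<dots> \<le> 1 * mnorm (dual_space ?X) (?F K)"
        using dual_norm_bound[OF p F(1)[OF K] H0(1)] H0(2) by simp
      finally have n: "0 \<le> mnorm (dual_space ?X) (?F K)" by simp
      have "cmod (\<psi> K) \<le> C * mnorm (dual_space ?X) (?F K)" using C[OF F(1)[OF K]] by (simp add: \<psi>_def)
      also have "\<dots> \<le> \<bar>C\<bar> * mnorm (dual_space ?X) (?F K)" using n by (intro mult_right_mono) auto
      also have "\<dots> \<le> \<bar>C\<bar> * lp_norm q K" using F(2)[OF K] by (intro mult_left_mono) auto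
      finally show ?thesis .
    qed
    ultimately obtain H where H: "H \<in> lp p" "\<And>K. K \<in> lp q \<Longrightarrow> \<psi> K = pairing K H"
      using lp_dual_representation[OF qp abs_ge_zero, of \<psi> C] by metis
    have "\<Phi> = canonical_embedding ?X H"
    proof (rule extensionalityI[of _ "carrier (dual_space ?X)"])
      fix f assume f: "f \<in> carrier (dual_space ?X)"
      obtain K where K: "K \<in> lp q" "f = ?F K" using lp_functional_surj[OF pq f] .
      have "\<Phi> f = cnj (\<psi> K)" by (simp add: \<psi>_def K(2))
      also have "\<dots> = pairing H K"
        using H(2)[OF K(1)] pairing_cnj[OF lp_op_fields[OF K(1)] lp_op_fields[OF H(1)]] by simp
      finally show "\<Phi> f = canonical_embedding ?X H f"
        using f H(1) by (simp add: canonical_embedding_def K(2) lp_functional_def)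
    qed (use \<Phi>D(1) in \<open>auto simp: canonical_embedding_def\<close>)
    thus "\<Phi> \<in> canonical_embedding ?X ` carrier ?X" using H(1) by auto
  qed
qed

end

section \<open>The unitary dual of a compact group\<close>

lemma one_dim_subspace:
  assumes "VectorSpace.subspace class_ring W (module_vec TYPE(complex) 1)"
  shows "W = {0\<^sub>v 1} \<or> W = carrier_vec 1"
proof -
  interpret V: vectorspace class_ring "module_vec TYPE(complex) 1" by (rule vec_vs)
  interpret W: VectorSpace.subspace class_ring W "module_vec TYPE(complex) 1" by fact
  have sub: "submodule class_ring W (module_vec TYPE(complex) 1)" using assms by (simp add: subspace_def)
  have Wc: "W \<subseteq> carrier_vec 1" using sub by (auto simp: submodule_def module_vec_def)
  have sm: "a \<cdot>\<^sub>v w \<in> W" if "w \<in> W" for a w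
    using sub that by (auto simp: submodule_def module_vec_def class_ring_simps)
  have W0: "0\<^sub>v 1 \<in> W" using sub by (auto simp: submodule_def module_vec_def)
  show ?thesis
  proof (cases "W = {0\<^sub>v 1}")
    case False
    then obtain w where w: "w \<in> W" "w \<noteq> 0\<^sub>v 1" using W0 by blast
    have wc: "w \<in> carrier_vec 1" using w(1) Wc by auto
    have w0: "w $ 0 \<noteq> 0"
    proof
      assume "w $ 0 = 0"
      hence "w = 0\<^sub>v 1" using wc by (intro eq_vecI) auto
      thus False using w(2) by simp
    qed
    have "v \<in> W" if v: "v \<in> carrier_vec 1" for v
    proof -
      have "v = (v $ 0 / w $ 0) \<cdot>\<^sub>v w" by (rule eq_vecI) (use v wc w0 in auto)
      thus ?thesis using sm[OF w(1)] by metis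
    qed
    thus ?thesis using Wc by blast
  qed simp
qed

text \<open>
  The trivial representation on \<open>\<complex>\<close> is irreducible.
\<close>

lemma unitary_dual_nonempty:
  assumes "topological_group G T"
  shows "unitary_dual G T \<noteq> {}"
proof -
  interpret topological_group G T by fact
  define \<pi> where "\<pi> = (\<lambda>g \<in> carrier G. 1\<^sub>m 1 :: complex mat)"
  have one: "1\<^sub>m 1 \<in> carrier (unitary_group 1)" by (rule unitary_groupI) (auto intro!: eq_matI)
  have "\<pi> \<in> hom G (unitary_group 1)"
    using one by (auto simp: hom_def \<pi>_def unitary_group_def)
  moreover have "continuous_map T euclidean (\<lambda>g. vec_index (\<pi> g *\<^sub>v v) i)"
    if "v \<in> carrier_vec 1" "i < 1" for v i
  proof (rule continuous_map_eq[where f = "\<lambda>g. v $ i"])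
    show "continuous_map T euclidean (\<lambda>g. v $ i)" by simp
    show "v $ i = vec_index (\<pi> g *\<^sub>v v) i" if "g \<in> topspace T" for g
      using that \<open>v \<in> carrier_vec 1\<close> by (simp add: \<pi>_def topspace_eq)
  qed
  ultimately have "unitary_rep G T 1 \<pi>" by (auto simp: unitary_rep_def \<pi>_def)
  moreover have "irreducible_rep G 1 \<pi>"
    using one_dim_subspace by (auto simp: irreducible_rep_def)
  ultimately have "(1, \<pi>) \<in> irreps G T" by (simp add: irreps_def)
  thus ?thesis unfolding unitary_dual_def quotient_def by blast
qed

lemma rep_dim_pos:
  assumes "choice_of_reps G T \<xi>" "c \<in> unitary_dual G T"
  shows "0 < rep_dim (\<xi> c)"
proof -
  have "\<xi> c \<in> c" using assms by (simp add: choice_of_reps_def)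
  hence "\<xi> c \<in> irreps G T"
    using assms(2) by (auto simp: unitary_dual_def quotient_def unitary_equivalence_def)
  thus ?thesis by (auto simp: irreps_def irreducible_rep_def)
qed

theorem theorem3p7:
  fixes G :: "('g, 'm) monoid_scheme"
    and T :: "'g topology"
    and \<xi> :: "'g rep set \<Rightarrow> 'g rep"
    and p :: real
  assumes "compact_topological_group G T"
    and "choice_of_reps G T \<xi>"
    and "1 < p"
  shows "complex_banach_space (ell_sch G T \<xi> p) \<and>
         uniformly_convex (ell_sch G T \<xi> p) \<and>
         uniformly_smooth (ell_sch G T \<xi> p) \<and>
         reflexive_space (ell_sch G T \<xi> p)"
proof -
  interpret schatten_sum "unitary_dual G T" "\<lambda>c. rep_dim (\<xi> c)"
    using unitary_dual_nonempty compact_topological_group.axioms(1)[OF assms(1)] rep_dim_pos[OF assms(2)]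
    by unfold_locales auto
  have "ell_sch G T \<xi> p = lp_space p"
    unfolding ell_sch_def operator_fields_def lp_space_def lp_def op_fields_def fzero_def
      lp_norm_def[abs_def] energy_def local_energy_def[abs_def] schatten_energy_def
      fadd_def[abs_def] fscale_def[abs_def]
    by simp
  thus ?thesis
    using complex_banach_space_lp uniformly_convex_lp uniformly_smooth_lp reflexive_lp assms(3) by simp
qed

end
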